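(* Let $K$ be a compact convex subset of a locally convex vector space, and let $\mu\in M^+(K)$ be a measure with corresponding GNS representation $\pi_\mu:\mathrm{C}(K)\to\mathcal{B}(L^2(\mu))$. Then $\mu$ is maximal in the dilation order if and only if $\pi_\mu$ has the unique extension property relative to $A(K)$.
   Context: $\mathrm{C}(K)$ is the C*-algebra of continuous complex-valued functions on $K$, and $A(K)\subset\mathrm{C}(K)$ is the space of continuous affine functions. $M^+(K)$ is the set of (finite) positive regular Borel measures on $K$; $\mu(f)=\int_K f\,d\mu$. The GNS representation of $\mu$ is $(\pi_\mu,L^2(\mu),1_\mu)$, where $\pi_\mu(f)h=fh$ and $1_\mu$ is the constant function $1$ in $L^2(\mu)$. A representation of $\mu\in M^+(K)$ is a tuple $(\pi,H,\xi)$ consisting of a $*$-representation $\pi:\mathrm{C}(K)\to\mathcal{B}(H)$ on a Hilbert space $H$ and a vector $\xi\in H$ with $\mu(f)=\langle\pi(f)\xi,\xi\rangle$ for all $f\in\mathrm{C}(K)$. A representation $(\pi,H,\xi)$ of $\mu$ is dilated by a representation $(\sigma,L,\eta)$ of $\nu$ if there is an isometry $V:H\to L$ such that $\pi(a)=V^*\sigma(a)V$ for every $a\in A(K)$ and $\eta=V\xi$. The dilation order: $\mu\prec_d\nu$ if some representation of $\mu$ is dilated by a representation of $\nu$. A measure $\mu\in M^+(K)$ is maximal in the dilation order if $\mu\prec_d\nu$ with $\nu\in M^+(K)$ implies $\nu=\mu$. Unique extension property: $A(K)$ generates $\mathrm{C}(K)$ as a C*-algebra. A $*$-representation $\pi:\mathrm{C}(K)\to\mathcal{B}(H)$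 has the unique extension property relative to $A(K)$ if the restriction $\pi|_{A(K)}$ has a unique completely positive extension $\mathrm{C}(K)\to\mathcal{B}(H)$ (which is then the $*$-homomorphism $\pi$). *)

theory Defs
  imports "HOL-Analysis.Analysis" "HOL-Algebra.Module"
begin

section \<open>Locally convex spaces, continuous functions and affine functions\<close>

text \<open>Real locally convex Hausdorff topological vector spaces.  A complex space is covered by
  its underlying real space, since compactness and convexity only depend on the latter.
  The constant \<^const>\<open>convex\<close> cannot occur in a class specification, so its definition is
  unfolded there.\<close>

class locally_convex_space = real_vector + t2_space + topological_ab_group_add +
  assumes tendsto_scaleR_Pair:
    "LIM x (nhds c \<times>\<^sub>F nhds a). fst x *\<^sub>R snd x :> nhds (c *\<^sub>R a)"
  and convex_nhds_zero:
    "open U \<Longrightarrow> 0 \<in> U \<Longrightarrow> \<exists>W. open W \<and> 0 \<in> W \<and> W \<subseteq> U \<and>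
      (\<forall>x\<in>W. \<forall>y\<in>W. \<forall>u\<ge>0. \<forall>v\<ge>0. u + v = 1 \<longrightarrow> u *\<^sub>R x + v *\<^sub>R y \<in> W)"

lemma locally_convex_zero:
  fixes U :: "'a::locally_convex_space set"
  assumes "open U" and "0 \<in> U"
  shows "\<exists>W. open W \<and> convex W \<and> 0 \<in> W \<and> W \<subseteq> U"
  using convex_nhds_zero[OF assms] unfolding convex_def by blast

text \<open>Functions on \<open>K\<close> are represented extensionally, so that equality in \<open>cont_fun K\<close> is
  equality on \<open>K\<close>.  The operations of the C*-algebra are the pointwise ones, restricted to \<open>K\<close>.\<close>

definition cont_fun :: "'a::topological_space set \<Rightarrow> ('a \<Rightarrow> complex) set" where
  "cont_fun K = {f \<in> extensional K. continuous_on K f}"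

definition cont_affine :: "'a::locally_convex_space set \<Rightarrow> ('a \<Rightarrow> complex) set" where
  "cont_affine K = {f \<in> cont_fun K. \<forall>x\<in>K. \<forall>y\<in>K. \<forall>t\<in>{0..1}.
     f ((1 - t) *\<^sub>R x + t *\<^sub>R y) = (1 - t) *\<^sub>R f x + t *\<^sub>R f y}"

text \<open>The set $M^+(K)$ of finite positive regular Borel measures on \<open>K\<close>.\<close>

definition pos_measures :: "'a::topological_space set \<Rightarrow> 'a measure set" where
  "pos_measures K = {\<mu>. sets \<mu> = sets (restrict_space borel K) \<and> finite_measure \<mu> \<and>
     (\<forall>A\<in>sets \<mu>.
        emeasure \<mu> A = (SUP C\<in>{C. C \<subseteq> A \<and> compact C}. emeasure \<mu> C) \<and>
        emeasure \<mu> A = (INF U\<in>{U. A \<subseteq> U \<and> open U}. emeasure \<mu> (U \<inter> K)))}"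


section \<open>Complex Hilbert spaces and bounded operators\<close>

definition complex_ring :: "complex ring" where
  "complex_ring = \<lparr>carrier = UNIV, mult = (*), one = 1, zero = 0, add = (+)\<rparr>"

text \<open>Hilbert spaces have an explicit carrier, because the dilation order quantifies over Hilbert
  spaces.  The ring multiplication and unit fields inherited from \<open>module\<close> are irrelevant.\<close>

record 'h inner_module = "(complex, 'h) module" +
  cinner :: "'h \<Rightarrow> 'h \<Rightarrow> complex"

definition hnorm :: "('h, 'm) inner_module_scheme \<Rightarrow> 'h \<Rightarrow> real" where
  "hnorm H x = sqrt (Re (cinner H x x))"

text \<open>The value outside the carrier is fixed since \<open>Metric_space\<close> demands symmetry and
  nonnegativity on the whole type.\<close>

definition hdist :: "('h, 'm) inner_module_scheme \<Rightarrow> 'h \<Rightarrow> 'h \<Rightarrow> real" where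
  "hdist H x y = (if x \<in> carrier H \<and> y \<in> carrier H then hnorm H (x \<ominus>\<^bsub>H\<^esub> y) else 0)"

text \<open>The inner product is linear in the first argument.\<close>

locale complex_hilbert_space = module complex_ring H
  for H :: "('h, 'm) inner_module_scheme" (structure) +
  assumes cinner_add_left:
      "\<lbrakk>x \<in> carrier H; y \<in> carrier H; z \<in> carrier H\<rbrakk>
        \<Longrightarrow> cinner H (x \<oplus>\<^bsub>H\<^esub> y) z = cinner H x z + cinner H y z"
    and cinner_smult_left:
      "\<lbrakk>x \<in> carrier H; y \<in> carrier H\<rbrakk> \<Longrightarrow> cinner H (c \<odot>\<^bsub>H\<^esub> x) y = c * cinner H x y"
    and cinner_commute:
      "\<lbrakk>x \<in> carrier H; y \<in> carrier H\<rbrakk> \<Longrightarrow> cinner H y x = cnj (cinner H x y)"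
    and cinner_nonneg: "x \<in> carrier H \<Longrightarrow> 0 \<le> Re (cinner H x x)"
    and cinner_definite: "x \<in> carrier H \<Longrightarrow> cinner H x x = 0 \<Longrightarrow> x = \<zero>\<^bsub>H\<^esub>"
    and complete: "Metric_space.mcomplete (carrier H) (hdist H)"

text \<open>Operators are extensional on the carrier of their domain.\<close>

definition bounded_ops ::
  "('h, 'm) inner_module_scheme \<Rightarrow> ('l, 'n) inner_module_scheme \<Rightarrow> ('h \<Rightarrow> 'l) set" where
  "bounded_ops H L = {T \<in> carrier H \<rightarrow>\<^sub>E carrier L.
     (\<forall>x\<in>carrier H. \<forall>y\<in>carrier H. T (x \<oplus>\<^bsub>H\<^esub> y) = T x \<oplus>\<^bsub>L\<^esub> T y) \<and>
     (\<forall>c. \<forall>x\<in>carrier H. T (c \<odot>\<^bsub>H\<^esub> x) = c \<odot>\<^bsub>L\<^esub> T x) \<and>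
     (\<exists>B. \<forall>x\<in>carrier H. hnorm L (T x) \<le> B * hnorm H x)}"

definition hadjoint ::
  "('h, 'm) inner_module_scheme \<Rightarrow> ('l, 'n) inner_module_scheme \<Rightarrow> ('h \<Rightarrow> 'l) \<Rightarrow> 'l \<Rightarrow> 'h" where
  "hadjoint H L T = (THE S. S \<in> bounded_ops L H \<and>
     (\<forall>x\<in>carrier H. \<forall>y\<in>carrier L. cinner L (T x) y = cinner H x (S y)))"

definition isometries ::
  "('h, 'm) inner_module_scheme \<Rightarrow> ('l, 'n) inner_module_scheme \<Rightarrow> ('h \<Rightarrow> 'l) set" where
  "isometries H L = {V \<in> bounded_ops H L. \<forall>x\<in>carrier H. hnorm L (V x) = hnorm H x}"


section \<open>Linear maps on the algebra of continuous functions\<close>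

definition linear_op_map ::
  "'a::topological_space set \<Rightarrow> ('h, 'm) inner_module_scheme \<Rightarrow> (('a \<Rightarrow> complex) \<Rightarrow> 'h \<Rightarrow> 'h) \<Rightarrow> bool"
where
  "linear_op_map K H \<Phi> \<longleftrightarrow> \<Phi> \<in> cont_fun K \<rightarrow> bounded_ops H H \<and>
     (\<forall>f\<in>cont_fun K. \<forall>g\<in>cont_fun K.
        \<Phi> (\<lambda>x\<in>K. f x + g x) = (\<lambda>h\<in>carrier H. \<Phi> f h \<oplus>\<^bsub>H\<^esub> \<Phi> g h)) \<and>
     (\<forall>c. \<forall>f\<in>cont_fun K. \<Phi> (\<lambda>x\<in>K. c * f x) = (\<lambda>h\<in>carrier H. c \<odot>\<^bsub>H\<^esub> \<Phi> f h))"

definition star_rep ::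
  "'a::topological_space set \<Rightarrow> ('h, 'm) inner_module_scheme \<Rightarrow> (('a \<Rightarrow> complex) \<Rightarrow> 'h \<Rightarrow> 'h) \<Rightarrow> bool"
where
  "star_rep K H \<pi> \<longleftrightarrow> linear_op_map K H \<pi> \<and>
     (\<forall>f\<in>cont_fun K. \<forall>g\<in>cont_fun K.
        \<pi> (\<lambda>x\<in>K. f x * g x) = compose (carrier H) (\<pi> f) (\<pi> g)) \<and>
     (\<forall>f\<in>cont_fun K. \<pi> (\<lambda>x\<in>K. cnj (f x)) = hadjoint H H (\<pi> f))"

text \<open>\<open>F\<close> is a positive element of the C*-algebra $M_n(C(K))$, i.e. $F = G^*G$ for some matrix
  \<open>G\<close>.  Only entries with indices below \<open>n\<close> matter.\<close>

definition pos_cont_matrix ::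
  "'a::topological_space set \<Rightarrow> nat \<Rightarrow> (nat \<Rightarrow> nat \<Rightarrow> 'a \<Rightarrow> complex) \<Rightarrow> bool" where
  "pos_cont_matrix K n F \<longleftrightarrow> (\<exists>G. (\<forall>i<n. \<forall>j<n. G i j \<in> cont_fun K) \<and>
     (\<forall>i<n. \<forall>j<n. F i j = (\<lambda>x\<in>K. \<Sum>k<n. cnj (G k i x) * G k j x)))"

text \<open>The operator matrix \<open>T\<close> is a positive operator on the direct sum of \<open>n\<close> copies of \<open>H\<close>.\<close>

definition pos_op_matrix ::
  "('h, 'm) inner_module_scheme \<Rightarrow> nat \<Rightarrow> (nat \<Rightarrow> nat \<Rightarrow> 'h \<Rightarrow> 'h) \<Rightarrow> bool" where
  "pos_op_matrix H n T \<longleftrightarrow> (\<forall>h. (\<forall>i<n. h i \<in> carrier H) \<longrightarrow>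
     (\<Sum>i<n. \<Sum>j<n. cinner H (T i j (h j)) (h i)) \<in> \<real>\<^sub>\<ge>\<^sub>0)"

definition completely_positive ::
  "'a::topological_space set \<Rightarrow> ('h, 'm) inner_module_scheme \<Rightarrow> (('a \<Rightarrow> complex) \<Rightarrow> 'h \<Rightarrow> 'h) \<Rightarrow> bool"
where
  "completely_positive K H \<Phi> \<longleftrightarrow> linear_op_map K H \<Phi> \<and>
     (\<forall>n F. pos_cont_matrix K n F \<longrightarrow> pos_op_matrix H n (\<lambda>i j. \<Phi> (F i j)))"

text \<open>Maps on \<open>cont_fun K\<close> are taken extensional, so uniqueness means uniqueness on \<open>cont_fun K\<close>.\<close>

definition unique_extension_property ::
  "'a::locally_convex_space set \<Rightarrow> ('h, 'm) inner_module_scheme \<Rightarrow>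
     (('a \<Rightarrow> complex) \<Rightarrow> 'h \<Rightarrow> 'h) \<Rightarrow> bool"
where
  "unique_extension_property K H \<pi> \<longleftrightarrow>
     (\<exists>!\<Phi>. \<Phi> \<in> extensional (cont_fun K) \<and> completely_positive K H \<Phi> \<and>
        (\<forall>a\<in>cont_affine K. \<Phi> a = \<pi> a))"


section \<open>The dilation order\<close>

definition measure_rep ::
  "'a::topological_space set \<Rightarrow> 'a measure \<Rightarrow> ('h, 'm) inner_module_scheme \<Rightarrow>
     (('a \<Rightarrow> complex) \<Rightarrow> 'h \<Rightarrow> 'h) \<Rightarrow> 'h \<Rightarrow> bool"
where
  "measure_rep K \<mu> H \<pi> \<xi> \<longleftrightarrow> complex_hilbert_space H \<and> star_rep K H \<pi> \<and> \<xi> \<in> carrier H \<and>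
     (\<forall>f\<in>cont_fun K. (LINT x|\<mu>. f x) = cinner H (\<pi> f \<xi>) \<xi>)"

definition dilated_by ::
  "'a::locally_convex_space set \<Rightarrow>
   ('h, 'm) inner_module_scheme \<Rightarrow> (('a \<Rightarrow> complex) \<Rightarrow> 'h \<Rightarrow> 'h) \<Rightarrow> 'h \<Rightarrow>
   ('l, 'n) inner_module_scheme \<Rightarrow> (('a \<Rightarrow> complex) \<Rightarrow> 'l \<Rightarrow> 'l) \<Rightarrow> 'l \<Rightarrow> bool"
where
  "dilated_by K H \<pi> \<xi> L \<sigma> \<eta> \<longleftrightarrow> (\<exists>V\<in>isometries H L.
     (\<forall>a\<in>cont_affine K.
        \<pi> a = compose (carrier H) (hadjoint H L V) (compose (carrier H) (\<sigma> a) V)) \<and>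
     \<eta> = V \<xi>)"

text \<open>HOL cannot quantify over types inside a formula, so the type \<open>'h\<close> of the elements of
  the Hilbert spaces ranged over is a parameter.\<close>

definition dilation_le ::
  "'h itself \<Rightarrow> 'a::locally_convex_space set \<Rightarrow> 'a measure \<Rightarrow> 'a measure \<Rightarrow> bool" where
  "dilation_le (_ :: 'h itself) K \<mu> \<nu> \<longleftrightarrow>
     (\<exists>(H :: 'h inner_module) \<pi> \<xi> (L :: 'h inner_module) \<sigma> \<eta>.
        measure_rep K \<mu> H \<pi> \<xi> \<and> measure_rep K \<nu> L \<sigma> \<eta> \<and> dilated_by K H \<pi> \<xi> L \<sigma> \<eta>)"

definition dilation_maximal ::
  "'h itself \<Rightarrow> 'a::locally_convex_space set \<Rightarrow> 'a measure \<Rightarrow> bool" where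
  "dilation_maximal U K \<mu> \<longleftrightarrow> (\<forall>\<nu>\<in>pos_measures K. dilation_le U K \<mu> \<nu> \<longrightarrow> \<nu> = \<mu>)"


section \<open>The GNS representation of a measure\<close>

definition sq_integrable :: "'a measure \<Rightarrow> ('a \<Rightarrow> complex) set" where
  "sq_integrable \<mu> = {f \<in> borel_measurable \<mu>. integrable \<mu> (\<lambda>x. (cmod (f x))\<^sup>2)}"

definition L2_class :: "'a measure \<Rightarrow> ('a \<Rightarrow> complex) \<Rightarrow> ('a \<Rightarrow> complex) set" where
  "L2_class \<mu> f = {g \<in> sq_integrable \<mu>. AE x in \<mu>. g x = f x}"

definition L2_repr :: "('a \<Rightarrow> complex) set \<Rightarrow> 'a \<Rightarrow> complex" where
  "L2_repr X = (SOME f. f \<in> X)"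

definition L2 :: "'a measure \<Rightarrow> ('a \<Rightarrow> complex) set inner_module" where
  "L2 \<mu> = \<lparr>carrier = L2_class \<mu> ` sq_integrable \<mu>,
     mult = undefined, one = undefined,
     zero = L2_class \<mu> (\<lambda>_. 0),
     add = (\<lambda>X Y. L2_class \<mu> (\<lambda>x. L2_repr X x + L2_repr Y x)),
     smult = (\<lambda>c X. L2_class \<mu> (\<lambda>x. c * L2_repr X x)),
     cinner = (\<lambda>X Y. LINT x|\<mu>. L2_repr X x * cnj (L2_repr Y x))\<rparr>"

definition gns_rep ::
  "'a::topological_space set \<Rightarrow> 'a measure \<Rightarrow>
     ('a \<Rightarrow> complex) \<Rightarrow> ('a \<Rightarrow> complex) set \<Rightarrow> ('a \<Rightarrow> complex) set" where
  "gns_rep K \<mu> = (\<lambda>f\<in>cont_fun K. \<lambda>X\<in>carrier (L2 \<mu>). L2_class \<mu> (\<lambda>x. f x * L2_repr X x))"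

end

theory Submission
  imports Defs
begin

text \<open>
  Let \<open>\<mu>\<close> be a measure on the compact convex set \<open>K\<close>.  Both notions in the theorem speak about
  extending a map from the affine functions \<open>A(K)\<close> to \<open>C(K)\<close>, and the bridge between them is that
  completely positive maps on \<open>C(K)\<close> are exactly the compressions of representations.

  Suppose that the GNS representation \<open>\<pi>\<^sub>\<mu>\<close> has the unique extension property and that a
  representation \<open>\<pi>\<close> of \<open>\<mu>\<close> with vector \<open>\<xi>\<close> is dilated through \<open>V\<close> by a representation \<open>\<sigma>\<close> of \<open>\<nu>\<close>.
  The vectors \<open>\<pi>(f)\<xi>\<close> have the same inner products as the functions \<open>f\<close> in \<open>L\<^sup>2(\<mu>)\<close>, so they
  define an isometry \<open>W\<close> that intertwines \<open>\<pi>\<^sub>\<mu>\<close> and \<open>\<pi>\<close>.  The compression of \<open>\<sigma>\<close> along \<open>V W\<close> is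
  completely positive and agrees with \<open>\<pi>\<^sub>\<mu>\<close> on \<open>A(K)\<close>, hence it is \<open>\<pi>\<^sub>\<mu>\<close>; evaluated at the constant
  function \<open>1\<close> this says that \<open>\<mu>\<close> and \<open>\<nu>\<close> have the same integrals of continuous functions, so they
  coincide by regularity (\<open>maximal_if_unique_extension\<close>, \<open>pos_measure_eqI\<close>).

  Conversely, let \<open>\<mu>\<close> be maximal and let \<open>\<Phi>\<close> be a completely positive map that agrees with \<open>\<pi>\<^sub>\<mu>\<close> on
  \<open>A(K)\<close>.  By the Riesz--Markov theorem \<open>f \<mapsto> \<langle>\<Phi>(f)1, 1\<rangle>\<close> is integration against a measure \<open>\<nu>\<close>.  The
  Stinespring space of \<open>\<Phi>\<close> is a completion of \<open>C(K) \<otimes> C(K)\<close> in which \<open>\<langle>f \<otimes> g, f' \<otimes> g'\<rangle>\<close> is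
  \<open>\<langle>\<Phi>(cnj f' * f) g, g'\<rangle>\<close>.  The same construction for \<open>\<pi>\<^sub>\<mu>\<close> gives a copy of \<open>L\<^sup>2(\<mu>)\<close>, and mapping
  \<open>1 \<otimes> g\<close> to \<open>1 \<otimes> g\<close> exhibits the representation of \<open>\<nu>\<close> as a dilation of that of \<open>\<mu>\<close>.  Maximality
  yields \<open>\<nu> = \<mu>\<close>, that is, \<open>\<langle>\<Phi>(f)1, 1\<rangle>\<close> is the integral of \<open>f\<close> against \<open>\<mu>\<close> for every \<open>f\<close>.
  Consequently both \<open>f \<otimes> 1\<close> and \<open>1 \<otimes> f\<close> have the length of \<open>f\<close> in \<open>L\<^sup>2(\<mu>)\<close>.  If they agree for
  \<open>p\<close> and \<open>a\<close> is affine, then \<open>a p \<otimes> 1 = a \<otimes> p\<close> has inner product \<open>\<langle>\<Phi>(a) p, a p\<rangle> = \<parallel>a p\<parallel>\<^sup>2\<close> with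
  \<open>1 \<otimes> a p\<close>, which forces equality for \<open>a p\<close>.  Affine functions separate the points of \<open>K\<close> by the
  Hahn--Banach theorem, so the Stone--Weierstrass theorem extends the equality to all of \<open>C(K)\<close>
  (\<open>cont_fun_if_affine_module\<close>).  Then \<open>f \<otimes> g = f g \<otimes> 1 = 1 \<otimes> f g\<close>, which means that
  \<open>\<Phi>(f) g = f g\<close> (\<open>eq_gns_if_func_eq\<close>); the density of \<open>C(K)\<close> in \<open>L\<^sup>2(\<mu>)\<close> finishes the proof.

  The Stinespring space is a space of functions on pairs of elements of \<open>C(K)\<close>, namely the
  Hilbert space with a prescribed reproducing kernel.  This realisation makes it small enough to be
  coded in every type that contains a copy of the sets of complex functions (\<open>kernel_encoding\<close>),
  which is what the dilation order over a fixed type of vectors requires.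
\<close>


section \<open>Semi-inner product spaces\<close>

text \<open>Hilbert spaces satisfy these axioms, and so do the formal linear combinations from which one is
  built by completion, although their addition is concatenation of lists.  For this reason every
  identity below is one of norms or of inner products.\<close>

locale semi_inner =
  fixes S :: "'v set" and add :: "'v \<Rightarrow> 'v \<Rightarrow> 'v" and scal :: "complex \<Rightarrow> 'v \<Rightarrow> 'v"
    and ip :: "'v \<Rightarrow> 'v \<Rightarrow> complex"
  assumes add_closed [simp]: "x \<in> S \<Longrightarrow> y \<in> S \<Longrightarrow> add x y \<in> S"
    and scal_closed [simp]: "x \<in> S \<Longrightarrow> scal c x \<in> S"
    and ip_add_left [simp]: "x \<in> S \<Longrightarrow> y \<in> S \<Longrightarrow> z \<in> S \<Longrightarrow> ip (add x y) z = ip x z + ip y z"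
    and ip_scal_left [simp]: "x \<in> S \<Longrightarrow> y \<in> S \<Longrightarrow> ip (scal c x) y = c * ip x y"
    and ip_commute: "x \<in> S \<Longrightarrow> y \<in> S \<Longrightarrow> ip y x = cnj (ip x y)"
    and ip_nonneg: "x \<in> S \<Longrightarrow> 0 \<le> Re (ip x x)"
begin

definition sub :: "'v \<Rightarrow> 'v \<Rightarrow> 'v" where "sub x y = add x (scal (-1) y)"
definition nm :: "'v \<Rightarrow> real" where "nm x = sqrt (Re (ip x x))"

definition cauchy :: "(nat \<Rightarrow> 'v) \<Rightarrow> bool" where
  "cauchy s \<longleftrightarrow> (\<forall>n. s n \<in> S) \<and> (\<forall>e>0. \<exists>N. \<forall>m\<ge>N. \<forall>n\<ge>N. nm (sub (s m) (s n)) < e)"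

lemma sub_closed [simp]: "x \<in> S \<Longrightarrow> y \<in> S \<Longrightarrow> sub x y \<in> S"
  by (simp add: sub_def)

lemma ip_add_right [simp]:
  assumes "x \<in> S" "y \<in> S" "z \<in> S" shows "ip x (add y z) = ip x y + ip x z"
  using assms ip_commute[of "add y z" x] ip_commute[of y x] ip_commute[of z x] by simp

lemma ip_scal_right [simp]:
  assumes "x \<in> S" "y \<in> S" shows "ip x (scal c y) = cnj c * ip x y"
  using assms ip_commute[of "scal c y" x] ip_commute[of y x] by simp

lemma ip_sub_left [simp]: "x \<in> S \<Longrightarrow> y \<in> S \<Longrightarrow> z \<in> S \<Longrightarrow> ip (sub x y) z = ip x z - ip y z"
  by (simp add: sub_def)

lemma ip_sub_right [simp]: "x \<in> S \<Longrightarrow> y \<in> S \<Longrightarrow> z \<in> S \<Longrightarrow> ip z (sub x y) = ip z x - ip z y"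
  by (simp add: sub_def)

lemma nm_nonneg [simp]: "x \<in> S \<Longrightarrow> 0 \<le> nm x"
  by (simp add: nm_def ip_nonneg)

lemma nm_sq: "x \<in> S \<Longrightarrow> (nm x)\<^sup>2 = Re (ip x x)"
  by (simp add: nm_def ip_nonneg)

lemma ip_self: "x \<in> S \<Longrightarrow> ip x x = complex_of_real ((nm x)\<^sup>2)"
  using ip_commute[of x x] nm_sq[of x] by (simp add: complex_eq_iff)

lemma Re_ip_commute: "x \<in> S \<Longrightarrow> y \<in> S \<Longrightarrow> Re (ip y x) = Re (ip x y)"
  using ip_commute[of x y] by simp

lemma nm_sub_sq:
  "x \<in> S \<Longrightarrow> y \<in> S \<Longrightarrow> (nm (sub x y))\<^sup>2 = (nm x)\<^sup>2 - 2 * Re (ip x y) + (nm y)\<^sup>2"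
  by (simp add: nm_sq Re_ip_commute[of x y])

lemma nm_add_sq:
  "x \<in> S \<Longrightarrow> y \<in> S \<Longrightarrow> (nm (add x y))\<^sup>2 = (nm x)\<^sup>2 + 2 * Re (ip x y) + (nm y)\<^sup>2"
  by (simp add: nm_sq Re_ip_commute[of x y])

lemma nm_scal: "x \<in> S \<Longrightarrow> nm (scal c x) = cmod c * nm x"
proof -
  assume x: "x \<in> S"
  have "ip (scal c x) (scal c x) = (c * cnj c) * ip x x" using x by simp
  also have "\<dots> = complex_of_real ((cmod c * nm x)\<^sup>2)"
    by (simp only: ip_self[OF x] complex_norm_square[of c, symmetric] power_mult_distrib of_real_mult of_real_power)
  finally have "(nm (scal c x))\<^sup>2 = (cmod c * nm x)\<^sup>2" using x nm_sq[of "scal c x"] by simp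
  thus ?thesis using x by (simp add: power2_eq_iff_nonneg)
qed

text \<open>For a vanishing second vector the quotient in the usual proof is not available; then letting
  the scalar grow gives the claim.\<close>

lemma Cauchy_Schwarz:
  assumes x: "x \<in> S" and y: "y \<in> S"
  shows "cmod (ip x y) \<le> nm x * nm y"
proof -
  define a where "a = ip x y"
  have key: "0 \<le> (nm x)\<^sup>2 - 2 * t * (cmod a)\<^sup>2 + t\<^sup>2 * (cmod a)\<^sup>2 * (nm y)\<^sup>2" for t :: real
  proof -
    let ?z = "scal (complex_of_real t * a) y"
    have "ip x ?z = complex_of_real t * (a * cnj a)" using x y by (simp add: a_def)
    hence "Re (ip x ?z) = t * (cmod a)\<^sup>2"
      by (simp only: complex_norm_square[symmetric]) simp
    moreover have "(nm ?z)\<^sup>2 = t\<^sup>2 * (cmod a)\<^sup>2 * (nm y)\<^sup>2"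
      using y by (simp add: nm_scal norm_mult power_mult_distrib)
    ultimately have "(nm (sub x ?z))\<^sup>2 = (nm x)\<^sup>2 - 2 * t * (cmod a)\<^sup>2 + t\<^sup>2 * (cmod a)\<^sup>2 * (nm y)\<^sup>2"
      using x y nm_sub_sq[of x ?z] by simp
    thus ?thesis by (metis zero_le_power2)
  qed
  show ?thesis
  proof (cases "nm y = 0")
    case True
    have "cmod a = 0"
    proof (rule ccontr)
      assume "cmod a \<noteq> 0"
      hence p: "(cmod a)\<^sup>2 > 0" by simp
      have "0 \<le> (nm x)\<^sup>2 - 2 * (((nm x)\<^sup>2 + 1) / (cmod a)\<^sup>2) * (cmod a)\<^sup>2"
        using key[of "((nm x)\<^sup>2 + 1) / (cmod a)\<^sup>2"] True by simp
      also have "\<dots> = (nm x)\<^sup>2 - 2 * ((nm x)\<^sup>2 + 1)" using p by simp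
      finally have "(nm x)\<^sup>2 \<le> - 2" by simp
      thus False using zero_le_power2[of "nm x"] by simp
    qed
    thus ?thesis using True by (simp add: a_def)
  next
    case False
    hence p: "(nm y)\<^sup>2 > 0" by simp
    define X A Y where "X = (nm x)\<^sup>2" and "A = (cmod a)\<^sup>2" and "Y = (nm y)\<^sup>2"
    have Y: "Y > 0" using p by (simp add: Y_def)
    have "0 \<le> X - 2 * (1 / Y) * A + (1 / Y)\<^sup>2 * A * Y"
      using key[of "1 / Y"] by (simp only: X_def A_def Y_def)
    also have "\<dots> = X - A / Y" using Y by (simp add: power2_eq_square)
    finally have "A \<le> X * Y" using Y by (simp add: pos_divide_le_eq)
    hence "(cmod a)\<^sup>2 \<le> (nm x * nm y)\<^sup>2" by (simp add: X_def A_def Y_def power_mult_distrib)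
    thus ?thesis using x y by (simp add: a_def power2_le_iff_abs_le)
  qed
qed

lemma nm_triangle:
  assumes "x \<in> S" "y \<in> S" shows "nm (add x y) \<le> nm x + nm y"
proof -
  have "Re (ip x y) \<le> nm x * nm y"
    using Cauchy_Schwarz[OF assms] complex_Re_le_cmod[of "ip x y"] by linarith
  hence "(nm (add x y))\<^sup>2 \<le> (nm x + nm y)\<^sup>2"
    using nm_add_sq[OF assms] by (simp add: power2_sum)
  thus ?thesis using assms by (simp add: power2_le_iff_abs_le)
qed

lemma dist_sym: "x \<in> S \<Longrightarrow> y \<in> S \<Longrightarrow> nm (sub x y) = nm (sub y x)"
  by (simp add: nm_def algebra_simps)

lemma dist_triangle:
  assumes "x \<in> S" "y \<in> S" "z \<in> S" shows "nm (sub x z) \<le> nm (sub x y) + nm (sub y z)"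
proof -
  \<comment> \<open>The two vectors need not be equal, but their norms have the same expansion.\<close>
  have "nm (sub x z) = nm (add (sub x y) (sub y z))"
    using assms by (simp add: nm_def algebra_simps)
  thus ?thesis using nm_triangle[of "sub x y" "sub y z"] assms by simp
qed

lemma nm_le_dist:
  assumes "x \<in> S" "y \<in> S" shows "nm x \<le> nm (sub x y) + nm y"
proof -
  have "nm x = nm (add (sub x y) y)" using assms by (simp add: nm_def algebra_simps)
  thus ?thesis using nm_triangle[of "sub x y" y] assms by simp
qed

lemma ip_diff_le:
  assumes "x \<in> S" "y \<in> S" "x' \<in> S" "y' \<in> S"
  shows "cmod (ip x' y' - ip x y) \<le> nm (sub x' x) * nm y' + nm x * nm (sub y' y)"
proof -
  have "ip x' y' - ip x y = ip (sub x' x) y' + ip x (sub y' y)" using assms by simp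
  also have "cmod \<dots> \<le> cmod (ip (sub x' x) y') + cmod (ip x (sub y' y))"
    by (rule norm_triangle_ineq)
  also have "\<dots> \<le> nm (sub x' x) * nm y' + nm x * nm (sub y' y)"
    using assms by (intro add_mono Cauchy_Schwarz) auto
  finally show ?thesis .
qed

lemma tendsto_ip:
  assumes S: "\<And>n. s n \<in> S" "\<And>n. t n \<in> S" "x \<in> S" "y \<in> S"
    and s: "(\<lambda>n. nm (sub (s n) x)) \<longlonglongrightarrow> 0" and t: "(\<lambda>n. nm (sub (t n) y)) \<longlonglongrightarrow> 0"
  shows "(\<lambda>n. ip (s n) (t n)) \<longlonglongrightarrow> ip x y"
proof -
  have "cmod (ip (s n) (t n) - ip x y)
      \<le> nm (sub (s n) x) * (nm (sub (t n) y) + nm y) + nm x * nm (sub (t n) y)" for n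
  proof -
    have "nm (sub (s n) x) * nm (t n) \<le> nm (sub (s n) x) * (nm (sub (t n) y) + nm y)"
      using S by (intro mult_left_mono nm_le_dist) auto
    thus ?thesis using ip_diff_le[of x y "s n" "t n"] S by fastforce
  qed
  hence bound: "\<forall>\<^sub>F n in sequentially. norm (ip (s n) (t n) - ip x y)
      \<le> nm (sub (s n) x) * (nm (sub (t n) y) + nm y) + nm x * nm (sub (t n) y)"
    by (simp add: eventually_sequentially)
  have "(\<lambda>n. nm (sub (s n) x) * (nm (sub (t n) y) + nm y) + nm x * nm (sub (t n) y))
      \<longlonglongrightarrow> 0 * (0 + nm y) + nm x * 0"
    by (intro tendsto_intros s t)
  hence "(\<lambda>n. ip (s n) (t n) - ip x y) \<longlonglongrightarrow> 0"
    using Lim_null_comparison[OF bound] by simp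
  thus ?thesis by (simp add: LIM_zero_iff)
qed

lemma cauchy_closed: "cauchy s \<Longrightarrow> s n \<in> S" by (simp add: cauchy_def)

lemma cauchy_bounded:
  assumes "cauchy s" obtains B where "\<And>n. nm (s n) \<le> B" "0 \<le> B"
proof -
  obtain N where N: "\<forall>m\<ge>N. \<forall>n\<ge>N. nm (sub (s m) (s n)) < 1"
    using assms unfolding cauchy_def by (meson zero_less_one)
  define B where "B = Max (nm ` s ` {..N}) + 1"
  have le: "nm (s n) \<le> B - 1" if "n \<le> N" for n unfolding B_def using that by simp
  have "nm (s n) \<le> B" for n
  proof (cases "n \<le> N")
    case True thus ?thesis using le by fastforce
  next
    case False
    hence "nm (sub (s n) (s N)) < 1" using N by simp
    thus ?thesis using nm_le_dist[of "s n" "s N"] le[of N] cauchy_closed[OF assms] by fastforce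
  qed
  moreover have "0 \<le> B" using calculation[of 0] nm_nonneg[OF cauchy_closed[OF assms, of 0]]
    by linarith
  ultimately show ?thesis by (rule that)
qed

lemma cauchy_ip_convergent:
  assumes s: "cauchy s" and t: "cauchy t"
  shows "convergent (\<lambda>n. ip (s n) (t n))"
proof -
  obtain B where B: "\<And>n. nm (s n) \<le> B" "0 \<le> B" using cauchy_bounded[OF s] by blast
  obtain C where C: "\<And>n. nm (t n) \<le> C" "0 \<le> C" using cauchy_bounded[OF t] by blast
  have "Cauchy (\<lambda>n. ip (s n) (t n))"
  proof (rule CauchyI)
    fix e :: real assume "0 < e"
    define d where "d = e / (B + C + 1)"
    have d: "d > 0" using \<open>0 < e\<close> B C by (simp add: d_def)
    obtain M N where M: "\<forall>m\<ge>M. \<forall>n\<ge>M. nm (sub (s m) (s n)) < d"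
      and N: "\<forall>m\<ge>N. \<forall>n\<ge>N. nm (sub (t m) (t n)) < d"
      using s t d unfolding cauchy_def by meson
    have "norm (ip (s m) (t m) - ip (s n) (t n)) < e" if "m \<ge> max M N" "n \<ge> max M N" for m n
    proof -
      have "norm (ip (s m) (t m) - ip (s n) (t n))
          \<le> nm (sub (s m) (s n)) * nm (t m) + nm (s n) * nm (sub (t m) (t n))"
        using ip_diff_le cauchy_closed s t by blast
      also have "\<dots> \<le> d * C + B * d"
        using M N that B C d cauchy_closed[OF s] cauchy_closed[OF t]
        by (intro add_mono mult_mono) (auto intro: less_imp_le)
      also have "\<dots> < d * (B + C + 1)" using d by (simp add: algebra_simps)
      also have "\<dots> = e" using B C by (simp add: d_def)
      finally show ?thesis .
    qed
    thus "\<exists>M. \<forall>m\<ge>M. \<forall>n\<ge>M. norm (ip (s m) (t m) - ip (s n) (t n)) < e" by blast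
  qed
  thus ?thesis by (rule Cauchy_convergent)
qed

lemma cauchy_if_convergent:
  assumes S: "\<And>n. s n \<in> S" "x \<in> S" and lim: "(\<lambda>n. nm (sub (s n) x)) \<longlonglongrightarrow> 0"
  shows "cauchy s"
  unfolding cauchy_def
proof (intro conjI allI impI)
  fix e :: real assume "0 < e"
  hence "\<forall>\<^sub>F n in sequentially. nm (sub (s n) x) < e / 2"
    using order_tendstoD(2)[OF lim, of "e/2"] by simp
  then obtain N where N: "\<And>n. n \<ge> N \<Longrightarrow> nm (sub (s n) x) < e / 2"
    by (auto simp: eventually_sequentially)
  have "nm (sub (s m) (s n)) < e" if "m \<ge> N" "n \<ge> N" for m n
    using dist_triangle[of "s m" x "s n"] dist_sym[of x "s n"] N[OF that(1)] N[OF that(2)] S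
    by fastforce
  thus "\<exists>N. \<forall>m\<ge>N. \<forall>n\<ge>N. nm (sub (s m) (s n)) < e" by blast
qed (simp add: S)

end


section \<open>Operators between Hilbert spaces\<close>

lemma complex_ring_simps [simp]:
  "carrier complex_ring = UNIV" "mult complex_ring = (*)" "one complex_ring = 1"
  "zero complex_ring = 0" "add complex_ring = (+)"
  by (simp_all add: complex_ring_def)

lemma cring_complex_ring: "cring complex_ring"
proof (rule cringI)
  show "abelian_group complex_ring"
    by (rule abelian_groupI) (auto simp: algebra_simps intro: exI[of _ "- x" for x])
  show "comm_monoid complex_ring"
    by (rule comm_monoidI) auto
qed (auto simp: algebra_simps)

lemma module_minus_eq:
  assumes "module complex_ring H" and "x \<in> carrier H" and "y \<in> carrier H"
  shows "x \<ominus>\<^bsub>H\<^esub> y = x \<oplus>\<^bsub>H\<^esub> ((-1) \<odot>\<^bsub>H\<^esub> y)"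
proof -
  interpret module complex_ring H by fact
  have "(-1) \<odot>\<^bsub>H\<^esub> y \<oplus>\<^bsub>H\<^esub> y = (-1 + 1) \<odot>\<^bsub>H\<^esub> y"
    using smult_l_distr[of "-1" 1 y] smult_one[of y] assms by simp
  also have "\<dots> = \<zero>\<^bsub>H\<^esub>" using smult_l_null[of y] assms by simp
  finally have "\<ominus>\<^bsub>H\<^esub> y = (-1) \<odot>\<^bsub>H\<^esub> y"
    using assms by (intro M.minus_equality) auto
  thus ?thesis by (simp add: a_minus_def)
qed

lemma hdist_eq:
  assumes m: "module complex_ring H" and "semi_inner (carrier H) (add H) (smult H) (cinner H)"
  shows "hdist H x y = (if x \<in> carrier H \<and> y \<in> carrier H
    then semi_inner.nm (cinner H) (semi_inner.sub (add H) (smult H) x y) else 0)"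
proof -
  interpret s: semi_inner "carrier H" "add H" "smult H" "cinner H" by fact
  show ?thesis using module_minus_eq[OF m, of x y] by (simp add: hdist_def hnorm_def s.nm_def s.sub_def)
qed

text \<open>Separation is a hypothesis, so that the metric is available both for verifying that a space is
  a Hilbert space and for using its completeness.\<close>

lemma hdist_metric:
  assumes m: "module complex_ring H" and si: "semi_inner (carrier H) (add H) (smult H) (cinner H)"
    and sep: "\<And>x y. x \<in> carrier H \<Longrightarrow> y \<in> carrier H \<Longrightarrow>
      semi_inner.nm (cinner H) (semi_inner.sub (add H) (smult H) x y) = 0 \<Longrightarrow> x = y"
  shows "Metric_space (carrier H) (hdist H)"
proof -
  interpret s: semi_inner "carrier H" "add H" "smult H" "cinner H" by (rule si)
  note hd = hdist_eq[OF m si]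
  show ?thesis
  proof
    fix x y
    show "0 \<le> hdist H x y" by (simp add: hd)
    show "hdist H x y = hdist H y x" by (simp add: hd s.dist_sym)
    assume "x \<in> carrier H" "y \<in> carrier H"
    thus "hdist H x y = 0 \<longleftrightarrow> x = y" using sep by (auto simp: hd s.nm_def)
  next
    fix x y z assume "x \<in> carrier H" "y \<in> carrier H" "z \<in> carrier H"
    thus "hdist H x z \<le> hdist H x y + hdist H y z" by (simp add: hd s.dist_triangle)
  qed
qed

text \<open>In the presence of an inner product all algebraic laws of a complex vector space hold up to
  vectors of norm zero, so only separation and completeness remain to be checked.\<close>

theorem complex_hilbert_space_if_semi_inner:
  fixes H :: "('h, 'm) inner_module_scheme"
  assumes "semi_inner (carrier H) (add H) (smult H) (cinner H)"
    and zero: "\<zero>\<^bsub>H\<^esub> \<in> carrier H" "cinner H \<zero>\<^bsub>H\<^esub> \<zero>\<^bsub>H\<^esub> = 0"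
    and sep: "\<And>x y. x \<in> carrier H \<Longrightarrow> y \<in> carrier H \<Longrightarrow>
      semi_inner.nm (cinner H) (semi_inner.sub (add H) (smult H) x y) = 0 \<Longrightarrow> x = y"
    and compl: "\<And>s. semi_inner.cauchy (carrier H) (add H) (smult H) (cinner H) s \<Longrightarrow>
      \<exists>x\<in>carrier H. (\<lambda>n. semi_inner.nm (cinner H) (semi_inner.sub (add H) (smult H) (s n) x)) \<longlonglongrightarrow> 0"
  shows "complex_hilbert_space H"
proof -
  interpret s: semi_inner "carrier H" "add H" "smult H" "cinner H" by fact
  have ip0: "cinner H \<zero>\<^bsub>H\<^esub> z = 0" if "z \<in> carrier H" for z
    using s.Cauchy_Schwarz[OF zero(1) that] zero(2) by (simp add: s.nm_def)
  have eqI: "x = y" if "x \<in> carrier H" "y \<in> carrier H"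
    and "\<And>z. z \<in> carrier H \<Longrightarrow> cinner H x z = cinner H y z" for x y
  proof (rule sep[OF that(1,2)])
    show "s.nm (s.sub x y) = 0" using that by (simp add: s.nm_def)
  qed
  have m: "module complex_ring H"
  proof (rule moduleI[OF cring_complex_ring], rule abelian_groupI)
    fix x assume x: "x \<in> carrier H"
    show "\<exists>y\<in>carrier H. y \<oplus>\<^bsub>H\<^esub> x = \<zero>\<^bsub>H\<^esub>"
      by (rule bexI[of _ "(-1) \<odot>\<^bsub>H\<^esub> x"], rule eqI) (use x zero ip0 in auto)
  qed (use zero ip0 in \<open>auto intro!: eqI simp: algebra_simps\<close>)
  interpret module complex_ring H by (rule m)
  note hd = hdist_eq[OF m assms(1)]
  interpret ms: Metric_space "carrier H" "hdist H" by (rule hdist_metric[OF m assms(1) sep])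
  show ?thesis
  proof
    show "Metric_space.mcomplete (carrier H) (hdist H)"
      unfolding ms.mcomplete_def
    proof (intro allI impI)
      fix \<sigma> assume "ms.MCauchy \<sigma>"
      hence c: "s.cauchy \<sigma>" unfolding ms.MCauchy_def s.cauchy_def
        by (auto simp: hd image_subset_iff)
      obtain x where x: "x \<in> carrier H" "(\<lambda>n. s.nm (s.sub (\<sigma> n) x)) \<longlonglongrightarrow> 0"
        using compl[OF c] by blast
      hence "limitin ms.mtopology \<sigma> x sequentially"
        using s.cauchy_closed[OF c] by (simp add: ms.limitin_metric_dist_null hd)
      thus "\<exists>x. limitin ms.mtopology \<sigma> x sequentially" ..
    qed
    fix x assume x: "x \<in> carrier H" and "cinner H x x = 0"
    hence "s.nm x = 0" by (simp add: s.nm_def)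
    hence "cinner H x z = cinner H \<zero>\<^bsub>H\<^esub> z" if "z \<in> carrier H" for z
      using s.Cauchy_Schwarz[OF x that] ip0[OF that] by simp
    thus "x = \<zero>\<^bsub>H\<^esub>" using x zero(1) by (intro eqI) auto
  qed (auto simp: s.ip_nonneg intro: s.ip_commute)
qed

context complex_hilbert_space
begin

lemma module_H: "module complex_ring H" by unfold_locales

sublocale si: semi_inner "carrier H" "add H" "smult H" "cinner H"
  by unfold_locales (auto simp: cinner_add_left cinner_smult_left cinner_nonneg intro: cinner_commute)

lemma hnorm_eq_nm: "hnorm H = si.nm"
  by (rule ext) (simp add: hnorm_def si.nm_def)

lemma minus_eq_sub: "x \<in> carrier H \<Longrightarrow> y \<in> carrier H \<Longrightarrow> x \<ominus>\<^bsub>H\<^esub> y = si.sub x y"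
  by (simp add: module_minus_eq[OF module_H] si.sub_def)

lemma eq_if_dist_zero:
  assumes "x \<in> carrier H" "y \<in> carrier H" "si.nm (si.sub x y) = 0" shows "x = y"
proof -
  have "x \<ominus>\<^bsub>H\<^esub> y = \<zero>\<^bsub>H\<^esub>"
    using assms cinner_definite[of "si.sub x y"] si.ip_self[of "si.sub x y"]
    by (simp add: minus_eq_sub)
  hence "\<zero> \<oplus> y = (x \<ominus> y) \<oplus> y" by simp
  also have "\<dots> = x" using assms(1,2) by (simp add: a_minus_def M.a_assoc M.l_neg)
  finally show ?thesis using assms(2) by simp
qed

lemma eq_if_cinner_eq:
  assumes "x \<in> carrier H" "y \<in> carrier H"
    and "\<And>z. z \<in> carrier H \<Longrightarrow> cinner H x z = cinner H y z"
  shows "x = y"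
  using assms by (intro eq_if_dist_zero) (auto simp: si.nm_def)

text \<open>Equality of two vectors is a statement about three inner products.\<close>

lemma eq_if_cinner_self:
  assumes "x \<in> carrier H" "y \<in> carrier H"
    and "Re (cinner H x x) - 2 * Re (cinner H x y) + Re (cinner H y y) = 0"
  shows "x = y"
proof (rule eq_if_dist_zero[OF assms(1,2)])
  have "(si.nm (si.sub x y))\<^sup>2 = 0"
    unfolding si.nm_sub_sq[OF assms(1,2)] si.nm_sq[OF assms(1)] si.nm_sq[OF assms(2)] by (rule assms(3))
  thus "si.nm (si.sub x y) = 0" by simp
qed

lemma complete_seq:
  assumes s: "si.cauchy s" obtains x where "x \<in> carrier H" "(\<lambda>n. si.nm (si.sub (s n) x)) \<longlonglongrightarrow> 0"
proof -
  note hd = hdist_eq[OF module_H si.semi_inner_axioms]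
  interpret ms: Metric_space "carrier H" "hdist H"
    by (rule hdist_metric[OF module_H si.semi_inner_axioms eq_if_dist_zero])
  have "ms.MCauchy s" using s unfolding ms.MCauchy_def si.cauchy_def
    by (auto simp: hd image_subset_iff)
  then obtain x where "limitin ms.mtopology s x sequentially"
    using complete unfolding ms.mcomplete_def by blast
  hence "x \<in> carrier H \<and> (\<lambda>n. si.nm (si.sub (s n) x)) \<longlonglongrightarrow> 0"
    using si.cauchy_closed[OF s] by (auto simp: ms.limitin_metric_dist_null hd)
  thus ?thesis using that by blast
qed

text \<open>The Riesz representation theorem, by minimising the functional
  \<open>\<lambda>x. \<parallel>x\<parallel>\<^sup>2 - 2 * Re (\<phi> x)\<close>: the parallelogram law makes every minimising sequence a Cauchy
  sequence, and the first variation at the minimiser vanishes.\<close>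

theorem Riesz_representation:
  assumes add: "\<And>x y. x \<in> carrier H \<Longrightarrow> y \<in> carrier H \<Longrightarrow> \<phi> (x \<oplus> y) = \<phi> x + \<phi> y"
    and smult: "\<And>c x. x \<in> carrier H \<Longrightarrow> \<phi> (c \<odot>\<^bsub>H\<^esub> x) = c * \<phi> x"
    and bound: "\<And>x. x \<in> carrier H \<Longrightarrow> cmod (\<phi> x) \<le> B * si.nm x"
  obtains y where "y \<in> carrier H" "\<And>x. x \<in> carrier H \<Longrightarrow> \<phi> x = cinner H x y"
proof -
  define J where "J x = (si.nm x)\<^sup>2 - 2 * Re (\<phi> x)" for x
  define m where "m = Inf (J ` carrier H)"
  have Jge: "- (B\<^sup>2) \<le> J x" if "x \<in> carrier H" for x
  proof -
    have "Re (\<phi> x) \<le> B * si.nm x" using bound[OF that] complex_Re_le_cmod[of "\<phi> x"] by linarith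
    moreover have "0 \<le> (si.nm x - B)\<^sup>2" by simp
    ultimately show ?thesis by (simp add: J_def power2_diff algebra_simps)
  qed
  hence bdd: "bdd_below (J ` carrier H)" by (auto simp: bdd_below_def)
  have ne: "carrier H \<noteq> {}" using M.zero_closed by blast
  have mle: "m \<le> J x" if "x \<in> carrier H" for x
    unfolding m_def using that bdd by (intro cInf_lower) auto
  have "\<exists>x\<in>carrier H. J x < m + 1 / real (Suc n)" for n
  proof -
    have "Inf (J ` carrier H) < m + 1 / real (Suc n)" unfolding m_def[symmetric] by simp
    thus ?thesis using cInf_less_iff[OF _ bdd] ne by auto
  qed
  then obtain s where s: "\<And>n. s n \<in> carrier H" "\<And>n. J (s n) < m + 1 / real (Suc n)" by metis
  have par: "(si.nm (si.sub x z))\<^sup>2 = 2 * J x + 2 * J z - 4 * J ((1/2) \<odot>\<^bsub>H\<^esub> (x \<oplus> z))"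
    if "x \<in> carrier H" "z \<in> carrier H" for x z
    using that si.nm_add_sq[of x z]
    by (simp add: si.nm_sub_sq J_def si.nm_scal add smult power_mult_distrib power_divide field_simps)
  have close: "(si.nm (si.sub (s i) (s j)))\<^sup>2 \<le> 4 / real (Suc N)" if "i \<ge> N" "j \<ge> N" for i j N
  proof -
    have "J (s k) \<le> m + 1 / real (Suc N)" if "k \<ge> N" for k
    proof -
      have "1 / real (Suc k) \<le> 1 / real (Suc N)" using that by (intro divide_left_mono) auto
      thus ?thesis using s(2)[of k] by linarith
    qed
    hence "J (s i) \<le> m + 1 / real (Suc N)" "J (s j) \<le> m + 1 / real (Suc N)" using that by auto
    moreover have "m \<le> J ((1/2) \<odot>\<^bsub>H\<^esub> (s i \<oplus> s j))" using s(1) by (intro mle) auto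
    ultimately show ?thesis using par[OF s(1) s(1), of i j] by simp
  qed
  have "si.cauchy s" unfolding si.cauchy_def
  proof (intro conjI allI impI s(1))
    fix e :: real assume "0 < e"
    then obtain N where N: "4 / e\<^sup>2 < real (Suc N)"
      using reals_Archimedean2 less_trans lessI of_nat_less_iff by metis
    have "si.nm (si.sub (s i) (s j)) < e" if "i \<ge> N" "j \<ge> N" for i j
    proof -
      have "4 / real (Suc N) < e\<^sup>2" using N \<open>0 < e\<close> by (simp add: field_simps)
      hence "(si.nm (si.sub (s i) (s j)))\<^sup>2 < e\<^sup>2" using close[OF that] by linarith
      thus ?thesis using \<open>0 < e\<close> by (simp add: power2_less_imp_less)
    qed
    thus "\<exists>N. \<forall>i\<ge>N. \<forall>j\<ge>N. si.nm (si.sub (s i) (s j)) < e" by blast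
  qed
  then obtain y where y: "y \<in> carrier H" "(\<lambda>n. si.nm (si.sub (s n) y)) \<longlonglongrightarrow> 0"
    by (rule complete_seq)
  have phi_sub: "\<phi> (si.sub x z) = \<phi> x - \<phi> z" if "x \<in> carrier H" "z \<in> carrier H" for x z
    using that by (simp add: si.sub_def add smult)
  have "(\<lambda>n. cinner H (s n) (s n)) \<longlonglongrightarrow> cinner H y y"
    by (rule si.tendsto_ip) (use s y in auto)
  hence "(\<lambda>n. Re (cinner H (s n) (s n))) \<longlonglongrightarrow> Re (cinner H y y)" by (rule tendsto_Re)
  moreover have "(\<lambda>n. \<phi> (s n)) \<longlonglongrightarrow> \<phi> y"
  proof -
    have "\<forall>\<^sub>F n in sequentially. norm (\<phi> (s n) - \<phi> y) \<le> B * si.nm (si.sub (s n) y)"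
      using s(1) y(1) bound by (simp add: phi_sub[symmetric])
    moreover have "(\<lambda>n. B * si.nm (si.sub (s n) y)) \<longlonglongrightarrow> 0"
      using tendsto_mult_left[OF y(2), of B] by simp
    ultimately have "(\<lambda>n. \<phi> (s n) - \<phi> y) \<longlonglongrightarrow> 0" by (rule Lim_null_comparison)
    thus ?thesis by (simp add: LIM_zero_iff)
  qed
  hence "(\<lambda>n. Re (\<phi> (s n))) \<longlonglongrightarrow> Re (\<phi> y)" by (rule tendsto_Re)
  ultimately have "(\<lambda>n. J (s n)) \<longlonglongrightarrow> J y"
    unfolding J_def using s(1) y(1) by (simp add: si.nm_sq) (intro tendsto_diff tendsto_mult tendsto_const)
  moreover have "(\<lambda>n. m + 1 / real (Suc n)) \<longlonglongrightarrow> m + 0"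
    using tendsto_add[OF tendsto_const LIMSEQ_inverse_real_of_nat] by (simp add: inverse_eq_divide)
  ultimately have "J y \<le> m + 0"
    by (rule LIMSEQ_le) (use s(2) less_imp_le in blast)
  hence min: "J y \<le> J x" if "x \<in> carrier H" for x using mle[OF that] by linarith
  have re: "Re (\<phi> x) = Re (cinner H x y)" if x: "x \<in> carrier H" for x
  proof -
    define d where "d = Re (cinner H x y) - Re (\<phi> x)"
    have q: "0 \<le> 2 * t * d + t\<^sup>2 * (si.nm x)\<^sup>2" for t :: real
    proof -
      let ?z = "y \<oplus> (complex_of_real t \<odot>\<^bsub>H\<^esub> x)"
      have "J ?z = J y + 2 * t * d + t\<^sup>2 * (si.nm x)\<^sup>2"
        using x y(1) si.Re_ip_commute[of x y]
        by (simp add: J_def d_def si.nm_add_sq si.nm_scal add smult power_mult_distrib algebra_simps)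
      thus ?thesis using min[of ?z] x y(1) by simp
    qed
    have "d = 0"
    proof (rule ccontr)
      assume "d \<noteq> 0"
      define n where "n = (si.nm x)\<^sup>2 + 1"
      have n: "n > 0" "(si.nm x)\<^sup>2 < n" by (auto simp: n_def add_nonneg_pos)
      have "0 \<le> 2 * (- d / n) * d + (- d / n)\<^sup>2 * (si.nm x)\<^sup>2" by (rule q)
      also have "\<dots> \<le> 2 * (- d / n) * d + (- d / n)\<^sup>2 * n"
        using n by (intro add_left_mono mult_left_mono) auto
      also have "\<dots> = - (d\<^sup>2 / n)" using n by (simp add: power2_eq_square field_simps)
      also have "\<dots> < 0" using n \<open>d \<noteq> 0\<close> by simp
      finally show False by simp
    qed
    thus ?thesis by (simp add: d_def)
  qed
  show ?thesis
  proof (rule that[OF y(1)])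
    fix x assume x: "x \<in> carrier H"
    have "Re (\<phi> (\<i> \<odot>\<^bsub>H\<^esub> x)) = Re (cinner H (\<i> \<odot>\<^bsub>H\<^esub> x) y)" using x by (intro re) simp
    hence "Im (\<phi> x) = Im (cinner H x y)" using x y(1) by (simp add: smult)
    thus "\<phi> x = cinner H x y" using re[OF x] by (simp add: complex_eq_iff)
  qed
qed

end


lemma bounded_opsD:
  assumes "T \<in> bounded_ops H L"
  shows "x \<in> carrier H \<Longrightarrow> T x \<in> carrier L"
    and "x \<in> carrier H \<Longrightarrow> y \<in> carrier H \<Longrightarrow> T (x \<oplus>\<^bsub>H\<^esub> y) = T x \<oplus>\<^bsub>L\<^esub> T y"
    and "x \<in> carrier H \<Longrightarrow> T (c \<odot>\<^bsub>H\<^esub> x) = c \<odot>\<^bsub>L\<^esub> T x"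
    and "T \<in> extensional (carrier H)"
  using assms by (auto simp: bounded_ops_def PiE_def)

lemma bounded_ops_eqI:
  assumes "T \<in> bounded_ops H L" "T' \<in> bounded_ops H L'"
    and "\<And>x. x \<in> carrier H \<Longrightarrow> T x = T' x"
  shows "T = T'"
  using bounded_opsD(4)[OF assms(1)] bounded_opsD(4)[OF assms(2)] assms(3) by (rule extensionalityI)

text \<open>Density is attached to an indexed family because an isometry is later defined by sending one
  family to another one with the same index set.\<close>

definition dense_family :: "('h, 'm) inner_module_scheme \<Rightarrow> 'i set \<Rightarrow> ('i \<Rightarrow> 'h) \<Rightarrow> bool" where
  "dense_family H I x \<longleftrightarrow> (\<forall>i\<in>I. x i \<in> carrier H) \<and>
     (\<forall>u\<in>carrier H. \<forall>e>0. \<exists>i\<in>I. hnorm H (u \<ominus>\<^bsub>H\<^esub> x i) < e)"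

locale hilbert_pair = H: complex_hilbert_space H + L: complex_hilbert_space L
  for H :: "('h, 'm) inner_module_scheme" and L :: "('l, 'n) inner_module_scheme"
begin

lemma bounded_ops_bound:
  assumes "T \<in> bounded_ops H L"
  obtains B where "0 \<le> B" "\<And>x. x \<in> carrier H \<Longrightarrow> L.si.nm (T x) \<le> B * H.si.nm x"
proof -
  obtain B where B: "\<And>x. x \<in> carrier H \<Longrightarrow> L.si.nm (T x) \<le> B * H.si.nm x"
    using assms unfolding bounded_ops_def H.hnorm_eq_nm L.hnorm_eq_nm by blast
  have "L.si.nm (T x) \<le> max B 0 * H.si.nm x" if "x \<in> carrier H" for x
    using B[OF that] mult_right_mono[of B "max B 0" "H.si.nm x"] that by fastforce
  thus ?thesis by (intro that[of "max B 0"]) auto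
qed

lemma bounded_opsI:
  assumes "\<And>x. x \<in> carrier H \<Longrightarrow> T x \<in> carrier L" "T \<in> extensional (carrier H)"
    and "\<And>x y. x \<in> carrier H \<Longrightarrow> y \<in> carrier H \<Longrightarrow> T (x \<oplus>\<^bsub>H\<^esub> y) = T x \<oplus>\<^bsub>L\<^esub> T y"
    and "\<And>c x. x \<in> carrier H \<Longrightarrow> T (c \<odot>\<^bsub>H\<^esub> x) = c \<odot>\<^bsub>L\<^esub> T x"
    and "\<And>x. x \<in> carrier H \<Longrightarrow> L.si.nm (T x) \<le> B * H.si.nm x"
  shows "T \<in> bounded_ops H L"
  using assms unfolding bounded_ops_def H.hnorm_eq_nm L.hnorm_eq_nm
  by (auto simp: PiE_def intro!: exI[of _ B])

lemma op_sub:
  assumes "T \<in> bounded_ops H L" "x \<in> carrier H" "y \<in> carrier H"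
  shows "T (H.si.sub x y) = L.si.sub (T x) (T y)"
  using assms by (simp add: H.si.sub_def L.si.sub_def bounded_opsD[OF assms(1)])

lemma adjoint_unique:
  assumes "S \<in> bounded_ops L H" "S' \<in> bounded_ops L H"
    and "\<And>x y. x \<in> carrier H \<Longrightarrow> y \<in> carrier L \<Longrightarrow> cinner L (T x) y = cinner H x (S y)"
    and "\<And>x y. x \<in> carrier H \<Longrightarrow> y \<in> carrier L \<Longrightarrow> cinner L (T x) y = cinner H x (S' y)"
  shows "S = S'"
proof (rule bounded_ops_eqI[OF assms(1,2)])
  fix y assume y: "y \<in> carrier L"
  note S = bounded_opsD(1)[OF assms(1) y] bounded_opsD(1)[OF assms(2) y]
  show "S y = S' y"
  proof (rule H.eq_if_cinner_eq[OF S])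
    fix z assume z: "z \<in> carrier H"
    have "cinner H z (S y) = cinner H z (S' y)" using assms(3,4)[OF z y] by simp
    thus "cinner H (S y) z = cinner H (S' y) z"
      using H.si.ip_commute[OF z S(1)] H.si.ip_commute[OF z S(2)] by simp
  qed
qed

text \<open>The adjoint is a definite description, so it is computed by exhibiting some adjoint.\<close>

lemma hadjoint_eqI:
  assumes "S \<in> bounded_ops L H"
    and "\<And>x y. x \<in> carrier H \<Longrightarrow> y \<in> carrier L \<Longrightarrow> cinner L (T x) y = cinner H x (S y)"
  shows "hadjoint H L T = S"
  unfolding hadjoint_def by (rule the_equality) (use assms adjoint_unique in blast)+

text \<open>The vector \<open>T\<^sup>* y\<close> represents the bounded functional \<open>\<lambda>x. \<langle>T x, y\<rangle>\<close>; linearity and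
  boundedness of \<open>T\<^sup>*\<close> follow since inner products determine vectors.\<close>

lemma adjoint_exists:
  assumes T: "T \<in> bounded_ops H L"
  shows "\<exists>S\<in>bounded_ops L H. \<forall>x\<in>carrier H. \<forall>y\<in>carrier L. cinner L (T x) y = cinner H x (S y)"
proof -
  obtain B where B: "0 \<le> B" "\<And>x. x \<in> carrier H \<Longrightarrow> L.si.nm (T x) \<le> B * H.si.nm x"
    by (rule bounded_ops_bound[OF T]) blast
  note TD = bounded_opsD[OF T]
  have "\<exists>z\<in>carrier H. \<forall>x\<in>carrier H. cinner L (T x) y = cinner H x z" if y: "y \<in> carrier L" for y
  proof (rule H.Riesz_representation[where \<phi> = "\<lambda>x. cinner L (T x) y" and B = "B * L.si.nm y"])
    fix x assume x: "x \<in> carrier H"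
    have "cmod (cinner L (T x) y) \<le> L.si.nm (T x) * L.si.nm y"
      using x y by (intro L.si.Cauchy_Schwarz TD)
    also have "\<dots> \<le> (B * H.si.nm x) * L.si.nm y"
      using B(2)[OF x] y by (intro mult_right_mono) auto
    finally show "cmod (cinner L (T x) y) \<le> B * L.si.nm y * H.si.nm x" by (simp add: mult_ac)
  qed (use y TD in auto)
  then obtain s where s: "\<And>y. y \<in> carrier L \<Longrightarrow> s y \<in> carrier H"
    "\<And>x y. x \<in> carrier H \<Longrightarrow> y \<in> carrier L \<Longrightarrow> cinner L (T x) y = cinner H x (s y)" by metis
  have s': "cinner H (s y) x = cinner L y (T x)" if "x \<in> carrier H" "y \<in> carrier L" for x y
    using H.si.ip_commute[OF that(1) s(1)[OF that(2)]] L.si.ip_commute[OF TD(1)[OF that(1)] that(2)]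
      s(2)[OF that] by simp
  have "(\<lambda>y\<in>carrier L. s y) \<in> bounded_ops L H"
  proof -
    interpret LH: hilbert_pair L H ..
    show ?thesis
    proof (rule LH.bounded_opsI[where B = B])
      fix y assume y: "y \<in> carrier L"
      have "(H.si.nm (s y))\<^sup>2 = Re (cinner L (T (s y)) y)"
        using H.si.nm_sq[OF s(1)[OF y]] s(2)[OF s(1)[OF y] y] by simp
      also have "\<dots> \<le> L.si.nm (T (s y)) * L.si.nm y"
        using L.si.Cauchy_Schwarz[OF TD(1)[OF s(1)[OF y]] y] complex_Re_le_cmod order_trans by blast
      also have "\<dots> \<le> (B * H.si.nm (s y)) * L.si.nm y"
        using B(2)[OF s(1)[OF y]] y by (intro mult_right_mono) auto
      finally have *: "H.si.nm (s y) * H.si.nm (s y) \<le> (B * L.si.nm y) * H.si.nm (s y)"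
        by (simp add: power2_eq_square mult_ac)
      have "H.si.nm (s y) \<le> B * L.si.nm y"
      proof (cases "H.si.nm (s y) = 0")
        case True thus ?thesis using B y by simp
      next
        case False
        hence "H.si.nm (s y) > 0" using H.si.nm_nonneg[OF s(1)[OF y]] by simp
        thus ?thesis using * by simp
      qed
      thus "H.si.nm ((\<lambda>y\<in>carrier L. s y) y) \<le> B * L.si.nm y" using y by simp
    next
      fix x y assume "x \<in> carrier L" "y \<in> carrier L"
      thus "(\<lambda>y\<in>carrier L. s y) (x \<oplus>\<^bsub>L\<^esub> y) = (\<lambda>y\<in>carrier L. s y) x \<oplus>\<^bsub>H\<^esub> (\<lambda>y\<in>carrier L. s y) y"
        by (simp, intro H.eq_if_cinner_eq) (auto simp: s s' TD(1))
    next
      fix c y assume "y \<in> carrier L"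
      thus "(\<lambda>y\<in>carrier L. s y) (c \<odot>\<^bsub>L\<^esub> y) = c \<odot>\<^bsub>H\<^esub> (\<lambda>y\<in>carrier L. s y) y"
        by (simp, intro H.eq_if_cinner_eq) (auto simp: s s' TD(1))
    qed (auto simp: s)
  qed
  thus ?thesis by (rule bexI[rotated]) (auto simp: s)
qed

lemma hadjoint:
  assumes T: "T \<in> bounded_ops H L"
  shows "hadjoint H L T \<in> bounded_ops L H"
    and "x \<in> carrier H \<Longrightarrow> y \<in> carrier L \<Longrightarrow> cinner L (T x) y = cinner H x (hadjoint H L T y)"
    and "x \<in> carrier H \<Longrightarrow> y \<in> carrier L \<Longrightarrow> cinner L y (T x) = cinner H (hadjoint H L T y) x"
proof -
  obtain S where S: "S \<in> bounded_ops L H"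
    "\<And>x y. x \<in> carrier H \<Longrightarrow> y \<in> carrier L \<Longrightarrow> cinner L (T x) y = cinner H x (S y)"
    using adjoint_exists[OF T] by blast
  have eq: "hadjoint H L T = S" by (rule hadjoint_eqI[OF S])
  show "hadjoint H L T \<in> bounded_ops L H" using S(1) eq by simp
  show i: "cinner L (T x) y = cinner H x (hadjoint H L T y)" if "x \<in> carrier H" "y \<in> carrier L" for x y
    using S(2)[OF that] eq by simp
  assume xy: "x \<in> carrier H" "y \<in> carrier L"
  show "cinner L y (T x) = cinner H (hadjoint H L T y) x"
    using i[OF xy] L.si.ip_commute[OF bounded_opsD(1)[OF T xy(1)] xy(2)]
      H.si.ip_commute[OF xy(1), of "S y"] bounded_opsD(1)[OF S(1) xy(2)] eq by simp
qed

lemma dense_sequence: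
  assumes "dense_family H I x" and u: "u \<in> carrier H"
  obtains i where "\<And>n. i n \<in> I" "(\<lambda>n. H.si.nm (H.si.sub (x (i n)) u)) \<longlonglongrightarrow> 0"
proof -
  have d: "x i \<in> carrier H" if "i \<in> I" for i using assms(1) that by (auto simp: dense_family_def)
  have "\<exists>i\<in>I. H.si.nm (H.si.sub (x i) u) < inverse (real (Suc n))" for n
  proof -
    obtain i where "i \<in> I" "hnorm H (u \<ominus>\<^bsub>H\<^esub> x i) < inverse (real (Suc n))"
      using assms unfolding dense_family_def by (metis inverse_positive_iff_positive of_nat_0_less_iff zero_less_Suc)
    thus ?thesis using H.si.dist_sym[OF u d] d u
      by (intro bexI[of _ i]) (simp_all add: H.hnorm_eq_nm H.minus_eq_sub)
  qed
  then obtain i where i: "\<And>n. i n \<in> I"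
    "\<And>n. H.si.nm (H.si.sub (x (i n)) u) < inverse (real (Suc n))" by metis
  have "(\<lambda>n. H.si.nm (H.si.sub (x (i n)) u)) \<longlonglongrightarrow> 0"
    by (rule real_tendsto_sandwich[OF _ _ tendsto_const LIMSEQ_inverse_real_of_nat])
      (use i d u in \<open>auto intro!: always_eventually less_imp_le simp del: of_nat_Suc\<close>)
  thus ?thesis using i(1) that by blast
qed

lemma op_tendsto:
  assumes T: "T \<in> bounded_ops H L" and x: "\<And>n. x n \<in> carrier H" "u \<in> carrier H"
    and lim: "(\<lambda>n. H.si.nm (H.si.sub (x n) u)) \<longlonglongrightarrow> 0"
  shows "(\<lambda>n. L.si.nm (L.si.sub (T (x n)) (T u))) \<longlonglongrightarrow> 0"
proof -
  obtain B where B: "0 \<le> B" "\<And>x. x \<in> carrier H \<Longrightarrow> L.si.nm (T x) \<le> B * H.si.nm x"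
    by (rule bounded_ops_bound[OF T]) blast
  have "norm (L.si.nm (L.si.sub (T (x n)) (T u))) \<le> B * H.si.nm (H.si.sub (x n) u)" for n
    using B(2)[of "H.si.sub (x n) u"] x by (simp add: op_sub[OF T] bounded_opsD(1)[OF T])
  hence "\<forall>\<^sub>F n in sequentially.
      norm (L.si.nm (L.si.sub (T (x n)) (T u))) \<le> B * H.si.nm (H.si.sub (x n) u)"
    by (simp add: eventually_sequentially)
  moreover have "(\<lambda>n. B * H.si.nm (H.si.sub (x n) u)) \<longlonglongrightarrow> 0"
    using tendsto_mult_left[OF lim, of B] by simp
  ultimately show ?thesis by (rule Lim_null_comparison)
qed

lemma bounded_ops_eq_if_dense:
  assumes T: "T \<in> bounded_ops H L" "T' \<in> bounded_ops H L" and d: "dense_family H I x"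
    and eq: "\<And>i j. i \<in> I \<Longrightarrow> T (x i) = T' (x i)"
  shows "T = T'"
proof (rule bounded_ops_eqI[OF T])
  fix u assume u: "u \<in> carrier H"
  obtain i where i: "\<And>n. i n \<in> I" "(\<lambda>n. H.si.nm (H.si.sub (x (i n)) u)) \<longlonglongrightarrow> 0"
    by (rule dense_sequence[OF d u]) blast
  have x: "x (i n) \<in> carrier H" for n using d i(1) by (auto simp: dense_family_def)
  have lim: "(\<lambda>n. L.si.nm (L.si.sub (T (x (i n))) (T u))) \<longlonglongrightarrow> 0"
    "(\<lambda>n. L.si.nm (L.si.sub (T (x (i n))) (T' u))) \<longlonglongrightarrow> 0"
    using op_tendsto[OF T(1) x u i(2)] op_tendsto[OF T(2) x u i(2)] eq[OF i(1)] by auto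
  note c = bounded_opsD(1)[OF T(1)] bounded_opsD(1)[OF T(2)]
  have le: "L.si.nm (L.si.sub (T u) (T' u))
      \<le> L.si.nm (L.si.sub (T (x (i n))) (T u)) + L.si.nm (L.si.sub (T (x (i n))) (T' u))" for n
    using L.si.dist_triangle[of "T u" "T (x (i n))" "T' u"] L.si.dist_sym[of "T u" "T (x (i n))"] u x c
    by simp
  have "L.si.nm (L.si.sub (T u) (T' u)) \<le> 0 + 0"
    by (rule LIMSEQ_le_const[OF tendsto_add[OF lim]]) (use le in blast)
  hence "L.si.nm (L.si.sub (T u) (T' u)) = 0"
    using L.si.nm_nonneg[OF L.si.sub_closed[OF c(1)[OF u] c(2)[OF u]]] by linarith
  thus "T u = T' u" using u c by (intro L.eq_if_dist_zero) auto
qed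

text \<open>Linearity asserts that certain vectors agree, and this only involves inner products.\<close>

lemma isometry_if_preserves_cinner:
  assumes V: "\<And>u. u \<in> carrier H \<Longrightarrow> V u \<in> carrier L" "V \<in> extensional (carrier H)"
    and ip: "\<And>u v. u \<in> carrier H \<Longrightarrow> v \<in> carrier H \<Longrightarrow> cinner L (V u) (V v) = cinner H u v"
  shows "V \<in> isometries H L"
proof -
  have nm: "L.si.nm (V u) = H.si.nm u" if "u \<in> carrier H" for u
    using ip[OF that that] by (simp add: L.si.nm_def H.si.nm_def)
  have "V \<in> bounded_ops H L"
  proof (rule bounded_opsI[where B = 1])
    fix u v assume "u \<in> carrier H" "v \<in> carrier H"
    thus "V (u \<oplus>\<^bsub>H\<^esub> v) = V u \<oplus>\<^bsub>L\<^esub> V v" by (intro L.eq_if_cinner_self) (auto simp: V ip)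
  next
    fix c u assume "u \<in> carrier H"
    thus "V (c \<odot>\<^bsub>H\<^esub> u) = c \<odot>\<^bsub>L\<^esub> V u" by (intro L.eq_if_cinner_self) (auto simp: V ip)
  qed (auto simp: V nm)
  thus ?thesis using nm by (simp add: isometries_def H.hnorm_eq_nm L.hnorm_eq_nm)
qed

lemma isometry_cinner:
  assumes V: "V \<in> isometries H L" and u: "u \<in> carrier H" "v \<in> carrier H"
  shows "cinner L (V u) (V v) = cinner H u v"
proof -
  have B: "V \<in> bounded_ops H L" using V by (simp add: isometries_def)
  have nm: "L.si.nm (V w) = H.si.nm w" if "w \<in> carrier H" for w
    using V that by (simp add: isometries_def H.hnorm_eq_nm L.hnorm_eq_nm)
  have re: "Re (cinner L (V a) (V b)) = Re (cinner H a b)" if "a \<in> carrier H" "b \<in> carrier H" for a b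
    using nm[of "H.si.sub a b"] that L.si.nm_sub_sq[of "V a" "V b"] H.si.nm_sub_sq[of a b]
    by (simp add: op_sub[OF B] nm bounded_opsD(1)[OF B])
  have "Re (cinner L (V (\<i> \<odot>\<^bsub>H\<^esub> u)) (V v)) = Re (cinner H (\<i> \<odot>\<^bsub>H\<^esub> u) v)"
    using u by (intro re) auto
  hence "Im (cinner L (V u) (V v)) = Im (cinner H u v)"
    using u by (simp add: bounded_opsD[OF B])
  thus ?thesis using re[OF u] by (simp add: complex_eq_iff)
qed

text \<open>The Gram matrix determines the distances.  Hence a convergent sequence from the first family
  corresponds to a Cauchy sequence from the second one, and the limits are made to correspond.\<close>

theorem isometry_extending_Gram:
  assumes d: "dense_family H I x" and y: "\<And>i. i \<in> I \<Longrightarrow> y i \<in> carrier L"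
    and gram: "\<And>i j. i \<in> I \<Longrightarrow> j \<in> I \<Longrightarrow> cinner L (y i) (y j) = cinner H (x i) (x j)"
  obtains V where "V \<in> isometries H L" "\<And>i. i \<in> I \<Longrightarrow> V (x i) = y i"
proof -
  have x: "x i \<in> carrier H" if "i \<in> I" for i using d that by (auto simp: dense_family_def)
  have dist: "L.si.nm (L.si.sub (y i) (y j)) = H.si.nm (H.si.sub (x i) (x j))" if "i \<in> I" "j \<in> I" for i j
    using that gram x y by (simp add: L.si.nm_def H.si.nm_def)
  have "\<exists>i v. (\<forall>n. i n \<in> I) \<and> (\<lambda>n. H.si.nm (H.si.sub (x (i n)) u)) \<longlonglongrightarrow> 0 \<and> v \<in> carrier L \<and>
      (\<lambda>n. L.si.nm (L.si.sub (y (i n)) v)) \<longlonglongrightarrow> 0" if u: "u \<in> carrier H" for u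
  proof -
    obtain i where i: "\<And>n. i n \<in> I" "(\<lambda>n. H.si.nm (H.si.sub (x (i n)) u)) \<longlonglongrightarrow> 0"
      by (rule dense_sequence[OF d u]) blast
    have "H.si.cauchy (\<lambda>n. x (i n))"
      using i x u by (intro H.si.cauchy_if_convergent[OF _ u]) auto
    hence "L.si.cauchy (\<lambda>n. y (i n))"
      unfolding L.si.cauchy_def H.si.cauchy_def using i(1) y by (simp add: dist)
    then obtain v where "v \<in> carrier L" "(\<lambda>n. L.si.nm (L.si.sub (y (i n)) v)) \<longlonglongrightarrow> 0"
      by (rule L.complete_seq)
    thus ?thesis using i by blast
  qed
  then obtain i v where i: "\<And>u n. u \<in> carrier H \<Longrightarrow> i u n \<in> I"
    "\<And>u. u \<in> carrier H \<Longrightarrow> (\<lambda>n. H.si.nm (H.si.sub (x (i u n)) u)) \<longlonglongrightarrow> 0"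
    and v: "\<And>u. u \<in> carrier H \<Longrightarrow> v u \<in> carrier L"
    "\<And>u. u \<in> carrier H \<Longrightarrow> (\<lambda>n. L.si.nm (L.si.sub (y (i u n)) (v u))) \<longlonglongrightarrow> 0" by metis
  define V where "V = (\<lambda>u\<in>carrier H. v u)"
  have V: "V \<in> isometries H L"
  proof (rule isometry_if_preserves_cinner)
    fix u w assume u: "u \<in> carrier H" and w: "w \<in> carrier H"
    have "(\<lambda>n. cinner L (y (i u n)) (y (i w n))) \<longlonglongrightarrow> cinner L (v u) (v w)"
      by (rule L.si.tendsto_ip) (use u w v i y in auto)
    moreover have "(\<lambda>n. cinner H (x (i u n)) (x (i w n))) \<longlonglongrightarrow> cinner H u w"
      by (rule H.si.tendsto_ip) (use u w i x in auto)
    ultimately show "cinner L (V u) (V w) = cinner H u w"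
      using u w i gram by (simp add: V_def LIMSEQ_unique)
  qed (auto simp: V_def v)
  have "V (x j) = y j" if j: "j \<in> I" for j
  proof -
    have xj: "x j \<in> carrier H" by (rule x[OF j])
    have "(\<lambda>n. L.si.nm (L.si.sub (y (i (x j) n)) (y j))) \<longlonglongrightarrow> 0"
      using i(2)[OF xj] dist[OF i(1)[OF xj] j] by simp
    hence lim: "(\<lambda>n. L.si.nm (L.si.sub (y (i (x j) n)) (v (x j))) + L.si.nm (L.si.sub (y (i (x j) n)) (y j)))
        \<longlonglongrightarrow> 0 + 0"
      by (intro tendsto_add v(2)[OF xj])
    have "L.si.nm (L.si.sub (v (x j)) (y j))
        \<le> L.si.nm (L.si.sub (y (i (x j) n)) (v (x j))) + L.si.nm (L.si.sub (y (i (x j) n)) (y j))" for n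
      using L.si.dist_triangle[of "v (x j)" "y (i (x j) n)" "y j"]
        L.si.dist_sym[of "v (x j)" "y (i (x j) n)"] v(1)[OF xj] y i(1)[OF xj] j by simp
    hence "L.si.nm (L.si.sub (v (x j)) (y j)) \<le> 0 + 0" using lim by (intro LIMSEQ_le_const) auto
    hence "L.si.nm (L.si.sub (v (x j)) (y j)) = 0"
      using L.si.nm_nonneg[OF L.si.sub_closed[OF v(1)[OF xj] y[OF j]]] by linarith
    thus ?thesis using L.eq_if_dist_zero v(1)[OF xj] y[OF j] xj by (simp add: V_def)
  qed
  thus ?thesis using V that by blast
qed

end

lemma bounded_ops_compose:
  assumes "complex_hilbert_space H1" "complex_hilbert_space H2" "complex_hilbert_space H3"
    and S: "S \<in> bounded_ops H1 H2" and T: "T \<in> bounded_ops H2 H3"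
  shows "compose (carrier H1) T S \<in> bounded_ops H1 H3"
proof -
  interpret p: hilbert_pair H1 H2 by (simp add: assms hilbert_pair_def)
  interpret q: hilbert_pair H2 H3 by (simp add: assms hilbert_pair_def)
  interpret r: hilbert_pair H1 H3 ..
  obtain B where B: "0 \<le> B" "\<And>x. x \<in> carrier H1 \<Longrightarrow> p.L.si.nm (S x) \<le> B * p.H.si.nm x"
    by (rule p.bounded_ops_bound[OF S]) blast
  obtain C where C: "0 \<le> C" "\<And>x. x \<in> carrier H2 \<Longrightarrow> q.L.si.nm (T x) \<le> C * p.L.si.nm x"
    by (rule q.bounded_ops_bound[OF T]) blast
  note SD = bounded_opsD[OF S] and TD = bounded_opsD[OF T]
  show ?thesis
  proof (rule r.bounded_opsI[where B = "C * B"])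
    fix x assume x: "x \<in> carrier H1"
    have "q.L.si.nm (T (S x)) \<le> C * p.L.si.nm (S x)" using C SD x by simp
    also have "\<dots> \<le> C * (B * p.H.si.nm x)" using B(2)[OF x] C(1) by (intro mult_left_mono) auto
    finally show "q.L.si.nm (compose (carrier H1) T S x) \<le> C * B * p.H.si.nm x"
      using x by (simp add: compose_eq mult_ac)
  qed (auto simp: compose_eq SD TD)
qed


section \<open>Regular measures on a compact Hausdorff space\<close>

lemma Urysohn_compact:
  fixes K :: "'a::t2_space set"
  assumes K: "compact K" and C: "closedin (top_of_set K) C" and D: "closedin (top_of_set K) D"
    and disj: "C \<inter> D = {}"
  obtains f :: "'a \<Rightarrow> real" where "continuous_on K f" "\<And>x. x \<in> K \<Longrightarrow> 0 \<le> f x \<and> f x \<le> 1"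
    "\<And>x. x \<in> C \<Longrightarrow> f x = 1" "\<And>x. x \<in> D \<Longrightarrow> f x = 0"
proof -
  have "Hausdorff_space (euclidean :: 'a topology)"
    using hausdorff by (fastforce simp: Hausdorff_space_def disjnt_def)
  hence "Hausdorff_space (top_of_set K)" by (rule Hausdorff_space_subtopology)
  hence n: "normal_space (top_of_set K)"
    using K by (intro compact_Hausdorff_or_regular_imp_normal_space) (auto simp: compact_space_subtopology)
  obtain f where f: "continuous_map (top_of_set K) (top_of_set {0..1::real}) f" "f ` D \<subseteq> {0}" "f ` C \<subseteq> {1}"
    by (rule Urysohn_lemma[OF n D C, of 0 1]) (use disj in \<open>auto simp: disjnt_def\<close>)
  have "continuous_on K f" "f ` K \<subseteq> {0..1}"
    using f(1) by (auto simp: continuous_map_in_subtopology)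
  moreover have "f x = 1" if "x \<in> C" for x using f(3) that by blast
  moreover have "f x = 0" if "x \<in> D" for x using f(2) that by blast
  ultimately show ?thesis by (intro that[of f]) (auto simp: image_subset_iff)
qed

lemma closedin_compact_iff:
  fixes K :: "'a::t2_space set"
  assumes "compact K"
  shows "closedin (top_of_set K) C \<longleftrightarrow> compact C \<and> C \<subseteq> K"
proof
  assume C: "closedin (top_of_set K) C"
  thus "compact C \<and> C \<subseteq> K" using closedin_compact[OF assms C] closedin_imp_subset[OF C] by blast
next
  assume "compact C \<and> C \<subseteq> K"
  thus "closedin (top_of_set K) C" by (auto intro: closed_subset compact_imp_closed)
qed

lemma closedin_superlevel:
  fixes f :: "'a::topological_space \<Rightarrow> real"
  assumes "continuous_on K f" shows "closedin (top_of_set K) {x \<in> K. c \<le> f x}"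
proof -
  have "{x \<in> K. c \<le> f x} = K \<inter> f -` {c..}" by auto
  thus ?thesis using continuous_closedin_preimage[OF assms, of "{c..}"] by simp
qed

lemma openin_superlevel:
  fixes f :: "'a::topological_space \<Rightarrow> real"
  assumes "continuous_on K f" shows "openin (top_of_set K) {x \<in> K. c < f x}"
proof -
  have "{x \<in> K. c < f x} = K \<inter> f -` {c<..}" by auto
  thus ?thesis using continuous_openin_preimage_gen[OF assms, of "{c<..}"] by simp
qed

subsection \<open>The Riesz--Markov theorem\<close>

text \<open>The measure of an open set \<open>U\<close> is the supremum of the functional over the functions with
  values in \<open>[0, 1]\<close> that vanish off \<open>U\<close>, and the outer measure of a set is the infimum over its
  open neighbourhoods.  Caratheodory's construction yields a measure once open sets are known to
  be measurable.\<close>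

locale positive_functional =
  fixes K :: "'a::t2_space set" and l :: "('a \<Rightarrow> real) \<Rightarrow> real"
  assumes K: "compact K"
    and add: "\<And>f g. continuous_on K f \<Longrightarrow> continuous_on K g \<Longrightarrow> l (\<lambda>x. f x + g x) = l f + l g"
    and scale: "\<And>c f. continuous_on K f \<Longrightarrow> l (\<lambda>x. c * f x) = c * l f"
    and pos: "\<And>f. continuous_on K f \<Longrightarrow> (\<And>x. x \<in> K \<Longrightarrow> 0 \<le> f x) \<Longrightarrow> 0 \<le> l f"
begin

abbreviation "op \<equiv> openin (top_of_set K)"

text \<open>Vanishing off \<open>U\<close> is weaker than having support in \<open>U\<close>.  The missing margin is created by
  \<open>trim e f\<close>, which vanishes outside the compact set \<open>{e \<le> f}\<close> and changes the functional by at
  most \<open>e * total\<close>.\<close>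

definition adm :: "'a set \<Rightarrow> ('a \<Rightarrow> real) set" where
  "adm U = {f. continuous_on K f \<and> (\<forall>x\<in>K. 0 \<le> f x \<and> f x \<le> 1) \<and> (\<forall>x\<in>K - U. f x = 0)}"

definition total :: real where "total = l (\<lambda>_. 1)"
definition \<rho> :: "'a set \<Rightarrow> real" where "\<rho> U = (SUP f\<in>adm U. l f)"
definition trim :: "real \<Rightarrow> ('a \<Rightarrow> real) \<Rightarrow> 'a \<Rightarrow> real" where "trim e f = (\<lambda>x. max 0 (f x - e))"

lemma mono:
  assumes "continuous_on K f" "continuous_on K g" "\<And>x. x \<in> K \<Longrightarrow> f x \<le> g x"
  shows "l f \<le> l g"
proof -
  have "0 \<le> l (\<lambda>x. g x + (-1) * f x)"
    using assms by (intro pos) (auto intro!: continuous_intros)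
  also have "\<dots> = l g + l (\<lambda>x. (-1) * f x)"
    using assms by (intro add) (auto intro!: continuous_intros)
  also have "l (\<lambda>x. (-1) * f x) = - l f" using scale[OF assms(1), of "-1"] by simp
  finally show ?thesis by simp
qed

lemma l_const: "l (\<lambda>x. c) = c * total"
  using scale[of "\<lambda>_. 1" c] by (simp add: total_def)

lemma total_nonneg: "0 \<le> total"
  unfolding total_def by (rule pos) auto

lemma adm_cont: "f \<in> adm U \<Longrightarrow> continuous_on K f" by (simp add: adm_def)

lemma adm_le_total: "f \<in> adm U \<Longrightarrow> l f \<le> total"
  unfolding total_def by (rule mono) (auto simp: adm_def)

lemma adm_zero: "(\<lambda>_. 0) \<in> adm U" by (simp add: adm_def)

lemma adm_le: "f \<in> adm U \<Longrightarrow> l f \<le> \<rho> U"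
  unfolding \<rho>_def by (intro cSUP_upper) (auto simp: bdd_above_def intro: adm_le_total)

lemma \<rho>_le: "(\<And>f. f \<in> adm U \<Longrightarrow> l f \<le> c) \<Longrightarrow> \<rho> U \<le> c"
  unfolding \<rho>_def using adm_zero by (intro cSUP_least) auto

lemma \<rho>_nonneg [simp]: "0 \<le> \<rho> U"
  using adm_le[OF adm_zero] l_const[of 0] by simp

lemma \<rho>_mono: "U \<subseteq> V \<Longrightarrow> \<rho> U \<le> \<rho> V"
  by (rule \<rho>_le, rule adm_le) (auto simp: adm_def)

lemma \<rho>_empty: "\<rho> {} = 0"
proof (rule antisym[OF \<rho>_le \<rho>_nonneg])
  fix f assume f: "f \<in> adm {}"
  have "l f \<le> l (\<lambda>_. 0)" using f by (intro mono) (auto simp: adm_def)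
  thus "l f \<le> 0" using l_const[of 0] by simp
qed

lemma \<rho>_space: "\<rho> K = total"
proof (rule antisym[OF \<rho>_le])
  show "total \<le> \<rho> K" unfolding total_def by (rule adm_le) (auto simp: adm_def)
qed (rule adm_le_total)

lemma trim_adm: "f \<in> adm U \<Longrightarrow> 0 < e \<Longrightarrow> trim e f \<in> adm U"
  by (fastforce simp: adm_def trim_def intro!: continuous_intros)

lemma le_trim:
  assumes "continuous_on K f" "0 < e" shows "l f \<le> l (trim e f) + e * total"
proof -
  have c: "continuous_on K (trim e f)" unfolding trim_def using assms(1) by (intro continuous_intros)
  have "l f \<le> l (\<lambda>x. trim e f x + e)"
    using assms(1) c by (intro mono continuous_intros) (auto simp: trim_def)
  also have "\<dots> = l (trim e f) + e * total" using c by (simp add: add l_const)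
  finally show ?thesis .
qed

lemma le_if_le_eps:
  assumes "\<And>e::real. 0 < e \<Longrightarrow> a \<le> b + e * total" shows "a \<le> b"
proof (rule field_le_epsilon)
  fix d :: real assume "0 < d"
  have "a \<le> b + d / (total + 1) * total" using \<open>0 < d\<close> total_nonneg by (intro assms) auto
  also have "d / (total + 1) * total \<le> d" using \<open>0 < d\<close> total_nonneg by (simp add: field_simps)
  finally show "a \<le> b + d" by simp
qed

text \<open>A partition of unity is avoided: with a Urysohn function \<open>g\<close> that is \<open>1\<close> on the part of
  \<open>{f \<ge> e}\<close> outside \<open>V\<close> and \<open>0\<close> outside \<open>U\<close>, the product \<open>f * g\<close> is supported in \<open>U\<close>, and what
  remains of \<open>f\<close> outside \<open>V\<close> is at most \<open>e\<close>.\<close>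

lemma \<rho>_Un_le:
  assumes U: "op U" and V: "op V" shows "\<rho> (U \<union> V) \<le> \<rho> U + \<rho> V"
proof (rule \<rho>_le)
  fix f assume f: "f \<in> adm (U \<union> V)"
  note cf = adm_cont[OF f]
  show "l f \<le> \<rho> U + \<rho> V"
  proof (rule le_if_le_eps)
    fix e :: real assume e: "0 < e"
    let ?C = "{x \<in> K. e \<le> f x} - V"
    have C: "closedin (top_of_set K) ?C"
      by (intro closedin_diff closedin_superlevel cf V)
    have D: "closedin (top_of_set K) (K - U)" using closedin_diff[OF closedin_topspace U] by simp
    have dj: "?C \<inter> (K - U) = {}" using f e by (auto simp: adm_def)
    obtain g where g: "continuous_on K g" "\<And>x. x \<in> K \<Longrightarrow> 0 \<le> g x \<and> g x \<le> 1"
      "\<And>x. x \<in> ?C \<Longrightarrow> g x = 1" "\<And>x. x \<in> K - U \<Longrightarrow> g x = (0::real)"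
      by (rule Urysohn_compact[OF K C D dj]) blast
    let ?f1 = "\<lambda>x. f x * g x" and ?f2 = "\<lambda>x. f x * (1 - g x)"
    have c: "continuous_on K ?f1" "continuous_on K ?f2" by (intro continuous_intros cf g(1))+
    have b: "0 \<le> f x" "f x \<le> 1" if "x \<in> K" for x using f that by (auto simp: adm_def)
    have f1: "?f1 \<in> adm U" using c(1) b g by (auto simp: adm_def intro: mult_le_one)
    have f2: "trim e ?f2 \<in> adm V"
    proof -
      have "?f2 x \<le> 1" if "x \<in> K" for x using b[OF that] g(2)[OF that] by (intro mult_le_one) auto
      moreover have "?f2 x \<le> e" if "x \<in> K - V" for x
      proof (cases "e \<le> f x")
        case True thus ?thesis using g(3)[of x] that e by simp
      next
        case False
        have "f x * (1 - g x) \<le> f x * 1" using b[of x] g(2)[of x] that by (intro mult_left_mono) auto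
        thus ?thesis using False by simp
      qed
      ultimately show ?thesis using e c(2)
        by (auto simp: adm_def trim_def intro!: continuous_intros cf g(1)) fastforce
    qed
    have "l f = l (\<lambda>x. ?f1 x + ?f2 x)" by (simp add: algebra_simps)
    also have "\<dots> = l ?f1 + l ?f2" by (rule add[OF c])
    also have "\<dots> \<le> \<rho> U + (\<rho> V + e * total)"
      using adm_le[OF f1] adm_le[OF f2] le_trim[OF c(2) e] by linarith
    finally show "l f \<le> \<rho> U + \<rho> V + e * total" by simp
  qed
qed

lemma \<rho>_finite_UN_le:
  assumes "\<And>i. op (U i)" shows "\<rho> (\<Union>i<n::nat. U i) \<le> (\<Sum>i<n. \<rho> (U i))"
proof (induction n)
  case 0 show ?case by (simp add: \<rho>_empty)
next
  case (Suc n)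
  have "\<rho> (\<Union>i<Suc n. U i) = \<rho> ((\<Union>i<n. U i) \<union> U n)" by (simp add: lessThan_Suc Un_commute)
  also have "\<dots> \<le> \<rho> (\<Union>i<n. U i) + \<rho> (U n)" using assms by (intro \<rho>_Un_le openin_Union) auto
  finally show ?case using Suc by simp
qed

text \<open>A trimmed function is supported in a compact set, which finitely many of the open sets cover.\<close>

lemma \<rho>_UN_le:
  assumes U: "\<And>i::nat. op (U i)" shows "ennreal (\<rho> (\<Union>i. U i)) \<le> (\<Sum>i. ennreal (\<rho> (U i)))"
proof (cases "(\<Sum>i. ennreal (\<rho> (U i)))")
  case (real S)
  have fin: "(\<Sum>i<n. \<rho> (U i)) \<le> S" for n
  proof -
    have "ennreal (\<Sum>i<n. \<rho> (U i)) = (\<Sum>i<n. ennreal (\<rho> (U i)))" by simp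
    also have "\<dots> \<le> ennreal S" unfolding real(2)[symmetric] by (rule sum_le_suminf) auto
    finally show ?thesis using real(1) by simp
  qed
  have "\<rho> (\<Union>i. U i) \<le> S"
  proof (rule \<rho>_le, rule le_if_le_eps)
    fix f and e :: real assume f: "f \<in> adm (\<Union>i. U i)" and e: "0 < e"
    let ?C = "{x \<in> K. e \<le> f x}"
    have cC: "compact ?C" using closedin_superlevel[OF adm_cont[OF f]] closedin_compact_iff[OF K] by blast
    have "\<exists>T. open T \<and> U i = K \<inter> T" for i using U[of i] by (simp add: openin_open)
    then obtain T where T: "\<And>i. open (T i)" "\<And>i. U i = K \<inter> T i" by metis
    have cov: "?C \<subseteq> (\<Union>i\<in>UNIV. T i)" using f e T(2) by (force simp: adm_def)
    obtain I where I: "finite I" "?C \<subseteq> (\<Union>i\<in>I. T i)"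
      by (rule compactE_image[OF cC T(1) cov]) blast
    then obtain n where n: "I \<subseteq> {..<n}" using finite_nat_iff_bounded by blast
    have "trim e f \<in> adm (\<Union>i<n. U i)"
    proof -
      have "f x \<le> e" if "x \<in> K - (\<Union>i<n. U i)" for x
        using I(2) n that T(2) by (force simp: not_le[symmetric])
      thus ?thesis using trim_adm[OF f e] by (auto simp: adm_def trim_def)
    qed
    hence "l (trim e f) \<le> S" using adm_le \<rho>_finite_UN_le[of U n, OF U] fin[of n] by fastforce
    thus "l f \<le> S + e * total" using le_trim[OF adm_cont[OF f] e] by linarith
  qed
  thus ?thesis using real by (simp add: ennreal_leI)
qed simp

definition outer :: "'a set \<Rightarrow> ennreal" where
  "outer E = (INF U\<in>{U. op U \<and> E \<subseteq> U}. ennreal (\<rho> U))"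

lemma outer_le: "op U \<Longrightarrow> E \<subseteq> U \<Longrightarrow> outer E \<le> ennreal (\<rho> U)"
  unfolding outer_def by (rule INF_lower) auto

lemma outer_open: "op U \<Longrightarrow> outer U = ennreal (\<rho> U)"
  by (rule antisym[OF outer_le]) (auto simp: outer_def intro!: INF_greatest ennreal_leI \<rho>_mono)

lemma outer_approx:
  assumes "E \<subseteq> K" "0 < e" obtains U where "op U" "E \<subseteq> U" "ennreal (\<rho> U) \<le> outer E + ennreal e"
proof -
  have "outer E \<le> ennreal (\<rho> K)" using assms(1) by (intro outer_le) auto
  hence fin: "outer E < top_class.top" using le_less_trans ennreal_less_top by blast
  hence "outer E < outer E + ennreal e" using assms(2) by (simp add: ennreal_add_left_cancel_less[of "outer E" 0 "ennreal e", simplified])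
  thus ?thesis unfolding outer_def INF_less_iff using that unfolding outer_def by (auto intro: less_imp_le)
qed

text \<open>Open neighbourhoods that are optimal up to \<open>e / 2 ^ (i + 1)\<close> reduce countable subadditivity
  to open sets.\<close>

lemma outer_measure_space_outer: "outer_measure_space (Pow K) outer"
  unfolding outer_measure_space_def
proof (intro conjI)
  show "positive (Pow K) outer" using outer_open[of "{}"] by (simp add: positive_def \<rho>_empty)
  show "increasing (Pow K) outer"
    unfolding increasing_def outer_def by (auto intro!: INF_superset_mono)
  show "countably_subadditive (Pow K) outer"
    unfolding countably_subadditive_def
  proof (intro allI impI)
    fix A :: "nat \<Rightarrow> 'a set" assume "range A \<subseteq> Pow K"
    hence A: "A i \<subseteq> K" for i by blast
    show "outer (\<Union>i. A i) \<le> (\<Sum>i. outer (A i))"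
    proof (rule ennreal_le_epsilon)
      fix e :: real assume e: "0 < e"
      have "\<exists>U. op U \<and> A i \<subseteq> U \<and> ennreal (\<rho> U) \<le> outer (A i) + ennreal (e * (1/2) ^ Suc i)" for i
        by (rule outer_approx[OF A, of "e * (1/2) ^ Suc i" i]) (use e in auto)
      then obtain U where U: "\<And>i. op (U i)" "\<And>i. A i \<subseteq> U i"
        "\<And>i. ennreal (\<rho> (U i)) \<le> outer (A i) + ennreal (e * (1/2) ^ Suc i)" by metis
      have "outer (\<Union>i. A i) \<le> ennreal (\<rho> (\<Union>i. U i))"
        using U by (intro outer_le openin_Union) auto
      also have "\<dots> \<le> (\<Sum>i. ennreal (\<rho> (U i)))" by (rule \<rho>_UN_le[OF U(1)])
      also have "\<dots> \<le> (\<Sum>i. outer (A i) + ennreal (e * (1/2) ^ Suc i))" by (intro suminf_le U) auto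
      also have "\<dots> = (\<Sum>i. outer (A i)) + (\<Sum>i. ennreal (e * (1/2) ^ Suc i))"
        by (intro suminf_add[symmetric]) auto
      also have "(\<Sum>i. ennreal (e * (1/2) ^ Suc i)) = ennreal e"
        using e sums_mult[OF power_half_series, of e] by (intro suminf_ennreal_eq) (auto simp del: power_Suc)
      finally show "outer (\<Union>i. A i) \<le> (\<Sum>i. outer (A i)) + ennreal e" .
    qed
  qed
qed

text \<open>If \<open>f\<close> almost exhausts \<open>W \<inter> U\<close> then any function supported off \<open>{f \<ge> e}\<close> can be added
  to the trimmed \<open>f\<close> without exceeding \<open>1\<close>.\<close>

lemma open_in_lambda_system:
  assumes U: "op U" shows "U \<in> lambda_system K (Pow K) outer"
proof -
  interpret P: Sigma_Algebra.algebra K "Pow K" by (rule algebra_Pow)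
  have UK: "U \<subseteq> K" using U openin_imp_subset by blast
  have os: "outer W \<ge> outer (W \<inter> U) + outer (W - U)" if W: "op W" for W
  proof -
    have WK: "W \<subseteq> K" using W openin_imp_subset by blast
    have o: "op (W \<inter> U)" by (rule openin_Int[OF W U])
    have fin: "outer (W - U) \<noteq> top_class.top"
      using outer_le[OF W, of "W - U"] by (auto simp: top_unique)
    define w where "w = enn2real (outer (W - U))"
    have w: "outer (W - U) = ennreal w" "0 \<le> w" using fin by (auto simp: w_def ennreal_enn2real_if)
    have "\<rho> (W \<inter> U) \<le> \<rho> W - w"
    proof (rule \<rho>_le, rule le_if_le_eps)
      fix f and e :: real assume f: "f \<in> adm (W \<inter> U)" and e: "0 < e"
      let ?C = "{x \<in> K. e \<le> f x}"
      have o2: "op (W - ?C)" by (intro openin_diff W closedin_superlevel adm_cont[OF f])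
      have "W - U \<subseteq> W - ?C" using f e by (auto simp: adm_def) 
      hence "ennreal w \<le> ennreal (\<rho> (W - ?C))" using outer_le[OF o2] w(1) by metis
      hence "w \<le> \<rho> (W - ?C)" using w(2) by simp
      also have "\<dots> \<le> \<rho> W - l (trim e f)"
      proof (rule \<rho>_le)
        fix g assume g: "g \<in> adm (W - ?C)"
        have t: "trim e f \<in> adm (W \<inter> U)" by (rule trim_adm[OF f e])
        have "(\<lambda>x. trim e f x + g x) \<in> adm W"
        proof -
          have "trim e f x + g x \<le> 1" if x: "x \<in> K" for x
          proof (cases "e \<le> f x")
            case True
            hence "g x = 0" using g x by (auto simp: adm_def)
            thus ?thesis using t x by (auto simp: adm_def)
          next
            case False
            hence "trim e f x = 0" by (simp add: trim_def)
            thus ?thesis using g x by (auto simp: adm_def)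
          qed
          thus ?thesis using t g by (auto simp: adm_def intro!: continuous_intros)
        qed
        hence "l (trim e f) + l g \<le> \<rho> W" using adm_le add adm_cont t g by metis
        thus "l g \<le> \<rho> W - l (trim e f)" by linarith
      qed
      finally show "l f \<le> \<rho> W - w + e * total" using le_trim[OF adm_cont[OF f] e] by linarith
    qed
    hence "\<rho> (W \<inter> U) + w \<le> \<rho> W" by simp
    hence "ennreal (\<rho> (W \<inter> U) + w) \<le> ennreal (\<rho> W)" by (rule ennreal_leI)
    thus ?thesis using w by (simp add: outer_open[OF W] outer_open[OF o])
  qed
  have "outer (E \<inter> U) + outer (E - U) = outer E" if E: "E \<subseteq> K" for E
  proof (rule antisym)
    show "outer (E \<inter> U) + outer (E - U) \<le> outer E"
    proof (rule ennreal_le_epsilon)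
      fix e :: real assume "0 < e"
      then obtain W where W: "op W" "E \<subseteq> W" "ennreal (\<rho> W) \<le> outer E + ennreal e"
        by (rule outer_approx[OF E]) blast
      have WK: "W \<subseteq> K" using W openin_imp_subset by blast
      have inc: "increasing (Pow K) outer" using outer_measure_space_outer by (simp add: outer_measure_space_def)
      have "outer (E \<inter> U) + outer (E - U) \<le> outer (W \<inter> U) + outer (W - U)"
        using W(2) WK by (intro add_mono increasingD[OF inc]) auto
      also have "\<dots> \<le> outer W" by (rule os[OF W(1)])
      also have "\<dots> \<le> outer E + ennreal e" using W by (simp add: outer_open)
      finally show "outer (E \<inter> U) + outer (E - U) \<le> outer E + ennreal e" .
    qed
    have sa: "subadditive (Pow K) outer"
      using outer_measure_space_outer P.countably_subadditive_subadditive
      by (simp add: outer_measure_space_def)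
    have "outer ((E \<inter> U) \<union> (E - U)) \<le> outer (E \<inter> U) + outer (E - U)"
      using E by (intro subadditiveD[OF sa]) auto
    thus "outer E \<le> outer (E \<inter> U) + outer (E - U)" by (simp add: Int_Diff_Un)
  qed
  thus ?thesis using UK by (auto simp: P.lambda_system_eq)
qed

definition \<nu> :: "'a measure" where
  "\<nu> = measure_of K (sets (restrict_space borel K)) outer"

lemma sets_\<nu>: "sets \<nu> = sets (restrict_space borel K)" and space_\<nu>: "space \<nu> = K"
proof -
  have "sets (restrict_space borel K) \<subseteq> Pow K"
    using sets.space_closed[of "restrict_space borel K"] by (simp add: space_restrict_space)
  moreover have "sigma_algebra K (sets (restrict_space borel K))"
    using sets.sigma_algebra_axioms[of "restrict_space borel K"] by (simp add: space_restrict_space)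
  ultimately show "sets \<nu> = sets (restrict_space borel K)" "space \<nu> = K"
    by (simp_all add: \<nu>_def sigma_algebra.sigma_sets_eq space_measure_of)
qed

lemma emeasure_\<nu>: "A \<in> sets \<nu> \<Longrightarrow> emeasure \<nu> A = outer A"
proof -
  assume A: "A \<in> sets \<nu>"
  interpret S: sigma_algebra K "Pow K" by (rule sigma_algebra_Pow)
  let ?L = "lambda_system K (Pow K) outer"
  have ms: "measure_space K ?L outer" by (rule S.caratheodory_lemma[OF outer_measure_space_outer])
  then interpret L: sigma_algebra K ?L by (simp add: measure_space_def)
  have "K \<inter> B \<in> ?L" if "B \<in> sets borel" for B
  proof -
    have "B \<in> sigma_sets UNIV {S. open S}" using that by (simp add: borel_def)
    thus ?thesis
    proof induction
      case (Basic U)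
      thus ?case by (intro open_in_lambda_system) (auto simp: openin_open)
    next
      case (Compl A)
      have "K \<inter> (UNIV - A) = K - (K \<inter> A)" by auto
      thus ?case using L.compl_sets[OF Compl.IH] by simp
    next
      case (Union A)
      thus ?case using L.countable_UN[of "\<lambda>i. K \<inter> A i"] by (simp add: image_subset_iff)
    qed simp
  qed
  hence sub: "sets (restrict_space borel K) \<subseteq> ?L" by (auto simp: sets_restrict_space)
  have sa: "sigma_algebra K (sets (restrict_space borel K))"
    using sets.sigma_algebra_axioms[of "restrict_space borel K"] by (simp add: space_restrict_space)
  have "countably_additive (sets (restrict_space borel K)) outer"
    using ms sub unfolding measure_space_def countably_additive_def by blast
  moreover have "positive (sets (restrict_space borel K)) outer"
    using ms unfolding measure_space_def positive_def by simp
  ultimately show ?thesis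
    unfolding \<nu>_def using A sa sets_\<nu> by (intro emeasure_measure_of_sigma) auto
qed

end


lemma pos_measuresD:
  assumes "\<mu> \<in> pos_measures K"
  shows "sets \<mu> = sets (restrict_space borel K)" "finite_measure \<mu>" "space \<mu> = K"
    and "A \<in> sets \<mu> \<Longrightarrow> emeasure \<mu> A = (SUP C\<in>{C. C \<subseteq> A \<and> compact C}. emeasure \<mu> C)"
    and "A \<in> sets \<mu> \<Longrightarrow> emeasure \<mu> A = (INF U\<in>{U. A \<subseteq> U \<and> open U}. emeasure \<mu> (U \<inter> K))"
proof -
  show s: "sets \<mu> = sets (restrict_space borel K)" and "finite_measure \<mu>"
    using assms unfolding pos_measures_def by blast+
  show "space \<mu> = K" using sets_eq_imp_space_eq[OF s] by (simp add: space_restrict_space)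
qed (use assms in \<open>unfold pos_measures_def, blast+\<close>)

lemma open_in_sets:
  assumes "sets \<mu> = sets (restrict_space borel K)" "openin (top_of_set K) U" shows "U \<in> sets \<mu>"
  using assms by (auto simp: sets_restrict_space openin_open)

lemma compact_in_sets:
  fixes K :: "'a::t2_space set"
  assumes "sets \<mu> = sets (restrict_space borel K)" "compact C" "C \<subseteq> K" shows "C \<in> sets \<mu>"
proof -
  have "C \<in> sets borel" using compact_imp_closed[OF assms(2)] by simp
  moreover have "C = K \<inter> C" using assms by auto
  ultimately show ?thesis unfolding assms(1) sets_restrict_space by (rule image_eqI[rotated])
qed

lemma borel_measurable_continuous:
  assumes "\<mu> \<in> pos_measures K" "continuous_on K f" shows "f \<in> borel_measurable \<mu>"
  using borel_measurable_continuous_on_restrict[OF assms(2)] pos_measuresD(1)[OF assms(1)]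
  by (simp cong: measurable_cong_sets)

lemma bounded_on_compact:
  fixes f :: "'a::topological_space \<Rightarrow> 'b::real_normed_vector"
  assumes "compact K" "continuous_on K f" obtains B where "0 < B" "\<And>x. x \<in> K \<Longrightarrow> norm (f x) \<le> B"
proof -
  have "bounded (f ` K)" using assms by (intro compact_imp_bounded compact_continuous_image)
  then obtain B where "0 < B" "\<forall>x\<in>f ` K. norm x \<le> B" using bounded_pos by blast
  thus ?thesis using that by blast
qed

lemma integrable_continuous:
  fixes f :: "'a::topological_space \<Rightarrow> 'b::{banach, second_countable_topology}"
  assumes "compact K" "\<mu> \<in> pos_measures K" "continuous_on K f" shows "integrable \<mu> f"
proof -
  interpret finite_measure \<mu> by (rule pos_measuresD(2)[OF assms(2)])
  obtain B where "\<And>x. x \<in> K \<Longrightarrow> norm (f x) \<le> B" by (rule bounded_on_compact[OF assms(1,3)]) blast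
  thus ?thesis using borel_measurable_continuous[OF assms(2,3)]
    by (intro integrable_const_bound[of _ B]) (auto simp: pos_measuresD(3)[OF assms(2)] intro!: AE_I2)
qed

context positive_functional
begin

lemma emeasure_\<nu>_open: "op U \<Longrightarrow> emeasure \<nu> U = ennreal (\<rho> U)"
  by (simp add: emeasure_\<nu> open_in_sets[OF sets_\<nu>] outer_open)

lemma finite_\<nu>: "finite_measure \<nu>"
  by (rule finite_measureI) (simp add: space_\<nu> emeasure_\<nu>_open)

lemma measure_\<nu>_open: "op U \<Longrightarrow> measure \<nu> U = \<rho> U"
  by (simp add: measure_def emeasure_\<nu>_open)

text \<open>Outer regularity holds by construction.  The complement of an open neighbourhood of \<open>K - A\<close> is a
  compact subset of \<open>A\<close>, which turns it into inner regularity.\<close>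

theorem \<nu>_regular: "\<nu> \<in> pos_measures K"
proof -
  interpret finite_measure \<nu> by (rule finite_\<nu>)
  have outer_reg: "emeasure \<nu> A = (INF U\<in>{U. A \<subseteq> U \<and> open U}. emeasure \<nu> (U \<inter> K))"
    if A: "A \<in> sets \<nu>" for A
  proof (rule antisym)
    have AK: "A \<subseteq> K" using sets.sets_into_space[OF A] space_\<nu> by simp
    show "emeasure \<nu> A \<le> (INF U\<in>{U. A \<subseteq> U \<and> open U}. emeasure \<nu> (U \<inter> K))"
    proof (rule INF_greatest, rule emeasure_mono)
      fix U assume "U \<in> {U. A \<subseteq> U \<and> open U}"
      thus "A \<subseteq> U \<inter> K" "U \<inter> K \<in> sets \<nu>"
        using AK open_in_sets[OF sets_\<nu>, of "U \<inter> K"] by (auto simp: openin_open)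
    qed
    show "(INF U\<in>{U. A \<subseteq> U \<and> open U}. emeasure \<nu> (U \<inter> K)) \<le> emeasure \<nu> A"
      unfolding emeasure_\<nu>[OF A] outer_def
    proof (rule INF_greatest)
      fix V assume V: "V \<in> {U. op U \<and> A \<subseteq> U}"
      then obtain U where U: "open U" "V = K \<inter> U" by (auto simp: openin_open)
      have "(INF U\<in>{U. A \<subseteq> U \<and> open U}. emeasure \<nu> (U \<inter> K)) \<le> emeasure \<nu> (U \<inter> K)"
        by (rule INF_lower) (use U V in auto)
      also have "\<dots> = ennreal (\<rho> V)" using emeasure_\<nu>_open[of V] V U by (simp add: Int_commute)
      finally show "(INF U\<in>{U. A \<subseteq> U \<and> open U}. emeasure \<nu> (U \<inter> K)) \<le> ennreal (\<rho> V)" .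
    qed
  qed
  have inner_reg: "emeasure \<nu> A = (SUP C\<in>{C. C \<subseteq> A \<and> compact C}. emeasure \<nu> C)"
    if A: "A \<in> sets \<nu>" for A
  proof (rule antisym)
    have AK: "A \<subseteq> K" using sets.sets_into_space[OF A] space_\<nu> by simp
    show "(SUP C\<in>{C. C \<subseteq> A \<and> compact C}. emeasure \<nu> C) \<le> emeasure \<nu> A"
      by (rule SUP_least, rule emeasure_mono) (use A in auto)
    show "emeasure \<nu> A \<le> (SUP C\<in>{C. C \<subseteq> A \<and> compact C}. emeasure \<nu> C)"
    proof (rule ennreal_le_epsilon)
      fix e :: real assume e: "0 < e"
      have KA: "K - A \<in> sets \<nu>" using A sets.compl_sets[OF A] by (simp add: space_\<nu>)
      obtain U where U: "op U" "K - A \<subseteq> U" "ennreal (\<rho> U) \<le> outer (K - A) + ennreal e"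
        using outer_approx[of "K - A" e] e by blast
      have UK: "U \<subseteq> K" using U(1) openin_imp_subset by blast
      have C: "compact (K - U)"
        using closedin_diff[OF closedin_topspace U(1)] closedin_compact_iff[OF K] by simp
      have "measure \<nu> (K - A) + measure \<nu> A = measure \<nu> K"
        using finite_measure_compl[OF A] by (simp add: space_\<nu>)
      moreover have "measure \<nu> (K - U) + measure \<nu> U = measure \<nu> K"
        using finite_measure_compl[OF open_in_sets[OF sets_\<nu> U(1)]] by (simp add: space_\<nu>)
      moreover have "measure \<nu> U \<le> measure \<nu> (K - A) + e"
      proof -
        have "ennreal (measure \<nu> U) \<le> emeasure \<nu> (K - A) + ennreal e"
          using U(3) emeasure_\<nu>[OF KA] by (simp add: measure_\<nu>_open[OF U(1)])
        also have "\<dots> = ennreal (measure \<nu> (K - A) + e)" using e by (simp add: emeasure_eq_measure)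
        finally have "ennreal (measure \<nu> U) \<le> ennreal (measure \<nu> (K - A) + e)" .
        moreover have "0 \<le> measure \<nu> (K - A) + e" using e by (simp add: add_nonneg_nonneg)
        ultimately show ?thesis using ennreal_le_iff by blast
      qed
      ultimately have "measure \<nu> A \<le> measure \<nu> (K - U) + e" by linarith
      hence "ennreal (measure \<nu> A) \<le> ennreal (measure \<nu> (K - U) + e)" by (rule ennreal_leI)
      hence "emeasure \<nu> A \<le> emeasure \<nu> (K - U) + ennreal e"
        using e by (simp add: emeasure_eq_measure)
      also have "emeasure \<nu> (K - U) \<le> (SUP C\<in>{C. C \<subseteq> A \<and> compact C}. emeasure \<nu> C)"
        by (rule SUP_upper) (use C U(2) in auto)
      finally show "emeasure \<nu> A \<le> (SUP C\<in>{C. C \<subseteq> A \<and> compact C}. emeasure \<nu> C) + ennreal e"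
        by (simp add: add_right_mono)
    qed
  qed
  show ?thesis using sets_\<nu> finite_\<nu> outer_reg inner_reg by (simp add: pos_measures_def)
qed

lemma integrable_\<nu>: "continuous_on K f \<Longrightarrow> integrable \<nu> (f :: 'a \<Rightarrow> real)"
  by (rule integrable_continuous[OF K \<nu>_regular])

lemma l_sum:
  assumes "\<And>i. continuous_on K (f i)" shows "l (\<lambda>x. \<Sum>i<n::nat. f i x) = (\<Sum>i<n. l (f i))"
  using assms by (induction n) (simp_all add: l_const add continuous_on_sum)

text \<open>Cut \<open>f\<close> into \<open>N\<close> horizontal slices of height \<open>1 / N\<close>.  The slice at height \<open>k / N\<close> is
  supported in \<open>{f > k / N}\<close> and equals \<open>1 / N\<close> on \<open>{f > (k + 1) / N}\<close>, so the value of \<open>l\<close> on it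
  is bounded by the integral of the slice below.\<close>

lemma l_le_integral:
  assumes f: "continuous_on K f" and b: "\<And>x. x \<in> K \<Longrightarrow> 0 \<le> f x \<and> f x \<le> 1"
  shows "l f \<le> (LINT x|\<nu>. f x)"
proof -
  interpret finite_measure \<nu> by (rule finite_\<nu>)
  have main: "real N * l f \<le> measure \<nu> K + real N * (LINT x|\<nu>. f x)" if N: "N > 0" for N :: nat
  proof -
    define h where "h = 1 / real N"
    have h: "h > 0" "real N * h = 1" using N by (simp_all add: h_def)
    define s where "s k x = min (max (f x - real k * h) 0) h" for k :: nat and x
    define V where "V k = {x \<in> K. real k * h < f x}" for k :: nat
    have cs: "continuous_on K (s k)" for k unfolding s_def by (intro continuous_intros f)
    have V: "op (V k)" for k unfolding V_def by (rule openin_superlevel[OF f])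
    have min_sum: "(\<Sum>k<n. min (max (t - real k * h) 0) h) = min t (real n * h)" if "0 \<le> t" for n :: nat and t
    proof (induction n)
      case 0 show ?case using that by simp
    next
      case (Suc n)
      show ?case unfolding sum.lessThan_Suc Suc using h(1) that by (auto simp: min_def max_def algebra_simps)
    qed
    have sum_s: "(\<Sum>k<N. s k x) = f x" if "x \<in> K" for x
      unfolding s_def using min_sum[of "f x" N] b[OF that] h by simp
    have up: "real N * l (s k) \<le> measure \<nu> (V k)" for k
    proof -
      have "(\<lambda>x. real N * s k x) \<in> adm (V k)"
      proof -
        have "real N * s k x \<le> real N * h" "0 \<le> real N * s k x" for x
          using h(1) by (auto simp: s_def intro!: mult_left_mono)
        thus ?thesis using cs[of k] h by (auto simp: adm_def V_def s_def intro!: continuous_intros)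
      qed
      from adm_le[OF this] show ?thesis by (simp add: scale[OF cs] measure_\<nu>_open[OF V])
    qed
    have low: "measure \<nu> (V (Suc k)) \<le> real N * (LINT x|\<nu>. s k x)" for k
    proof -
      have "measure \<nu> (V (Suc k)) = (LINT x|\<nu>. indicator (V (Suc k)) x)"
        using open_in_sets[OF sets_\<nu> V] sets.sets_into_space by (simp add: Int_absorb2)
      also have "\<dots> \<le> (LINT x|\<nu>. real N * s k x)"
      proof (rule integral_mono)
        show "integrable \<nu> (indicat_real (V (Suc k)))"
          using open_in_sets[OF sets_\<nu> V] by (simp add: emeasure_eq_measure)
        show "integrable \<nu> (\<lambda>x. real N * s k x)" by (intro integrable_mult_right integrable_\<nu> cs)
        fix x assume "x \<in> space \<nu>"
        show "indicat_real (V (Suc k)) x \<le> real N * s k x"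
        proof (cases "x \<in> V (Suc k)")
          case True
          hence "s k x = h" using h(1) by (simp add: V_def s_def algebra_simps)
          thus ?thesis using True h by simp
        next
          case False thus ?thesis using h by (simp add: s_def)
        qed
      qed
      finally show ?thesis by simp
    qed
    have "l f = l (\<lambda>x. \<Sum>k<N. s k x)"
      by (intro antisym mono continuous_intros f cs) (simp_all add: sum_s)
    also have "\<dots> = (\<Sum>k<N. l (s k))" by (rule l_sum[OF cs])
    finally have "real N * l f = (\<Sum>k<N. real N * l (s k))" by (simp add: sum_distrib_left)
    also have "\<dots> \<le> (\<Sum>k<N. measure \<nu> (V k))" by (intro sum_mono up)
    also have "\<dots> \<le> measure \<nu> (V 0) + (\<Sum>k<N. measure \<nu> (V (Suc k)))"
      using sum.lessThan_Suc_shift[of "\<lambda>k. measure \<nu> (V k)" N] measure_nonneg[of \<nu> "V N"]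
      by (simp only: sum.lessThan_Suc)
    also have "\<dots> \<le> measure \<nu> K + (\<Sum>k<N. real N * (LINT x|\<nu>. s k x))"
      by (intro add_mono sum_mono low) (use bounded_measure[of "V 0"] in \<open>simp add: space_\<nu>\<close>)
    also have "(\<Sum>k<N. real N * (LINT x|\<nu>. s k x)) = real N * (LINT x|\<nu>. (\<Sum>k<N. s k x))"
      by (simp add: integrable_\<nu>[OF cs] sum_distrib_left)
    also have "(LINT x|\<nu>. (\<Sum>k<N. s k x)) = (LINT x|\<nu>. f x)"
      by (rule Bochner_Integration.integral_cong) (simp_all add: sum_s space_\<nu>)
    finally show ?thesis .
  qed
  show ?thesis
  proof (rule ccontr)
    assume "\<not> l f \<le> (LINT x|\<nu>. f x)"
    then obtain N :: nat where N: "measure \<nu> K < real N * (l f - (LINT x|\<nu>. f x))"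
      using reals_Archimedean3[of "l f - (LINT x|\<nu>. f x)"] by auto
    hence "N > 0" using measure_nonneg[of \<nu> K] by (cases "N = 0") auto
    from main[OF this] N show False by (simp add: algebra_simps)
  qed
qed

text \<open>The inequality for \<open>f\<close> and for \<open>1 - f\<close> gives equality when \<open>0 \<le> f \<le> 1\<close>, since the functional
  and the integral agree at constants.  An affine change of the values reaches all other functions.\<close>

theorem l_eq_integral:
  assumes f: "continuous_on K f" shows "l f = (LINT x|\<nu>. f x)"
proof -
  interpret finite_measure \<nu> by (rule finite_\<nu>)
  have one: "l (\<lambda>_. c) = (LINT x|\<nu>. c)" for c
    using measure_\<nu>_open[of K] by (simp add: l_const space_\<nu> \<rho>_space)
  have unit: "l g = (LINT x|\<nu>. g x)" if g: "continuous_on K g" "\<And>x. x \<in> K \<Longrightarrow> 0 \<le> g x \<and> g x \<le> 1" for g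
  proof (rule antisym[OF l_le_integral[OF g]])
    have c: "continuous_on K (\<lambda>x. 1 - g x)" by (intro continuous_intros g)
    have "l (\<lambda>x. 1 - g x) \<le> (LINT x|\<nu>. 1 - g x)" by (rule l_le_integral[OF c]) (use g in auto)
    also have "\<dots> = (LINT x|\<nu>. 1) - (LINT x|\<nu>. g x)"
      by (intro Bochner_Integration.integral_diff integrable_\<nu> g continuous_intros)
    finally have "l (\<lambda>x. 1 - g x) \<le> (LINT x|\<nu>. 1) - (LINT x|\<nu>. g x)" .
    moreover have "l (\<lambda>x. (1 - g x) + g x) = l (\<lambda>x. 1 - g x) + l g" by (rule add[OF c g(1)])
    ultimately show "(LINT x|\<nu>. g x) \<le> l g" using one[of 1] by simp
  qed
  obtain B where B: "0 < B" "\<And>x. x \<in> K \<Longrightarrow> norm (f x) \<le> B" by (rule bounded_on_compact[OF K f]) blast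
  define g where "g x = (f x + B) / (2 * B)" for x
  have g: "continuous_on K g" unfolding g_def using B(1) by (intro continuous_intros f) auto
  have "l g = (LINT x|\<nu>. g x)"
  proof (rule unit[OF g])
    fix x assume "x \<in> K"
    thus "0 \<le> g x \<and> g x \<le> 1" using B(1) B(2)[of x] by (auto simp: g_def field_simps abs_le_iff)
  qed
  moreover have fg: "f = (\<lambda>x. (2 * B) * g x + (- B))" using B(1) by (auto simp: g_def field_simps)
  hence "l f = 2 * B * l g + l (\<lambda>_. - B)"
    using g add[of "\<lambda>x. (2 * B) * g x" "\<lambda>_. - B"] scale[OF g, of "2 * B"]
    by (simp add: continuous_intros)
  moreover have "(LINT x|\<nu>. f x) = 2 * B * (LINT x|\<nu>. g x) + (LINT x|\<nu>. - B)"
    using integrable_\<nu>[OF g] by (subst fg) simp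
  ultimately show ?thesis using one by simp
qed

end

text \<open>A Urysohn function between a compact set and an open neighbourhood bounds the first measure
  of the compact set by the second measure of the neighbourhood.  Regularity passes from there to
  compact sets and then to all Borel sets; the roles of the measures are symmetric.\<close>

lemma pos_measure_eqI:
  fixes K :: "'a::t2_space set"
  assumes K: "compact K" and \<mu>: "\<mu> \<in> pos_measures K" and \<nu>: "\<nu> \<in> pos_measures K"
    and eq: "\<And>f::'a \<Rightarrow> real. continuous_on K f \<Longrightarrow> (LINT x|\<mu>. f x) = (LINT x|\<nu>. f x)"
  shows "\<mu> = \<nu>"
proof -
  have compact_le: "emeasure \<mu> C \<le> emeasure \<nu> C"
    if \<mu>: "\<mu> \<in> pos_measures K" and \<nu>: "\<nu> \<in> pos_measures K" and C: "compact C" "C \<subseteq> K"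
      and eq: "\<And>f::'a \<Rightarrow> real. continuous_on K f \<Longrightarrow> (LINT x|\<mu>. f x) = (LINT x|\<nu>. f x)" for \<mu> \<nu> C
  proof -
    interpret m: finite_measure \<mu> by (rule pos_measuresD(2)[OF \<mu>])
    interpret n: finite_measure \<nu> by (rule pos_measuresD(2)[OF \<nu>])
    note Cm = compact_in_sets[OF pos_measuresD(1)[OF \<mu>] C]
    note Cn = compact_in_sets[OF pos_measuresD(1)[OF \<nu>] C]
    show ?thesis
      unfolding pos_measuresD(5)[OF \<nu> Cn]
    proof (rule INF_greatest)
      fix U assume U: "U \<in> {U. C \<subseteq> U \<and> open U}"
      have o: "openin (top_of_set K) (U \<inter> K)" using U by (auto simp: openin_open)
      note Un = open_in_sets[OF pos_measuresD(1)[OF \<nu>] o]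
      have D: "closedin (top_of_set K) (K - U)"
        using closedin_diff[OF closedin_topspace o] by (simp add: Diff_Int)
      have C': "closedin (top_of_set K) C" using C closedin_compact_iff[OF K] by blast
      have "C \<inter> (K - U) = {}" using U by auto
      from Urysohn_compact[OF K C' D this]
      obtain f :: "'a \<Rightarrow> real" where f: "continuous_on K f" "\<And>x. x \<in> K \<Longrightarrow> 0 \<le> f x \<and> f x \<le> 1"
        "\<And>x. x \<in> C \<Longrightarrow> f x = 1" "\<And>x. x \<in> K - U \<Longrightarrow> f x = 0" by blast
      have iC: "integrable \<mu> (indicat_real C)" using Cm by (simp add: m.emeasure_eq_measure)
      have iU: "integrable \<nu> (indicat_real (U \<inter> K))" using Un by (simp add: n.emeasure_eq_measure)
      have "measure \<mu> C = (LINT x|\<mu>. indicator C x)"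
        using sets.sets_into_space[OF Cm] by (simp add: Int_absorb2)
      also have "\<dots> \<le> (LINT x|\<mu>. f x)"
        using iC f by (intro integral_mono integrable_continuous[OF K \<mu>, of f])
          (auto simp: pos_measuresD(3)[OF \<mu>] split: split_indicator)
      also have "\<dots> = (LINT x|\<nu>. f x)" by (rule eq[OF f(1)])
      also have "\<dots> \<le> (LINT x|\<nu>. indicator (U \<inter> K) x)"
        using iU f by (intro integral_mono integrable_continuous[OF K \<nu>, of f])
          (auto simp: pos_measuresD(3)[OF \<nu>] split: split_indicator)
      also have "\<dots> = measure \<nu> (U \<inter> K)"
        using sets.sets_into_space[OF Un] by (simp add: Int_absorb2)
      finally show "emeasure \<mu> C \<le> emeasure \<nu> (U \<inter> K)"
        by (simp add: m.emeasure_eq_measure n.emeasure_eq_measure)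
    qed
  qed
  have s: "sets \<mu> = sets \<nu>" using pos_measuresD(1)[OF \<mu>] pos_measuresD(1)[OF \<nu>] by simp
  show ?thesis
  proof (rule measure_eqI[OF s])
    fix A assume A: "A \<in> sets \<mu>"
    have AK: "A \<subseteq> K" using sets.sets_into_space[OF A] pos_measuresD(3)[OF \<mu>] by simp
    have e: "emeasure \<mu> C = emeasure \<nu> C" if "compact C" "C \<subseteq> A" for C
      using compact_le[OF \<mu> \<nu> that(1) _ eq] compact_le[OF \<nu> \<mu> that(1) _ eq[symmetric]] that(2) AK
      by (intro antisym) auto
    have A': "A \<in> sets \<nu>" using A s by simp
    show "emeasure \<mu> A = emeasure \<nu> A"
      unfolding pos_measuresD(4)[OF \<mu> A] pos_measuresD(4)[OF \<nu> A']
      by (rule SUP_cong) (auto simp: e)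
  qed
qed


section \<open>The Hilbert space of square-integrable functions\<close>

lemma cmod_add_sq_le: "(cmod (a + b))\<^sup>2 \<le> 2 * (cmod a)\<^sup>2 + 2 * (cmod b)\<^sup>2"
proof -
  have "(cmod (a + b))\<^sup>2 \<le> (cmod a + cmod b)\<^sup>2" by (intro power_mono norm_triangle_ineq) auto
  also have "\<dots> \<le> 2 * (cmod a)\<^sup>2 + 2 * (cmod b)\<^sup>2"
    using zero_le_power2[of "cmod a - cmod b"] by (simp add: power2_sum power2_diff)
  finally show ?thesis .
qed

lemma sq_integrableD [simp]:
  assumes "f \<in> sq_integrable \<mu>"
  shows "f \<in> borel_measurable \<mu>" "integrable \<mu> (\<lambda>x. (cmod (f x))\<^sup>2)"
  using assms by (auto simp: sq_integrable_def)

lemma sq_integrableI: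
  "f \<in> borel_measurable \<mu> \<Longrightarrow> integrable \<mu> (\<lambda>x. (cmod (f x))\<^sup>2) \<Longrightarrow> f \<in> sq_integrable \<mu>"
  unfolding sq_integrable_def by blast

lemma sq_integrable_bounded_by:
  assumes "f \<in> borel_measurable \<mu>" "integrable \<mu> g" "\<And>x. x \<in> space \<mu> \<Longrightarrow> (cmod (f x))\<^sup>2 \<le> g x"
  shows "f \<in> sq_integrable \<mu>"
proof -
  have "integrable \<mu> (\<lambda>x. (cmod (f x))\<^sup>2)"
    by (rule Bochner_Integration.integrable_bound[OF assms(2)])
      (use assms in \<open>auto intro!: AE_I2 order_trans[OF _ abs_ge_self]\<close>)
  thus ?thesis by (rule sq_integrableI[OF assms(1)])
qed

lemma cnj_measurable [measurable (raw)]: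
  "f \<in> borel_measurable \<mu> \<Longrightarrow> (\<lambda>x. cnj (f x)) \<in> borel_measurable \<mu>"
  by (rule measurable_compose[OF _ borel_measurable_continuous_onI[OF continuous_on_cnj[OF continuous_on_id]]])

lemma sq_integrable_add [simp]:
  assumes "f \<in> sq_integrable \<mu>" "g \<in> sq_integrable \<mu>" shows "(\<lambda>x. f x + g x) \<in> sq_integrable \<mu>"
proof (rule sq_integrable_bounded_by)
  show "(\<lambda>x. f x + g x) \<in> borel_measurable \<mu>" using assms by (intro borel_measurable_add) simp_all
  show "integrable \<mu> (\<lambda>x. 2 * (cmod (f x))\<^sup>2 + 2 * (cmod (g x))\<^sup>2)" using assms by simp
qed (rule cmod_add_sq_le)

lemma sq_integrable_scale [simp]:
  assumes "f \<in> sq_integrable \<mu>" shows "(\<lambda>x. c * f x) \<in> sq_integrable \<mu>"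
proof (rule sq_integrable_bounded_by)
  show "(\<lambda>x. c * f x) \<in> borel_measurable \<mu>"
    by (rule borel_measurable_times[OF borel_measurable_const sq_integrableD(1)[OF assms]])
  show "integrable \<mu> (\<lambda>x. (cmod c)\<^sup>2 * (cmod (f x))\<^sup>2)"
    by (rule integrable_mult_right[OF sq_integrableD(2)[OF assms]])
qed (simp add: norm_mult power_mult_distrib)

lemma sq_integrable_diff [simp]:
  assumes "f \<in> sq_integrable \<mu>" "g \<in> sq_integrable \<mu>" shows "(\<lambda>x. f x - g x) \<in> sq_integrable \<mu>"
proof -
  have "(\<lambda>x. f x + (-1) * g x) \<in> sq_integrable \<mu>"
    by (intro sq_integrable_add sq_integrable_scale assms)
  thus ?thesis by (simp only: mult_minus1 add_uminus_conv_diff)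
qed

lemma sq_integrable_bounded_mult:
  assumes f: "f \<in> sq_integrable \<mu>" and g: "g \<in> borel_measurable \<mu>" "\<And>x. x \<in> space \<mu> \<Longrightarrow> cmod (g x) \<le> B"
  shows "(\<lambda>x. g x * f x) \<in> sq_integrable \<mu>"
proof (rule sq_integrable_bounded_by[where g = "\<lambda>x. B\<^sup>2 * (cmod (f x))\<^sup>2"])
  fix x assume "x \<in> space \<mu>"
  hence "(cmod (g x))\<^sup>2 \<le> B\<^sup>2" using g(2) by (intro power_mono) auto
  thus "(cmod (g x * f x))\<^sup>2 \<le> B\<^sup>2 * (cmod (f x))\<^sup>2"
    by (simp add: norm_mult power_mult_distrib mult_right_mono)
next
  show "(\<lambda>x. g x * f x) \<in> borel_measurable \<mu>" using f by (intro borel_measurable_times g(1)) simp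
  show "integrable \<mu> (\<lambda>x. B\<^sup>2 * (cmod (f x))\<^sup>2)" using f by simp
qed

lemma sq_integrable_mult_cnj [simp]:
  assumes "f \<in> sq_integrable \<mu>" "g \<in> sq_integrable \<mu>" shows "integrable \<mu> (\<lambda>x. f x * cnj (g x))"
proof (rule Bochner_Integration.integrable_bound[where f = "\<lambda>x. (cmod (f x))\<^sup>2 + (cmod (g x))\<^sup>2"])
  have "cmod a * cmod b \<le> (cmod a)\<^sup>2 + (cmod b)\<^sup>2" for a b
  proof -
    have "2 * (cmod a * cmod b) \<le> (cmod a)\<^sup>2 + (cmod b)\<^sup>2"
      using zero_le_power2[of "cmod a - cmod b"] by (simp add: power2_diff)
    moreover have "0 \<le> cmod a * cmod b" by simp
    ultimately show ?thesis by linarith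
  qed
  thus "AE x in \<mu>. norm (f x * cnj (g x)) \<le> norm ((cmod (f x))\<^sup>2 + (cmod (g x))\<^sup>2)"
    by (simp add: norm_mult)
  show "(\<lambda>x. f x * cnj (g x)) \<in> borel_measurable \<mu>"
    using assms by (intro borel_measurable_times cnj_measurable) auto
qed (use assms in auto)

lemma L2_class_self: "f \<in> sq_integrable \<mu> \<Longrightarrow> f \<in> L2_class \<mu> f"
  by (simp add: L2_class_def)

lemma L2_class_cong: "(AE x in \<mu>. f x = g x) \<Longrightarrow> L2_class \<mu> f = L2_class \<mu> g"
  unfolding L2_class_def by (rule Collect_cong) (auto elim: AE_mp)

lemma L2_class_cong_space: "(\<And>x. x \<in> space \<mu> \<Longrightarrow> f x = g x) \<Longrightarrow> L2_class \<mu> f = L2_class \<mu> g"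
  by (rule L2_class_cong) auto

lemma L2_repr_class:
  assumes "f \<in> sq_integrable \<mu>"
  shows "L2_repr (L2_class \<mu> f) \<in> sq_integrable \<mu>" "AE x in \<mu>. L2_repr (L2_class \<mu> f) x = f x"
  using someI[of "\<lambda>g. g \<in> L2_class \<mu> f", OF L2_class_self[OF assms]]
  by (auto simp: L2_repr_def L2_class_def)

lemma L2_carrierE:
  assumes "X \<in> carrier (L2 \<mu>)" obtains f where "f \<in> sq_integrable \<mu>" "X = L2_class \<mu> f"
  using assms by (auto simp: L2_def)

lemma L2_class_carrier [simp]: "f \<in> sq_integrable \<mu> \<Longrightarrow> L2_class \<mu> f \<in> carrier (L2 \<mu>)"
  by (simp add: L2_def)

lemma L2_add_class [simp]:
  assumes "f \<in> sq_integrable \<mu>" "g \<in> sq_integrable \<mu>"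
  shows "L2_class \<mu> f \<oplus>\<^bsub>L2 \<mu>\<^esub> L2_class \<mu> g = L2_class \<mu> (\<lambda>x. f x + g x)"
proof -
  have "AE x in \<mu>. L2_repr (L2_class \<mu> f) x + L2_repr (L2_class \<mu> g) x = f x + g x"
    using L2_repr_class(2)[OF assms(1)] L2_repr_class(2)[OF assms(2)] by eventually_elim simp
  thus ?thesis by (simp add: L2_def L2_class_cong)
qed

lemma L2_smult_class [simp]:
  assumes "f \<in> sq_integrable \<mu>" shows "c \<odot>\<^bsub>L2 \<mu>\<^esub> L2_class \<mu> f = L2_class \<mu> (\<lambda>x. c * f x)"
proof -
  have "AE x in \<mu>. c * L2_repr (L2_class \<mu> f) x = c * f x"
    using L2_repr_class(2)[OF assms] by eventually_elim simp
  thus ?thesis by (simp add: L2_def L2_class_cong)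
qed

lemma L2_cinner_class [simp]:
  assumes "f \<in> sq_integrable \<mu>" "g \<in> sq_integrable \<mu>"
  shows "cinner (L2 \<mu>) (L2_class \<mu> f) (L2_class \<mu> g) = (LINT x|\<mu>. f x * cnj (g x))"
proof -
  note [measurable] = sq_integrableD(1)[OF assms(1)] sq_integrableD(1)[OF assms(2)]
    sq_integrableD(1)[OF L2_repr_class(1)[OF assms(1)]] sq_integrableD(1)[OF L2_repr_class(1)[OF assms(2)]]
  have "AE x in \<mu>. L2_repr (L2_class \<mu> f) x * cnj (L2_repr (L2_class \<mu> g) x) = f x * cnj (g x)"
    using L2_repr_class(2)[OF assms(1)] L2_repr_class(2)[OF assms(2)] by eventually_elim simp
  hence "(LINT x|\<mu>. L2_repr (L2_class \<mu> f) x * cnj (L2_repr (L2_class \<mu> g) x)) = (LINT x|\<mu>. f x * cnj (g x))"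
    by (intro integral_cong_AE) (auto intro!: borel_measurable_times cnj_measurable)
  thus ?thesis by (simp add: L2_def)
qed

lemma L2_cinner_self:
  assumes "f \<in> sq_integrable \<mu>"
  shows "cinner (L2 \<mu>) (L2_class \<mu> f) (L2_class \<mu> f) = complex_of_real (LINT x|\<mu>. (cmod (f x))\<^sup>2)"
proof -
  have "f x * cnj (f x) = complex_of_real ((cmod (f x))\<^sup>2)" for x
    using complex_norm_square[of "f x"] by (simp only: of_real_power)
  thus ?thesis using assms by (simp only: L2_cinner_class integral_complex_of_real)
qed

interpretation L2: semi_inner "carrier (L2 \<mu>)" "add (L2 \<mu>)" "smult (L2 \<mu>)" "cinner (L2 \<mu>)"
proof
  fix X Y Z and c :: complex
  assume X: "X \<in> carrier (L2 \<mu>)"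
  then obtain f where f: "f \<in> sq_integrable \<mu>" "X = L2_class \<mu> f" by (rule L2_carrierE)
  show "c \<odot>\<^bsub>L2 \<mu>\<^esub> X \<in> carrier (L2 \<mu>)" using f by simp
  show "0 \<le> Re (cinner (L2 \<mu>) X X)" unfolding f(2) L2_cinner_self[OF f(1)] by simp
  assume Y: "Y \<in> carrier (L2 \<mu>)"
  then obtain g where g: "g \<in> sq_integrable \<mu>" "Y = L2_class \<mu> g" by (rule L2_carrierE)
  show "X \<oplus>\<^bsub>L2 \<mu>\<^esub> Y \<in> carrier (L2 \<mu>)" using f g by simp
  show "cinner (L2 \<mu>) (c \<odot>\<^bsub>L2 \<mu>\<^esub> X) Y = c * cinner (L2 \<mu>) X Y"
    using f g by (simp add: mult.assoc)
  have "cnj (LINT x|\<mu>. f x * cnj (g x)) = (LINT x|\<mu>. cnj (f x * cnj (g x)))"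
    by (rule Bochner_Integration.integral_cnj[symmetric])
  thus "cinner (L2 \<mu>) Y X = cnj (cinner (L2 \<mu>) X Y)" using f g by (simp add: mult.commute)
  assume Z: "Z \<in> carrier (L2 \<mu>)"
  then obtain h where h: "h \<in> sq_integrable \<mu>" "Z = L2_class \<mu> h" by (rule L2_carrierE)
  show "cinner (L2 \<mu>) (X \<oplus>\<^bsub>L2 \<mu>\<^esub> Y) Z = cinner (L2 \<mu>) X Z + cinner (L2 \<mu>) Y Z"
    using f g h by (simp add: distrib_right)
qed

lemma L2_sub_class:
  "f \<in> sq_integrable \<mu> \<Longrightarrow> g \<in> sq_integrable \<mu> \<Longrightarrow>
    L2.sub \<mu> (L2_class \<mu> f) (L2_class \<mu> g) = L2_class \<mu> (\<lambda>x. f x - g x)"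
  using L2_add_class[of f \<mu> "\<lambda>x. (-1) * g x"] L2_smult_class[of g \<mu> "-1"] sq_integrable_scale[of g \<mu> "-1"]
  by (simp add: L2.sub_def)

lemma L2_nm_class:
  "f \<in> sq_integrable \<mu> \<Longrightarrow> L2.nm \<mu> (L2_class \<mu> f) = sqrt (LINT x|\<mu>. (cmod (f x))\<^sup>2)"
  by (simp add: L2.nm_def L2_cinner_self del: L2_cinner_class)

text \<open>The Riesz--Fischer theorem.  Finiteness of the measure allows one to pass from small
  \<open>L\<^sup>2\<close>-distances to small \<open>L\<^sup>1\<close>-distances by \<open>2 * \<bar>u\<bar> \<le> t * \<bar>u\<bar>\<^sup>2 + 1 / t\<close>, so that a rapidly
  convergent subsequence converges almost everywhere; Fatou's lemma identifies the limit.\<close>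

lemma L2_complete:
  assumes "finite_measure \<mu>" and s: "L2.cauchy \<mu> s"
  shows "\<exists>X\<in>carrier (L2 \<mu>). (\<lambda>n. L2.nm \<mu> (L2.sub \<mu> (s n) X)) \<longlonglongrightarrow> 0"
proof -
  interpret finite_measure \<mu> by fact
  have "\<exists>f. f \<in> sq_integrable \<mu> \<and> s n = L2_class \<mu> f" for n
    using L2_carrierE[OF L2.cauchy_closed[OF s, of n]] by blast
  then obtain f where f: "\<And>n. f n \<in> sq_integrable \<mu>" "\<And>n. s n = L2_class \<mu> (f n)" by metis
  note [measurable] = sq_integrableD(1)[OF f(1)]
  define D where "D m n = (LINT x|\<mu>. (cmod (f m x - f n x))\<^sup>2)" for m n
  have nmD: "L2.nm \<mu> (L2.sub \<mu> (s m) (s n)) = sqrt (D m n)" for m n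
    using f by (simp add: L2_sub_class L2_nm_class D_def)
  have C: "\<exists>N. \<forall>m\<ge>N. \<forall>n\<ge>N. D m n < e" if "0 < e" for e
  proof -
    obtain N where "\<forall>m\<ge>N. \<forall>n\<ge>N. L2.nm \<mu> (L2.sub \<mu> (s m) (s n)) < sqrt e"
      using s \<open>0 < e\<close> unfolding L2.cauchy_def by (metis real_sqrt_gt_0_iff)
    thus ?thesis by (auto simp: nmD)
  qed
  have "\<exists>r. \<forall>k. r k < r (Suc k) \<and> (\<forall>m\<ge>r k. \<forall>n\<ge>r k. D m n < (1/4)^k)"
  proof -
    have "\<exists>N'>N. \<forall>m\<ge>N'. \<forall>n\<ge>N'. D m n < (1/4)^k" for k N
    proof -
      obtain M where "\<forall>m\<ge>M. \<forall>n\<ge>M. D m n < (1/4)^k" using C[of "(1/4)^k"] by auto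
      thus ?thesis by (intro exI[of _ "max M (Suc N)"]) auto
    qed
    then obtain step where step: "\<And>N k. step N k > N"
      "\<And>N k. \<forall>m\<ge>step N k. \<forall>n\<ge>step N k. D m n < (1/4)^k" by metis
    define r where "r = rec_nat (step 0 0) (\<lambda>k N. step N (Suc k))"
    have "r 0 = step 0 0" "\<And>k. r (Suc k) = step (r k) (Suc k)" by (simp_all add: r_def)
    moreover have "\<forall>m\<ge>r k. \<forall>n\<ge>r k. D m n < (1/4)^k" for k
      using calculation step(2) by (cases k) metis+
    ultimately show ?thesis using step(1) by metis
  qed
  then obtain r where r: "\<And>k. r k < r (Suc k)" "\<And>k m n. r k \<le> m \<Longrightarrow> r k \<le> n \<Longrightarrow> D m n < (1/4)^k"
    by metis
  have mono: "strict_mono r" using r(1) by (simp add: strict_mono_Suc_iff)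
  define u where "u k x = f (r (Suc k)) x - f (r k) x" for k x
  have [measurable]: "u k \<in> borel_measurable \<mu>" for k unfolding u_def by measurable
  define c where "c = (1 + measure \<mu> (space \<mu>)) / 2"
  have c: "0 \<le> c" by (simp add: c_def)
  have u1: "(\<integral>\<^sup>+x. ennreal (cmod (u k x)) \<partial>\<mu>) \<le> ennreal (c * (1/2)^k)" for k
  proof -
    have Iu: "integrable \<mu> (\<lambda>x. (cmod (u k x))\<^sup>2)" unfolding u_def using f by simp
    have "cmod (u k x) \<le> (2^k * (cmod (u k x))\<^sup>2 + (1/2)^k) / 2" for x
    proof -
      have "0 \<le> 2^k * (cmod (u k x) - (1/2)^k)\<^sup>2" by simp
      also have "\<dots> = 2^k * (cmod (u k x))\<^sup>2 - 2 * (2^k * (1/2)^k) * cmod (u k x) + (2^k * (1/2)^k) * (1/2)^k"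
        by (simp add: power2_diff algebra_simps power2_eq_square)
      also have "(2::real)^k * (1/2)^k = 1" by (simp flip: power_mult_distrib)
      finally show ?thesis by simp
    qed
    hence "(\<integral>\<^sup>+x. ennreal (cmod (u k x)) \<partial>\<mu>)
        \<le> (\<integral>\<^sup>+x. ennreal ((2^k * (cmod (u k x))\<^sup>2 + (1/2)^k) / 2) \<partial>\<mu>)"
      by (intro nn_integral_mono ennreal_leI)
    also have "\<dots> = ennreal (LINT x|\<mu>. (2^k * (cmod (u k x))\<^sup>2 + (1/2)^k) / 2)"
      using Iu by (intro nn_integral_eq_integral) auto
    also have "(LINT x|\<mu>. (2^k * (cmod (u k x))\<^sup>2 + (1/2)^k) / 2)
        = (2^k * D (r (Suc k)) (r k) + (1/2)^k * measure \<mu> (space \<mu>)) / 2"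
      using Iu by (simp add: D_def u_def mult.commute)
    also have "\<dots> \<le> (2^k * (1/4)^k + (1/2)^k * measure \<mu> (space \<mu>)) / 2"
      using r(2)[of k "r (Suc k)" "r k"] r(1)[of k]
      by (intro divide_right_mono add_right_mono mult_left_mono) auto
    also have "(2::real)^k * (1/4)^k = (1/2)^k" by (simp flip: power_mult_distrib)
    also have "((1/2)^k + (1/2)^k * measure \<mu> (space \<mu>)) / 2 = c * (1/2)^k"
      by (simp add: c_def field_simps)
    finally show ?thesis by (simp add: ennreal_leI)
  qed
  have "AE x in \<mu>. summable (\<lambda>k. cmod (u k x))"
  proof -
    have "(\<integral>\<^sup>+x. (\<Sum>k. ennreal (cmod (u k x))) \<partial>\<mu>) = (\<Sum>k. \<integral>\<^sup>+x. ennreal (cmod (u k x)) \<partial>\<mu>)"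
      by (rule nn_integral_suminf) measurable
    also have "\<dots> \<le> (\<Sum>k. ennreal (c * (1/2)^k))" by (intro suminf_le u1) auto
    also have "\<dots> = ennreal (c * 2)"
      using c sums_mult[OF geometric_sums[of "1/2::real"], of c]
      by (intro suminf_ennreal_eq) auto
    finally have "(\<integral>\<^sup>+x. (\<Sum>k. ennreal (cmod (u k x))) \<partial>\<mu>) < \<infinity>"
      by (simp add: le_less_trans)
    hence "AE x in \<mu>. (\<Sum>k. ennreal (cmod (u k x))) \<noteq> \<infinity>"
      by (intro nn_integral_noteq_infinite) auto
    thus ?thesis by eventually_elim (auto intro: summable_suminf_not_top)
  qed
  hence conv: "AE x in \<mu>. convergent (\<lambda>k. f (r k) x)"
  proof eventually_elim
    case (elim x)
    have "convergent (\<lambda>n. \<Sum>k<n. u k x)"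
      using summable_norm_cancel[OF elim] by (simp add: summable_iff_convergent)
    moreover have "(\<Sum>k<n. u k x) = f (r n) x - f (r 0) x" for n
      unfolding u_def by (rule sum_lessThan_telescope)
    ultimately have "convergent (\<lambda>n. f (r n) x - f (r 0) x)" by simp
    thus ?case using convergent_diff_const_right_iff[of "\<lambda>n. f (r n) x" "f (r 0) x"] by blast
  qed
  define h where "h x = lim (\<lambda>k. f (r k) x)" for x
  have [measurable]: "h \<in> borel_measurable \<mu>" unfolding h_def by measurable
  have h: "AE x in \<mu>. (\<lambda>k. f (r k) x) \<longlonglongrightarrow> h x"
    using conv by eventually_elim (simp add: h_def convergent_LIMSEQ_iff)
  have fatou: "(\<integral>\<^sup>+x. ennreal ((cmod (f n x - h x))\<^sup>2) \<partial>\<mu>) \<le> ennreal ((1/4)^k)" if n: "r k \<le> n" for n k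
  proof -
    have "(\<integral>\<^sup>+x. ennreal ((cmod (f n x - h x))\<^sup>2) \<partial>\<mu>)
        = (\<integral>\<^sup>+x. liminf (\<lambda>j. ennreal ((cmod (f n x - f (r j) x))\<^sup>2)) \<partial>\<mu>)"
    proof (rule nn_integral_cong_AE)
      show "AE x in \<mu>. ennreal ((cmod (f n x - h x))\<^sup>2) = liminf (\<lambda>j. ennreal ((cmod (f n x - f (r j) x))\<^sup>2))"
        using h
      proof eventually_elim
        case (elim x)
        have "(\<lambda>j. ennreal ((cmod (f n x - f (r j) x))\<^sup>2)) \<longlonglongrightarrow> ennreal ((cmod (f n x - h x))\<^sup>2)"
          by (intro tendsto_intros elim)
        thus ?case by (intro lim_imp_Liminf[symmetric]) simp_all
      qed
    qed
    also have "\<dots> \<le> liminf (\<lambda>j. \<integral>\<^sup>+x. ennreal ((cmod (f n x - f (r j) x))\<^sup>2) \<partial>\<mu>)"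
      by (rule nn_integral_liminf) measurable
    also have "\<dots> = liminf (\<lambda>j. ennreal (D n (r j)))"
      unfolding D_def using f by (subst nn_integral_eq_integral) auto
    also have "\<dots> \<le> ennreal ((1/4)^k)"
    proof (rule Liminf_le)
      show "\<forall>\<^sub>F j in sequentially. ennreal (D n (r j)) \<le> ennreal ((1/4)^k)"
        using eventually_ge_at_top[of k]
      proof eventually_elim
        case (elim j)
        have "r k \<le> r j" using elim mono by (simp add: strict_mono_less_eq)
        thus ?case using r(2)[OF n, of "r j"] by (intro ennreal_leI) simp
      qed
    qed simp
    finally show ?thesis .
  qed
  have fh: "(\<lambda>x. f n x - h x) \<in> sq_integrable \<mu>" if n: "r k \<le> n" for n k
  proof -
    have "integrable \<mu> (\<lambda>x. (cmod (f n x - h x))\<^sup>2)"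
      using fatou[OF n] by (intro integrableI_nonneg) (auto simp: le_less_trans)
    thus ?thesis by (intro sq_integrableI) simp_all
  qed
  have hsq: "h \<in> sq_integrable \<mu>"
    using sq_integrable_diff[OF f(1)[of "r 0"] fh[OF order_refl[of "r 0"]]] by simp
  have le: "L2.nm \<mu> (L2.sub \<mu> (s n) (L2_class \<mu> h)) \<le> (1/2)^k" if n: "r k \<le> n" for n k
  proof -
    have "ennreal (LINT x|\<mu>. (cmod (f n x - h x))\<^sup>2) \<le> ennreal ((1/4)^k)"
      using fatou[OF n] sq_integrableD(2)[OF fh[OF n]] by (subst (asm) nn_integral_eq_integral) auto
    hence "(LINT x|\<mu>. (cmod (f n x - h x))\<^sup>2) \<le> (1/4)^k" by simp
    also have "(1/4::real)^k = ((1/2)^k)\<^sup>2" by (simp add: power2_eq_square flip: power_mult_distrib)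
    finally have "sqrt (LINT x|\<mu>. (cmod (f n x - h x))\<^sup>2) \<le> (1/2)^k"
      by (simp add: real_le_lsqrt real_sqrt_le_iff)
    thus ?thesis using f hsq by (simp add: L2_sub_class L2_nm_class)
  qed
  have "(\<lambda>n. L2.nm \<mu> (L2.sub \<mu> (s n) (L2_class \<mu> h))) \<longlonglongrightarrow> 0"
  proof (rule LIMSEQ_I)
    fix e :: real assume "0 < e"
    then obtain k where k: "(1/2::real)^k < e" using real_arch_pow_inv[of e "1/2"] by auto
    have "0 \<le> L2.nm \<mu> (L2.sub \<mu> (s n) (L2_class \<mu> h))" for n using f hsq by simp
    hence "norm (L2.nm \<mu> (L2.sub \<mu> (s n) (L2_class \<mu> h)) - 0) < e" if "n \<ge> r k" for n
      using le[OF that] k by simp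
    thus "\<exists>N. \<forall>n\<ge>N. norm (L2.nm \<mu> (L2.sub \<mu> (s n) (L2_class \<mu> h)) - 0) < e" by blast
  qed
  thus ?thesis using hsq by (intro bexI[of _ "L2_class \<mu> h"]) auto
qed

theorem L2_hilbert:
  assumes "finite_measure \<mu>" shows "complex_hilbert_space (L2 \<mu>)"
proof (rule complex_hilbert_space_if_semi_inner)
  have z: "(\<lambda>_. 0) \<in> sq_integrable \<mu>" by (intro sq_integrableI) simp_all
  have zero: "\<zero>\<^bsub>L2 \<mu>\<^esub> = L2_class \<mu> (\<lambda>_. 0)" by (simp add: L2_def)
  show "\<zero>\<^bsub>L2 \<mu>\<^esub> \<in> carrier (L2 \<mu>)" "cinner (L2 \<mu>) \<zero>\<^bsub>L2 \<mu>\<^esub> \<zero>\<^bsub>L2 \<mu>\<^esub> = 0" using z by (simp_all add: zero)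
  fix X Y assume "X \<in> carrier (L2 \<mu>)" "Y \<in> carrier (L2 \<mu>)" and n: "L2.nm \<mu> (L2.sub \<mu> X Y) = 0"
  then obtain f g where f: "f \<in> sq_integrable \<mu>" "X = L2_class \<mu> f" and g: "g \<in> sq_integrable \<mu>" "Y = L2_class \<mu> g"
    by (meson L2_carrierE)
  have "(LINT x|\<mu>. (cmod (f x - g x))\<^sup>2) = 0" using n f g by (simp add: L2_sub_class L2_nm_class)
  hence "AE x in \<mu>. (cmod (f x - g x))\<^sup>2 = 0"
    using f g by (subst (asm) integral_nonneg_eq_0_iff_AE) auto
  hence "AE x in \<mu>. f x = g x" by eventually_elim simp
  thus "X = Y" using f g L2_class_cong by blast
qed (use L2.semi_inner_axioms L2_complete[OF assms] in blast)+

subsection \<open>Continuous functions are dense\<close>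

lemma cont_funD: "f \<in> cont_fun K \<Longrightarrow> continuous_on K f"
  by (simp add: cont_fun_def)

lemma cont_fun_restrict: "continuous_on K f \<Longrightarrow> (\<lambda>x\<in>K. f x) \<in> cont_fun K"
  by (simp add: cont_fun_def cong: continuous_on_cong)

lemma cont_fun_eqI: "f \<in> cont_fun K \<Longrightarrow> g \<in> cont_fun K \<Longrightarrow> (\<And>x. x \<in> K \<Longrightarrow> f x = g x) \<Longrightarrow> f = g"
  unfolding cont_fun_def by (auto intro: extensionalityI)

locale regular_measure =
  fixes K :: "'a::t2_space set" and \<mu> :: "'a measure"
  assumes K: "compact K" and \<mu>: "\<mu> \<in> pos_measures K"
begin

lemma space_\<mu>: "space \<mu> = K" by (rule pos_measuresD(3)[OF \<mu>])

sublocale finite_measure \<mu> by (rule pos_measuresD(2)[OF \<mu>])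

sublocale L2: complex_hilbert_space "L2 \<mu>" by (rule L2_hilbert) unfold_locales

lemma continuous_sq_integrable: 
  assumes f: "continuous_on K f" shows "f \<in> sq_integrable \<mu>"
proof (rule sq_integrableI)
  show "f \<in> borel_measurable \<mu>" by (rule borel_measurable_continuous[OF \<mu> f])
  show "integrable \<mu> (\<lambda>x. (cmod (f x))\<^sup>2)" by (intro integrable_continuous[OF K \<mu>] continuous_intros f)
qed

lemma cont_fun_sq_integrable [simp]: "f \<in> cont_fun K \<Longrightarrow> f \<in> sq_integrable \<mu>"
  by (intro continuous_sq_integrable cont_funD)

text \<open>Being approximable by continuous functions in the \<open>L\<^sup>2\<close>-norm is a closed linear condition.
  Regularity and Urysohn functions provide it for indicators of Borel sets, linearity for simple
  functions, and dominated convergence for all square-integrable functions.\<close>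

definition approx :: "('a \<Rightarrow> complex) \<Rightarrow> bool" where
  "approx f \<longleftrightarrow> f \<in> sq_integrable \<mu> \<and>
     (\<forall>e>0. \<exists>g. continuous_on K g \<and> (LINT x|\<mu>. (cmod (f x - g x))\<^sup>2) < e)"

lemma approx_sum_bound:
  assumes "f \<in> sq_integrable \<mu>" "g \<in> sq_integrable \<mu>" "f' \<in> sq_integrable \<mu>" "g' \<in> sq_integrable \<mu>"
  shows "(LINT x|\<mu>. (cmod ((f x + f' x) - (g x + g' x)))\<^sup>2)
    \<le> 2 * (LINT x|\<mu>. (cmod (f x - g x))\<^sup>2) + 2 * (LINT x|\<mu>. (cmod (f' x - g' x))\<^sup>2)"
proof -
  have "(LINT x|\<mu>. (cmod ((f x + f' x) - (g x + g' x)))\<^sup>2)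
      \<le> (LINT x|\<mu>. 2 * (cmod (f x - g x))\<^sup>2 + 2 * (cmod (f' x - g' x))\<^sup>2)"
  proof (rule integral_mono)
    fix x show "(cmod ((f x + f' x) - (g x + g' x)))\<^sup>2 \<le> 2 * (cmod (f x - g x))\<^sup>2 + 2 * (cmod (f' x - g' x))\<^sup>2"
      using cmod_add_sq_le[of "f x - g x" "f' x - g' x"] by (simp add: algebra_simps)
  qed (use assms in \<open>simp_all\<close>)
  thus ?thesis using assms by simp
qed

lemma approx_add:
  assumes "approx f" "approx f'" shows "approx (\<lambda>x. f x + f' x)"
  unfolding approx_def
proof (intro conjI allI impI)
  show "(\<lambda>x. f x + f' x) \<in> sq_integrable \<mu>" using assms by (simp add: approx_def)
  fix e :: real assume "0 < e"
  hence e: "0 < e / 4" by simp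
  obtain g g' where g: "continuous_on K g" "(LINT x|\<mu>. (cmod (f x - g x))\<^sup>2) < e / 4"
    and g': "continuous_on K g'" "(LINT x|\<mu>. (cmod (f' x - g' x))\<^sup>2) < e / 4"
    using assms e unfolding approx_def by meson
  have "(LINT x|\<mu>. (cmod ((f x + f' x) - (g x + g' x)))\<^sup>2)
      \<le> 2 * (LINT x|\<mu>. (cmod (f x - g x))\<^sup>2) + 2 * (LINT x|\<mu>. (cmod (f' x - g' x))\<^sup>2)"
    using assms by (intro approx_sum_bound continuous_sq_integrable[OF g(1)] continuous_sq_integrable[OF g'(1)])
      (simp_all add: approx_def)
  also have "\<dots> < e" using g(2) g'(2) by simp
  finally show "\<exists>g. continuous_on K g \<and> (LINT x|\<mu>. (cmod (f x + f' x - g x))\<^sup>2) < e"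
    using g(1) g'(1) by (intro exI[of _ "\<lambda>x. g x + g' x"]) (auto intro: continuous_intros)
qed

lemma approx_zero: "approx (\<lambda>_. 0)"
  unfolding approx_def using continuous_sq_integrable[of "\<lambda>_. 0"]
  by (auto intro!: exI[of _ "\<lambda>_. 0"])

lemma approx_sum: "finite A \<Longrightarrow> (\<And>a. a \<in> A \<Longrightarrow> approx (f a)) \<Longrightarrow> approx (\<lambda>x. \<Sum>a\<in>A. f a x)"
  by (induction rule: finite_induct) (simp_all add: approx_zero approx_add)

lemma approx_indicator:
  assumes A: "A \<in> sets \<mu>" shows "approx (\<lambda>x. c * complex_of_real (indicator A x))"
  unfolding approx_def
proof (intro conjI allI impI)
  show sq: "(\<lambda>x. c * complex_of_real (indicator A x)) \<in> sq_integrable \<mu>"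
    using A by (intro sq_integrable_bounded_by[where g = "\<lambda>x. (cmod c)\<^sup>2"])
      (auto simp: norm_mult power_mult_distrib split: split_indicator)
  fix e :: real assume "0 < e"
  define d where "d = e / ((cmod c)\<^sup>2 + 1) / 2"
  have d: "d > 0" using \<open>0 < e\<close> by (simp add: d_def add_nonneg_pos)
  have AK: "A \<subseteq> K" using sets.sets_into_space[OF A] space_\<mu> by simp
  obtain C where C: "compact C" "C \<subseteq> A" "measure \<mu> A - d < measure \<mu> C"
  proof (cases "measure \<mu> A - d < 0")
    case True thus ?thesis using that[of "{}"] by simp
  next
    case False
    have "ennreal (measure \<mu> A - d) < emeasure \<mu> A"
      unfolding emeasure_eq_measure using d False by (intro ennreal_lessI) auto
    thus ?thesis unfolding pos_measuresD(4)[OF \<mu> A] less_SUP_iff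
      using that False by (auto simp: emeasure_eq_measure ennreal_less_iff)
  qed
  obtain U where U: "open U" "A \<subseteq> U" "measure \<mu> (U \<inter> K) < measure \<mu> A + d"
  proof -
    have "emeasure \<mu> A < ennreal (measure \<mu> A + d)"
      unfolding emeasure_eq_measure using d by (intro ennreal_lessI) (auto simp: add_nonneg_pos)
    thus ?thesis unfolding pos_measuresD(5)[OF \<mu> A] INF_less_iff
      using that by (auto simp: emeasure_eq_measure ennreal_less_iff)
  qed
  have CK: "C \<subseteq> K" using C AK by auto
  have o: "openin (top_of_set K) (U \<inter> K)" using U by (auto simp: openin_open)
  have sC: "C \<in> sets \<mu>" by (rule compact_in_sets[OF pos_measuresD(1)[OF \<mu>] C(1) CK])
  have sU: "U \<inter> K \<in> sets \<mu>" by (rule open_in_sets[OF pos_measuresD(1)[OF \<mu>] o])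
  have "closedin (top_of_set K) (K - (U \<inter> K))" using closedin_diff[OF closedin_topspace o] by simp
  moreover have "closedin (top_of_set K) C" using C CK closedin_compact_iff[OF K] by blast
  moreover have "C \<inter> (K - (U \<inter> K)) = {}" using C U by auto
  ultimately obtain g :: "'a \<Rightarrow> real" where g: "continuous_on K g" "\<And>x. x \<in> K \<Longrightarrow> 0 \<le> g x \<and> g x \<le> 1"
    "\<And>x. x \<in> C \<Longrightarrow> g x = 1" "\<And>x. x \<in> K - (U \<inter> K) \<Longrightarrow> g x = 0"
    using Urysohn_compact[OF K] by blast
  let ?g = "\<lambda>x. c * complex_of_real (g x)" and ?D = "U \<inter> K - C"
  have cg: "continuous_on K ?g" by (intro continuous_intros g(1))
  have sD: "?D \<in> sets \<mu>" using sC sU by auto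
  have "(LINT x|\<mu>. (cmod (c * complex_of_real (indicator A x) - ?g x))\<^sup>2)
      \<le> (LINT x|\<mu>. (cmod c)\<^sup>2 * indicator ?D x)"
  proof (rule integral_mono)
    show "integrable \<mu> (\<lambda>x. (cmod (c * complex_of_real (indicator A x) - ?g x))\<^sup>2)"
      using sq continuous_sq_integrable[OF cg] by simp
    show "integrable \<mu> (\<lambda>x. (cmod c)\<^sup>2 * indicat_real ?D x)"
      using sD by (simp add: emeasure_eq_measure)
    fix x assume "x \<in> space \<mu>"
    hence x: "x \<in> K" by (simp add: space_\<mu>)
    have "(cmod (c * complex_of_real (indicator A x) - ?g x))\<^sup>2 = (cmod c)\<^sup>2 * (indicator A x - g x)\<^sup>2"
    proof -
      have "c * complex_of_real (indicator A x) - ?g x = c * complex_of_real (indicator A x - g x)"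
        by (simp add: algebra_simps)
      thus ?thesis by (simp only: norm_mult norm_of_real power_mult_distrib power2_abs)
    qed
    also have "(indicator A x - g x)\<^sup>2 \<le> indicat_real ?D x"
    proof (cases "x \<in> ?D")
      case True
      have "\<bar>indicator A x - g x\<bar> \<le> 1" using g(2)[OF x] by (auto split: split_indicator)
      thus ?thesis using True by (simp add: abs_square_le_1)
    next
      case False
      hence "indicator A x = g x" using g(3)[of x] g(4)[of x] x C(2) U(2) by (auto split: split_indicator)
      thus ?thesis using False by simp
    qed
    finally show "(cmod (c * complex_of_real (indicator A x) - ?g x))\<^sup>2 \<le> (cmod c)\<^sup>2 * indicator ?D x"
      by (simp add: mult_left_mono)
  qed
  also have "\<dots> = (cmod c)\<^sup>2 * measure \<mu> ?D"
    using sD sets.sets_into_space[OF sD] by (simp add: Int_absorb2)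
  also have "measure \<mu> ?D = measure \<mu> (U \<inter> K) - measure \<mu> C"
    using C U AK by (intro finite_measure_Diff sC sU) auto
  also have "(cmod c)\<^sup>2 * (measure \<mu> (U \<inter> K) - measure \<mu> C) \<le> (cmod c)\<^sup>2 * (2 * d)"
    using C(3) U(3) by (intro mult_left_mono) auto
  also have "\<dots> < ((cmod c)\<^sup>2 + 1) * (2 * d)" using d by (intro mult_strict_right_mono) auto
  also have "\<dots> = e"
  proof -
    have "q * (2 * (e / q / 2)) = e" if "q > 0" for q :: real using that by simp
    moreover have "(cmod c)\<^sup>2 + 1 > 0" by (simp add: add_nonneg_pos)
    ultimately show ?thesis unfolding d_def by blast
  qed
  finally show "\<exists>g. continuous_on K g \<and> (LINT x|\<mu>. (cmod (c * complex_of_real (indicator A x) - g x))\<^sup>2) < e"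
    using cg by blast
qed

lemma approx_all:
  assumes f: "f \<in> sq_integrable \<mu>" shows "approx f"
  unfolding approx_def
proof (intro conjI allI impI f)
  fix e :: real assume "0 < e"
  have fm: "f \<in> borel_measurable \<mu>" using f by simp
  obtain s where s: "\<And>i. simple_function \<mu> (s i)" "\<And>x. x \<in> space \<mu> \<Longrightarrow> (\<lambda>i. s i x) \<longlonglongrightarrow> f x"
    "\<And>i x. x \<in> space \<mu> \<Longrightarrow> cmod (s i x) \<le> 2 * cmod (f x)"
    using borel_measurable_implies_sequence_metric[OF fm, of 0] unfolding dist_norm diff_0_right by metis
  have sm: "s i \<in> borel_measurable \<mu>" for i by (rule borel_measurable_simple_function[OF s(1)])
  have ssq: "s i \<in> sq_integrable \<mu>" for i
  proof (rule sq_integrable_bounded_by[where g = "\<lambda>x. 4 * (cmod (f x))\<^sup>2"])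
    fix x assume "x \<in> space \<mu>"
    hence "(cmod (s i x))\<^sup>2 \<le> (2 * cmod (f x))\<^sup>2" by (intro power_mono s(3)) auto
    thus "(cmod (s i x))\<^sup>2 \<le> 4 * (cmod (f x))\<^sup>2" by (simp add: power_mult_distrib)
  qed (use f sm in simp_all)
  have as: "approx (s i)" for i
  proof -
    have a: "approx (\<lambda>x. \<Sum>y\<in>s i ` space \<mu>. y * complex_of_real (indicator (s i -` {y} \<inter> space \<mu>) x))"
      by (intro approx_sum approx_indicator simple_functionD[OF s(1)])
    have eq: "s i x = (\<Sum>y\<in>s i ` space \<mu>. y * complex_of_real (indicator (s i -` {y} \<inter> space \<mu>) x))"
      if x: "x \<in> space \<mu>" for x
    proof -
      have "(\<Sum>y\<in>s i ` space \<mu>. y * complex_of_real (indicator (s i -` {y} \<inter> space \<mu>) x))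
          = (\<Sum>y\<in>s i ` space \<mu>. if y = s i x then y else 0)"
        using x by (intro sum.cong) (auto split: split_indicator)
      also have "\<dots> = s i x" using x simple_functionD(1)[OF s(1)] by simp
      finally show ?thesis by simp
    qed
    show ?thesis
      unfolding approx_def
    proof (intro conjI allI impI ssq)
      fix e :: real assume "0 < e"
      then obtain g where g: "continuous_on K g"
        "(LINT x|\<mu>. (cmod ((\<Sum>y\<in>s i ` space \<mu>. y * complex_of_real (indicator (s i -` {y} \<inter> space \<mu>) x)) - g x))\<^sup>2) < e"
        using a unfolding approx_def by blast
      have "(LINT x|\<mu>. (cmod (s i x - g x))\<^sup>2)
        = (LINT x|\<mu>. (cmod ((\<Sum>y\<in>s i ` space \<mu>. y * complex_of_real (indicator (s i -` {y} \<inter> space \<mu>) x)) - g x))\<^sup>2)"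
        by (rule Bochner_Integration.integral_cong[OF refl]) (simp only: eq[symmetric])
      thus "\<exists>g. continuous_on K g \<and> (LINT x|\<mu>. (cmod (s i x - g x))\<^sup>2) < e" using g by auto
    qed
  qed
  have "(\<lambda>i. LINT x|\<mu>. (cmod (f x - s i x))\<^sup>2) \<longlonglongrightarrow> (LINT x|\<mu>. 0)"
  proof (rule integral_dominated_convergence[where w = "\<lambda>x. 9 * (cmod (f x))\<^sup>2"])
    show "AE x in \<mu>. (\<lambda>i. (cmod (f x - s i x))\<^sup>2) \<longlonglongrightarrow> 0"
    proof (rule AE_I2)
      fix x assume "x \<in> space \<mu>"
      from s(2)[OF this] have "(\<lambda>i. (cmod (f x - s i x))\<^sup>2) \<longlonglongrightarrow> (cmod (f x - f x))\<^sup>2" by (intro tendsto_intros)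
      thus "(\<lambda>i. (cmod (f x - s i x))\<^sup>2) \<longlonglongrightarrow> 0" by simp
    qed
    show "AE x in \<mu>. norm ((cmod (f x - s i x))\<^sup>2) \<le> 9 * (cmod (f x))\<^sup>2" for i
    proof (rule AE_I2)
      fix x assume "x \<in> space \<mu>"
      hence "cmod (f x - s i x) \<le> 3 * cmod (f x)"
        using norm_triangle_ineq4[of "f x" "s i x"] s(3)[of x i] by linarith
      hence "(cmod (f x - s i x))\<^sup>2 \<le> (3 * cmod (f x))\<^sup>2" by (intro power_mono) auto
      thus "norm ((cmod (f x - s i x))\<^sup>2) \<le> 9 * (cmod (f x))\<^sup>2" by (simp add: power_mult_distrib)
    qed
    show "(\<lambda>x. (cmod (f x - s i x))\<^sup>2) \<in> borel_measurable \<mu>" for i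
      using sq_integrableD(2)[OF sq_integrable_diff[OF f ssq]] by (rule borel_measurable_integrable)
  qed (use f in simp_all)
  hence lim: "(\<lambda>i. LINT x|\<mu>. (cmod (f x - s i x))\<^sup>2) \<longlonglongrightarrow> 0" by simp
  obtain i where i: "(LINT x|\<mu>. (cmod (f x - s i x))\<^sup>2) < e / 4"
    using order_tendstoD(2)[OF lim, of "e / 4"] \<open>0 < e\<close> eventually_sequentially by auto
  obtain g where g: "continuous_on K g" "(LINT x|\<mu>. (cmod (s i x - g x))\<^sup>2) < e / 4"
    using as[of i] \<open>0 < e\<close> unfolding approx_def by (meson zero_less_divide_iff zero_less_numeral)
  have gs: "g \<in> sq_integrable \<mu>" by (rule continuous_sq_integrable[OF g(1)])
  have "(LINT x|\<mu>. (cmod ((f x + s i x) - (s i x + g x)))\<^sup>2)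
      \<le> 2 * (LINT x|\<mu>. (cmod (f x - s i x))\<^sup>2) + 2 * (LINT x|\<mu>. (cmod (s i x - g x))\<^sup>2)"
    by (rule approx_sum_bound[OF f ssq ssq gs])
  also have "\<dots> < e" using i g(2) by simp
  finally show "\<exists>g. continuous_on K g \<and> (LINT x|\<mu>. (cmod (f x - g x))\<^sup>2) < e"
    using g(1) by (auto intro!: exI[of _ g])
qed

theorem continuous_dense_in_L2: "dense_family (L2 \<mu>) (cont_fun K) (L2_class \<mu>)"
  unfolding dense_family_def
proof (intro conjI ballI allI impI)
  fix X and e :: real assume X: "X \<in> carrier (L2 \<mu>)" and e: "0 < e"
  obtain f where f: "f \<in> sq_integrable \<mu>" "X = L2_class \<mu> f" using X by (rule L2_carrierE)
  obtain g where g: "continuous_on K g" "(LINT x|\<mu>. (cmod (f x - g x))\<^sup>2) < e\<^sup>2"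
    using approx_all[OF f(1)] e unfolding approx_def by (meson zero_less_power)
  let ?g = "\<lambda>x\<in>K. g x"
  have gK: "?g \<in> cont_fun K" by (rule cont_fun_restrict[OF g(1)])
  have "(LINT x|\<mu>. (cmod (f x - ?g x))\<^sup>2) = (LINT x|\<mu>. (cmod (f x - g x))\<^sup>2)"
    by (rule Bochner_Integration.integral_cong) (simp_all add: space_\<mu>)
  hence "sqrt (LINT x|\<mu>. (cmod (f x - ?g x))\<^sup>2) < e"
    using g(2) e real_sqrt_less_mono[OF g(2)] by simp
  hence "hnorm (L2 \<mu>) (X \<ominus>\<^bsub>L2 \<mu>\<^esub> L2_class \<mu> ?g) < e"
    using f gK by (simp only: L2.hnorm_eq_nm L2.minus_eq_sub L2_class_carrier cont_fun_sq_integrable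
        L2_sub_class L2_nm_class sq_integrable_diff)
  thus "\<exists>g\<in>cont_fun K. hnorm (L2 \<mu>) (X \<ominus>\<^bsub>L2 \<mu>\<^esub> L2_class \<mu> g) < e" using gK by blast
qed simp

end


section \<open>Hilbert spaces from positive kernels\<close>

text \<open>Formal finite linear combinations of indices are lists of coefficient-index pairs.  The
  vectors of the Hilbert space are functions on the index set, encoded by an injection into a
  prescribed type; \<open>F i\<close> is the inner product of the vector \<open>F\<close> with the \<open>i\<close>-th basic vector.\<close>

locale positive_kernel =
  fixes k :: "'i \<Rightarrow> 'i \<Rightarrow> complex" and enc :: "('i \<Rightarrow> complex) \<Rightarrow> 'h"
  assumes k_commute: "k j i = cnj (k i j)"
    and k_pos: "0 \<le> Re (\<Sum>(c, i)\<leftarrow>xs. \<Sum>(d, j)\<leftarrow>xs. c * cnj d * k i j)"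
    and inj_enc: "inj enc"
begin

definition form :: "(complex \<times> 'i) list \<Rightarrow> (complex \<times> 'i) list \<Rightarrow> complex" where
  "form xs ys = (\<Sum>(c, i)\<leftarrow>xs. \<Sum>(d, j)\<leftarrow>ys. c * cnj d * k i j)"

definition scale_list :: "complex \<Rightarrow> (complex \<times> 'i) list \<Rightarrow> (complex \<times> 'i) list" where
  "scale_list a xs = map (\<lambda>(c, i). (a * c, i)) xs"

lemma form_Nil [simp]: "form [] ys = 0" "form xs [] = 0"
proof -
  show "form [] ys = 0" by (simp add: form_def)
  show "form xs [] = 0" unfolding form_def by (induction xs) auto
qed

lemma form_Cons_left: "form ((c, i) # xs) ys = c * form [(1, i)] ys + form xs ys"
proof -
  have "(\<Sum>(d, j)\<leftarrow>ys. c * cnj d * k i j) = c * (\<Sum>(d, j)\<leftarrow>ys. cnj d * k i j)"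
    by (induction ys) (auto simp: algebra_simps)
  thus ?thesis by (simp add: form_def)
qed

lemma form_scale_left: "form (scale_list a xs) ys = a * form xs ys"
proof (induction xs)
  case (Cons x xs)
  obtain c i where x: "x = (c, i)" by force
  have "form (scale_list a (x # xs)) ys = (a * c) * form [(1, i)] ys + form (scale_list a xs) ys"
    unfolding x scale_list_def by (simp add: form_Cons_left[of "a * c"])
  thus ?case unfolding Cons x by (subst form_Cons_left) (simp add: distrib_left)
qed (simp add: scale_list_def)

lemma form_append_left: "form (xs @ xs') ys = form xs ys + form xs' ys"
  by (simp add: form_def)

lemma form_commute: "form ys xs = cnj (form xs ys)"
proof -
  have "form ys xs = (\<Sum>(c, i)\<leftarrow>xs. \<Sum>(d, j)\<leftarrow>ys. d * cnj c * k j i)"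
    unfolding form_def
  proof (induction ys)
    case (Cons y ys)
    thus ?case by (simp add: case_prod_beta sum_list_addf)
  qed (simp add: case_prod_beta sum_list_0)
  also have "\<dots> = cnj (form xs ys)"
  proof -
    have "cnj (\<Sum>(d, j)\<leftarrow>ys. c * cnj d * k i j) = (\<Sum>(d, j)\<leftarrow>ys. d * cnj c * k j i)" for c i
      by (induction ys) (auto simp: mult_ac simp flip: k_commute)
    hence "cnj (\<Sum>(d, j)\<leftarrow>ys. fst x * cnj d * k (snd x) j) = (\<Sum>(d, j)\<leftarrow>ys. d * cnj (fst x) * k j (snd x))" for x by blast
    thus ?thesis unfolding form_def by (induction xs) (auto simp: case_prod_beta)
  qed
  finally show ?thesis .
qed

sublocale pre: semi_inner UNIV append scale_list form
proof
  show "0 \<le> Re (form xs xs)" for xs using k_pos unfolding form_def .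
  show "form ys xs = cnj (form xs ys)" for xs ys by (rule form_commute)
qed (simp_all add: form_append_left form_scale_left)

definition basic :: "'i \<Rightarrow> (complex \<times> 'i) list" where "basic i = [(1, i)]"

lemma form_basic: "form (basic i) (basic j) = k i j"
  by (simp add: basic_def form_def)

lemma form_expand: "form xs ys = (\<Sum>(d, j)\<leftarrow>ys. cnj d * form xs (basic j))"
proof (induction ys)
  case (Cons y ys)
  obtain d j where y: "y = (d, j)" by force
  have "form xs (y # ys) = form xs (scale_list d (basic j) @ ys)" by (simp add: y basic_def scale_list_def)
  thus ?case using Cons by (simp add: y)
qed simp

definition represents :: "(nat \<Rightarrow> (complex \<times> 'i) list) \<Rightarrow> ('i \<Rightarrow> complex) \<Rightarrow> bool" where
  "represents s F \<longleftrightarrow> pre.cauchy s \<and> (\<forall>i. (\<lambda>n. form (s n) (basic i)) \<longlonglongrightarrow> F i)"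

definition rk_fun :: "('i \<Rightarrow> complex) set" where "rk_fun = {F. \<exists>s. represents s F}"

text \<open>For large \<open>m\<close> and \<open>n\<close> the squared norm of \<open>s n\<close> is close to the form of \<open>s m\<close> and \<open>s n\<close>, which
  tends to \<open>0\<close> as \<open>m\<close> grows.\<close>

lemma cauchy_null:
  assumes s: "pre.cauchy s" and lim: "\<And>i. (\<lambda>n. form (s n) (basic i)) \<longlonglongrightarrow> 0"
  shows "(\<lambda>n. pre.nm (s n)) \<longlonglongrightarrow> 0"
proof (rule LIMSEQ_I)
  fix e :: real assume "0 < e"
  obtain B where B: "\<And>n. pre.nm (s n) \<le> B" "0 \<le> B" using pre.cauchy_bounded[OF s] by blast
  define d where "d = e\<^sup>2 / (B + 1)"
  have d: "d > 0" using \<open>0 < e\<close> B(2) by (simp add: d_def)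
  obtain N where N: "\<And>m n. m \<ge> N \<Longrightarrow> n \<ge> N \<Longrightarrow> pre.nm (pre.sub (s m) (s n)) < d"
    using s d unfolding pre.cauchy_def by meson
  have weak: "(\<lambda>n. form (s n) ys) \<longlonglongrightarrow> 0" for ys
  proof (induction ys)
    case (Cons y ys)
    obtain c j where y: "y = (c, j)" by force
    have "form (s n) (y # ys) = cnj c * form (s n) (basic j) + form (s n) ys" for n
      by (subst (1 2) form_expand) (simp add: y)
    thus ?case using tendsto_add[OF tendsto_mult_left[OF lim, of "cnj c" j] Cons] by simp
  qed simp
  have "norm (pre.nm (s n) - 0) < e" if n: "n \<ge> N" for n
  proof -
    have "(pre.nm (s n))\<^sup>2 \<le> B * d + cmod (form (s m) (s n))" if m: "m \<ge> N" for m
    proof -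
      have "(pre.nm (s n))\<^sup>2 = Re (form (pre.sub (s n) (s m)) (s n) + form (s m) (s n))"
        by (simp add: pre.nm_sq)
      also have "\<dots> \<le> cmod (form (pre.sub (s n) (s m)) (s n)) + cmod (form (s m) (s n))"
        using complex_Re_le_cmod norm_triangle_ineq order_trans by blast
      also have "cmod (form (pre.sub (s n) (s m)) (s n)) \<le> d * B"
        using pre.Cauchy_Schwarz[of "pre.sub (s n) (s m)" "s n"] N[OF n m] B d
          mult_mono[of "pre.nm (pre.sub (s n) (s m))" d "pre.nm (s n)" B] by fastforce
      finally show ?thesis by (simp add: mult.commute)
    qed
    moreover have "(\<lambda>m. B * d + cmod (form (s m) (s n))) \<longlonglongrightarrow> B * d + 0"
      by (intro tendsto_intros tendsto_norm_zero weak)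
    ultimately have "(pre.nm (s n))\<^sup>2 \<le> B * d + 0"
      by (intro LIMSEQ_le_const) auto
    also have "\<dots> < (B + 1) * d" using d by (simp add: algebra_simps)
    also have "\<dots> = e\<^sup>2" using B(2) by (simp add: d_def)
    finally show ?thesis using \<open>0 < e\<close> by (simp add: power2_less_imp_less)
  qed
  thus "\<exists>N. \<forall>n\<ge>N. norm (pre.nm (s n) - 0) < e" by blast
qed

lemma cauchy_append:
  assumes "pre.cauchy s" "pre.cauchy t" shows "pre.cauchy (\<lambda>n. s n @ t n)"
  unfolding pre.cauchy_def
proof (intro conjI allI impI)
  fix e :: real assume "0 < e"
  hence "0 < e / 2" by simp
  then obtain M N where M: "\<And>m n. m \<ge> M \<Longrightarrow> n \<ge> M \<Longrightarrow> pre.nm (pre.sub (s m) (s n)) < e / 2"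
    and N: "\<And>m n. m \<ge> N \<Longrightarrow> n \<ge> N \<Longrightarrow> pre.nm (pre.sub (t m) (t n)) < e / 2"
    using assms unfolding pre.cauchy_def by meson
  have "pre.nm (pre.sub (s m @ t m) (s n @ t n)) < e" if "m \<ge> max M N" "n \<ge> max M N" for m n
  proof -
    have "pre.nm (pre.sub (s m @ t m) (s n @ t n)) = pre.nm (pre.sub (s m) (s n) @ pre.sub (t m) (t n))"
      by (simp add: pre.nm_def algebra_simps)
    also have "\<dots> \<le> pre.nm (pre.sub (s m) (s n)) + pre.nm (pre.sub (t m) (t n))"
      by (intro pre.nm_triangle) auto
    also have "\<dots> < e" using M[of m n] N[of m n] that by simp
    finally show ?thesis .
  qed
  thus "\<exists>N. \<forall>m\<ge>N. \<forall>n\<ge>N. pre.nm (pre.sub (s m @ t m) (s n @ t n)) < e" by blast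
qed simp

lemma cauchy_scale:
  assumes "pre.cauchy s" shows "pre.cauchy (\<lambda>n. scale_list c (s n))"
  unfolding pre.cauchy_def
proof (intro conjI allI impI)
  fix e :: real assume "0 < e"
  hence "0 < e / (cmod c + 1)" by (simp add: add_nonneg_pos)
  then obtain N where N: "\<And>m n. m \<ge> N \<Longrightarrow> n \<ge> N \<Longrightarrow> pre.nm (pre.sub (s m) (s n)) < e / (cmod c + 1)"
    using assms unfolding pre.cauchy_def by meson
  have "pre.nm (pre.sub (scale_list c (s m)) (scale_list c (s n))) < e" if "m \<ge> N" "n \<ge> N" for m n
  proof -
    have "pre.nm (pre.sub (scale_list c (s m)) (scale_list c (s n))) = pre.nm (scale_list c (pre.sub (s m) (s n)))"
      by (simp add: pre.nm_def algebra_simps)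
    also have "\<dots> = cmod c * pre.nm (pre.sub (s m) (s n))" by (simp add: pre.nm_scal)
    also have "\<dots> \<le> cmod c * (e / (cmod c + 1))" using N[OF that] by (intro mult_left_mono) auto
    also have "\<dots> < (cmod c + 1) * (e / (cmod c + 1))" using \<open>0 < e / (cmod c + 1)\<close>
      by (intro mult_strict_right_mono) auto
    also have "\<dots> = e" using add_nonneg_pos[of "cmod c" 1] by simp
    finally show ?thesis .
  qed
  thus "\<exists>N. \<forall>m\<ge>N. \<forall>n\<ge>N. pre.nm (pre.sub (scale_list c (s m)) (scale_list c (s n))) < e" by blast
qed simp

lemma represents_add:
  "represents s F \<Longrightarrow> represents t G \<Longrightarrow> represents (\<lambda>n. s n @ t n) (\<lambda>i. F i + G i)"
  unfolding represents_def by (auto intro: cauchy_append tendsto_add)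

lemma represents_scale:
  "represents s F \<Longrightarrow> represents (\<lambda>n. scale_list c (s n)) (\<lambda>i. c * F i)"
  unfolding represents_def by (auto intro: cauchy_scale tendsto_mult_left)

lemma represents_unique:
  assumes s: "represents s F" and t: "represents t F"
  shows "(\<lambda>n. pre.nm (pre.sub (s n) (t n))) \<longlonglongrightarrow> 0"
proof -
  have r: "represents (\<lambda>n. pre.sub (s n) (t n)) (\<lambda>i. F i + (-1) * F i)"
    unfolding pre.sub_def by (intro represents_add represents_scale s t)
  show ?thesis by (rule cauchy_null) (use r in \<open>auto simp: represents_def\<close>)
qed

definition rep :: "('i \<Rightarrow> complex) \<Rightarrow> nat \<Rightarrow> (complex \<times> 'i) list" where
  "rep F = (SOME s. represents s F)"

text \<open>The chosen representing sequences may be replaced by any others, by \<open>rk_ip_lim\<close>.\<close>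

definition rk_ip :: "('i \<Rightarrow> complex) \<Rightarrow> ('i \<Rightarrow> complex) \<Rightarrow> complex" where
  "rk_ip F G = lim (\<lambda>n. form (rep F n) (rep G n))"

lemma represents_rep: "F \<in> rk_fun \<Longrightarrow> represents (rep F) F"
  unfolding rep_def rk_fun_def mem_Collect_eq by (rule someI_ex[of "\<lambda>s. represents s F"])

lemma rk_ip_lim:
  assumes s: "represents s F" and t: "represents t G"
  shows "(\<lambda>n. form (s n) (t n)) \<longlonglongrightarrow> rk_ip F G"
proof -
  have F: "represents (rep F) F" and G: "represents (rep G) G"
    using s t by (intro represents_rep; auto simp: rk_fun_def)+
  have c: "pre.cauchy s" "pre.cauchy t" "pre.cauchy (rep F)" "pre.cauchy (rep G)"
    using s t F G by (auto simp: represents_def)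
  have l: "(\<lambda>n. form (rep F n) (rep G n)) \<longlonglongrightarrow> rk_ip F G"
    unfolding rk_ip_def using pre.cauchy_ip_convergent[OF c(3,4)] by (simp add: convergent_LIMSEQ_iff)
  obtain B where B: "\<And>n. pre.nm (t n) \<le> B" "0 \<le> B" using pre.cauchy_bounded[OF c(2)] by blast
  obtain C where C: "\<And>n. pre.nm (rep F n) \<le> C" "0 \<le> C" using pre.cauchy_bounded[OF c(3)] by blast
  have le: "cmod (form (s n) (t n) - form (rep F n) (rep G n))
      \<le> pre.nm (pre.sub (s n) (rep F n)) * B + C * pre.nm (pre.sub (t n) (rep G n))" for n
  proof -
    have "pre.nm (pre.sub (s n) (rep F n)) * pre.nm (t n) \<le> pre.nm (pre.sub (s n) (rep F n)) * B"
      by (intro mult_left_mono B) simp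
    moreover have "pre.nm (rep F n) * pre.nm (pre.sub (t n) (rep G n)) \<le> C * pre.nm (pre.sub (t n) (rep G n))"
      by (intro mult_right_mono C) simp
    ultimately show ?thesis using pre.ip_diff_le[of "rep F n" "rep G n" "s n" "t n"] by simp
  qed
  have "(\<lambda>n. pre.nm (pre.sub (s n) (rep F n)) * B + C * pre.nm (pre.sub (t n) (rep G n))) \<longlonglongrightarrow> 0 * B + C * 0"
    by (intro tendsto_intros represents_unique[OF s F] represents_unique[OF t G])
  hence z: "(\<lambda>n. pre.nm (pre.sub (s n) (rep F n)) * B + C * pre.nm (pre.sub (t n) (rep G n))) \<longlonglongrightarrow> 0" by simp
  have "(\<lambda>n. form (s n) (t n) - form (rep F n) (rep G n)) \<longlonglongrightarrow> 0"
    by (rule Lim_null_comparison[OF _ z]) (use le in \<open>simp add: eventually_sequentially\<close>)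
  from tendsto_add[OF this l] show ?thesis by simp
qed

definition combination :: "(complex \<times> 'i) list \<Rightarrow> 'i \<Rightarrow> complex" where
  "combination xs = (\<lambda>i. form xs (basic i))"

lemma represents_combination: "represents (\<lambda>_. xs) (combination xs)"
  unfolding represents_def combination_def pre.cauchy_def by (simp add: pre.nm_def exI[of _ 0])

lemma combination_rk_fun: "combination xs \<in> rk_fun"
  using represents_combination by (auto simp: rk_fun_def)

lemma rk_ip_combination: "rk_ip (combination xs) (combination ys) = form xs ys"
  using rk_ip_lim[OF represents_combination represents_combination, of xs ys] LIMSEQ_unique tendsto_const
  by blast

lemma rk_ip_basic: "F \<in> rk_fun \<Longrightarrow> rk_ip F (combination (basic i)) = F i"
  using rk_ip_lim[OF represents_rep represents_combination, of F "basic i"] represents_rep[of F]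
    LIMSEQ_unique unfolding represents_def by blast

sublocale rk: semi_inner rk_fun "\<lambda>F G i. F i + G i" "\<lambda>c F i. c * F i" rk_ip
proof
  fix F G H and c :: complex
  assume F: "F \<in> rk_fun"
  note rF = represents_rep[OF F]
  show "(\<lambda>i. c * F i) \<in> rk_fun" using represents_scale[OF rF] by (auto simp: rk_fun_def)
  have "(\<lambda>n. Re (form (rep F n) (rep F n))) \<longlonglongrightarrow> Re (rk_ip F F)" by (intro tendsto_Re rk_ip_lim rF)
  thus "0 \<le> Re (rk_ip F F)" by (rule LIMSEQ_le_const) (use pre.ip_nonneg in auto)
  assume G: "G \<in> rk_fun"
  note rG = represents_rep[OF G]
  show "(\<lambda>i. F i + G i) \<in> rk_fun" using represents_add[OF rF rG] by (auto simp: rk_fun_def)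
  show "rk_ip (\<lambda>i. c * F i) G = c * rk_ip F G"
    using rk_ip_lim[OF represents_scale[OF rF] rG, of c] tendsto_mult_left[OF rk_ip_lim[OF rF rG], of c]
    by (simp add: LIMSEQ_unique)
  have "(\<lambda>n. cnj (form (rep F n) (rep G n))) \<longlonglongrightarrow> cnj (rk_ip F G)" by (intro tendsto_cnj rk_ip_lim rF rG)
  thus "rk_ip G F = cnj (rk_ip F G)"
    using rk_ip_lim[OF rG rF] by (simp add: LIMSEQ_unique flip: form_commute)
  assume H: "H \<in> rk_fun"
  note rH = represents_rep[OF H]
  show "rk_ip (\<lambda>i. F i + G i) H = rk_ip F H + rk_ip G H"
    using rk_ip_lim[OF represents_add[OF rF rG] rH] tendsto_add[OF rk_ip_lim[OF rF rH] rk_ip_lim[OF rG rH]]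
    by (simp add: LIMSEQ_unique)
qed

lemma rk_sub: "rk.sub F G = (\<lambda>i. F i - G i)"
  by (simp add: rk.sub_def)

lemma rk_eq_if_nm_zero:
  assumes "F \<in> rk_fun" "rk.nm F = 0" shows "F i = 0"
  using rk.Cauchy_Schwarz[OF assms(1) combination_rk_fun, of "basic i"] assms by (simp add: rk_ip_basic)

lemma represents_tendsto:
  assumes s: "represents s F" and F: "F \<in> rk_fun"
  shows "(\<lambda>n. rk.nm (rk.sub F (combination (s n)))) \<longlonglongrightarrow> 0"
proof (rule LIMSEQ_I)
  fix e :: real assume "0 < e"
  then obtain N where N: "\<And>m n. m \<ge> N \<Longrightarrow> n \<ge> N \<Longrightarrow> pre.nm (pre.sub (s m) (s n)) < e / 2"
    using s unfolding represents_def pre.cauchy_def by (meson half_gt_zero)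
  have "rk.nm (rk.sub F (combination (s n))) \<le> e / 2" if n: "n \<ge> N" for n
  proof -
    have r: "represents (\<lambda>m. pre.sub (s m) (s n)) (rk.sub F (combination (s n)))"
      unfolding pre.sub_def rk.sub_def by (intro represents_add represents_scale s represents_combination)
    have "(\<lambda>m. sqrt (Re (form (pre.sub (s m) (s n)) (pre.sub (s m) (s n)))))
        \<longlonglongrightarrow> rk.nm (rk.sub F (combination (s n)))"
      unfolding rk.nm_def by (intro tendsto_real_sqrt tendsto_Re rk_ip_lim r)
    thus ?thesis
      by (rule LIMSEQ_le_const2) (use N n in \<open>auto simp: pre.nm_def intro!: exI[of _ N] less_imp_le\<close>)
  qed
  moreover have "0 \<le> rk.nm (rk.sub F (combination (s n)))" for n
    using F combination_rk_fun by simp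
  ultimately show "\<exists>N. \<forall>n\<ge>N. norm (rk.nm (rk.sub F (combination (s n))) - 0) < e"
    using \<open>0 < e\<close> by (intro exI[of _ N]) fastforce
qed

lemma combination_dense:
  assumes F: "F \<in> rk_fun" and e: "0 < e" obtains xs where "rk.nm (rk.sub F (combination xs)) < e"
  using order_tendstoD(2)[OF represents_tendsto[OF represents_rep[OF F] F] e] that
  by (auto simp: eventually_sequentially)

lemma combination_sub: "rk.nm (rk.sub (combination xs) (combination ys)) = pre.nm (pre.sub xs ys)"
  by (simp add: rk.nm_def pre.nm_def combination_rk_fun rk_ip_combination)

text \<open>Each member of a Cauchy sequence is replaced by a nearby finite combination; the pointwise
  limit of the resulting Cauchy sequence of combinations is the limit sought.\<close>

lemma rk_complete:
  assumes S: "rk.cauchy S" shows "\<exists>F\<in>rk_fun. (\<lambda>n. rk.nm (rk.sub (S n) F)) \<longlonglongrightarrow> 0"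
proof -
  note SR = rk.cauchy_closed[OF S]
  have "\<exists>xs. rk.nm (rk.sub (S n) (combination xs)) < inverse (real (Suc n))" for n
    by (rule combination_dense[OF SR, of "inverse (real (Suc n))" n]) auto
  then obtain s where s: "\<And>n. rk.nm (rk.sub (S n) (combination (s n))) < inverse (real (Suc n))" by metis
  have close: "(\<lambda>n. rk.nm (rk.sub (S n) (combination (s n)))) \<longlonglongrightarrow> 0"
  proof (rule Lim_null_comparison[OF _ LIMSEQ_inverse_real_of_nat])
    show "\<forall>\<^sub>F n in sequentially. norm (rk.nm (rk.sub (S n) (combination (s n)))) \<le> inverse (real (Suc n))"
      using s SR combination_rk_fun by (intro always_eventually allI) (simp add: less_imp_le del: of_nat_Suc)
  qed
  have cs: "pre.cauchy s"
    unfolding pre.cauchy_def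
  proof (intro conjI allI impI)
    fix e :: real assume "0 < e"
    hence e: "0 < e / 3" by simp
    obtain M where M: "\<And>m n. m \<ge> M \<Longrightarrow> n \<ge> M \<Longrightarrow> rk.nm (rk.sub (S m) (S n)) < e / 3"
      using S e unfolding rk.cauchy_def by meson
    obtain N where N: "\<And>n. n \<ge> N \<Longrightarrow> rk.nm (rk.sub (S n) (combination (s n))) < e / 3"
      using order_tendstoD(2)[OF close e] by (auto simp: eventually_sequentially)
    have "pre.nm (pre.sub (s m) (s n)) < e" if "m \<ge> max M N" "n \<ge> max M N" for m n
    proof -
      have "rk.nm (rk.sub (combination (s m)) (combination (s n)))
          \<le> rk.nm (rk.sub (combination (s m)) (S m)) + rk.nm (rk.sub (S m) (combination (s n)))"
        by (intro rk.dist_triangle combination_rk_fun SR)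
      also have "rk.nm (rk.sub (S m) (combination (s n)))
          \<le> rk.nm (rk.sub (S m) (S n)) + rk.nm (rk.sub (S n) (combination (s n)))"
        by (intro rk.dist_triangle combination_rk_fun SR)
      also have "rk.nm (rk.sub (combination (s m)) (S m)) = rk.nm (rk.sub (S m) (combination (s m)))"
        by (intro rk.dist_sym combination_rk_fun SR)
      finally show ?thesis using M[of m n] N[of m] N[of n] that by (simp add: combination_sub)
    qed
    thus "\<exists>N. \<forall>m\<ge>N. \<forall>n\<ge>N. pre.nm (pre.sub (s m) (s n)) < e" by blast
  qed simp
  define F where "F i = lim (\<lambda>n. form (s n) (basic i))" for i
  have "pre.cauchy (\<lambda>_. basic i)" for i using represents_combination by (simp add: represents_def)
  hence rF: "represents s F"
    unfolding represents_def F_def using cs pre.cauchy_ip_convergent[OF cs]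
    by (auto simp: convergent_LIMSEQ_iff)
  hence F: "F \<in> rk_fun" by (auto simp: rk_fun_def)
  have le: "rk.nm (rk.sub (S n) F) \<le> rk.nm (rk.sub (S n) (combination (s n))) + rk.nm (rk.sub F (combination (s n)))" for n
    using rk.dist_triangle[OF SR combination_rk_fun F, of n "s n"]
      rk.dist_sym[OF combination_rk_fun F, of "s n"] by simp
  have "(\<lambda>n. rk.nm (rk.sub (S n) F)) \<longlonglongrightarrow> 0"
  proof (rule Lim_null_comparison)
    show "\<forall>\<^sub>F n in sequentially. norm (rk.nm (rk.sub (S n) F))
        \<le> rk.nm (rk.sub (S n) (combination (s n))) + rk.nm (rk.sub F (combination (s n)))"
      using le SR F by (intro always_eventually allI) simp
    show "(\<lambda>n. rk.nm (rk.sub (S n) (combination (s n))) + rk.nm (rk.sub F (combination (s n)))) \<longlonglongrightarrow> 0"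
      using tendsto_add[OF close represents_tendsto[OF rF F]] by simp
  qed
  thus ?thesis using F by blast
qed

definition dec :: "'h \<Rightarrow> 'i \<Rightarrow> complex" where "dec = inv_into UNIV enc"

lemma dec_enc [simp]: "dec (enc F) = F" by (simp add: dec_def inj_enc)

definition space :: "'h inner_module" where
  "space = \<lparr>carrier = enc ` rk_fun, mult = undefined, one = undefined, zero = enc (\<lambda>_. 0),
     add = (\<lambda>x y. enc (\<lambda>i. dec x i + dec y i)), smult = (\<lambda>c x. enc (\<lambda>i. c * dec x i)),
     cinner = (\<lambda>x y. rk_ip (dec x) (dec y))\<rparr>"

definition vec :: "'i \<Rightarrow> 'h" where "vec i = enc (combination (basic i))"

lemma space_simps [simp]:
  "carrier space = enc ` rk_fun" "zero space = enc (\<lambda>_. 0)"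
  "add space x y = enc (\<lambda>i. dec x i + dec y i)" "smult space c x = enc (\<lambda>i. c * dec x i)"
  "cinner space x y = rk_ip (dec x) (dec y)"
  by (simp_all add: space_def)

lemma semi_inner_space: "semi_inner (carrier space) (add space) (smult space) (cinner space)"
  by unfold_locales (auto simp: rk.ip_nonneg intro: rk.ip_commute)

theorem hilbert_space: "complex_hilbert_space space"
proof -
  interpret sp: semi_inner "carrier space" "add space" "smult space" "cinner space"
    by (rule semi_inner_space)
  have nm: "sp.nm x = rk.nm (dec x)" for x by (simp add: sp.nm_def rk.nm_def)
  have sub: "sp.sub x y = enc (rk.sub (dec x) (dec y))" for x y by (simp add: sp.sub_def rk.sub_def)
  have z: "(\<lambda>_. 0) \<in> rk_fun" using combination_rk_fun[of "[]"] by (simp add: combination_def)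
  show ?thesis
  proof (rule complex_hilbert_space_if_semi_inner[OF semi_inner_space])
    show "\<zero>\<^bsub>space\<^esub> \<in> carrier space" using z by simp
    show "cinner space \<zero>\<^bsub>space\<^esub> \<zero>\<^bsub>space\<^esub> = 0"
      using rk_ip_combination[of "[]" "[]"] by (simp add: combination_def)
  next
    fix x y assume "x \<in> carrier space" "y \<in> carrier space" and n: "sp.nm (sp.sub x y) = 0"
    then obtain F G where F: "F \<in> rk_fun" "x = enc F" and G: "G \<in> rk_fun" "y = enc G" by auto
    have "rk.sub F G i = 0" for i
      using n F G by (intro rk_eq_if_nm_zero) (auto simp: nm sub)
    hence "F = G" by (simp add: rk_sub fun_eq_iff)
    thus "x = y" using F G by simp
  next
    fix s assume s: "sp.cauchy s"
    have d: "dec (s n) \<in> rk_fun" for n using sp.cauchy_closed[OF s, of n] by auto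
    have "rk.cauchy (\<lambda>n. dec (s n))"
      using s d unfolding rk.cauchy_def sp.cauchy_def by (simp add: nm sub)
    then obtain F where "F \<in> rk_fun" "(\<lambda>n. rk.nm (rk.sub (dec (s n)) F)) \<longlonglongrightarrow> 0" using rk_complete by blast
    thus "\<exists>x\<in>carrier space. (\<lambda>n. sp.nm (sp.sub (s n) x)) \<longlonglongrightarrow> 0"
      by (intro bexI[of _ "enc F"]) (auto simp: nm sub)
  qed
qed

lemma vec_carrier [simp]: "vec i \<in> carrier space"
  by (simp add: vec_def combination_rk_fun)

lemma cinner_vec: "x \<in> carrier space \<Longrightarrow> cinner space x (vec i) = dec x i"
  by (auto simp: vec_def rk_ip_basic)

lemma cinner_vec_vec: "cinner space (vec i) (vec j) = k i j"
  by (simp add: vec_def rk_ip_combination form_basic)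

definition lin :: "(complex \<times> 'i) list \<Rightarrow> 'h" where "lin xs = enc (combination xs)"

lemma lin_dense: "dense_family space UNIV lin"
  unfolding dense_family_def
proof (intro conjI ballI allI impI)
  interpret sp: complex_hilbert_space space by (rule hilbert_space)
  show "lin xs \<in> carrier space" for xs by (simp add: lin_def combination_rk_fun)
  fix x and e :: real assume x: "x \<in> carrier space" and e: "0 < e"
  then obtain F where F: "F \<in> rk_fun" "x = enc F" by auto
  obtain xs where xs: "rk.nm (rk.sub F (combination xs)) < e" by (rule combination_dense[OF F(1) e])
  have "x \<ominus>\<^bsub>space\<^esub> lin xs = sp.si.sub x (lin xs)"
    by (rule sp.minus_eq_sub[OF x]) (simp add: lin_def combination_rk_fun)
  also have "\<dots> = enc (rk.sub F (combination xs))"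
    by (simp add: F sp.si.sub_def rk.sub_def lin_def)
  finally have "hnorm space (x \<ominus>\<^bsub>space\<^esub> lin xs) = rk.nm (rk.sub F (combination xs))"
    by (simp add: hnorm_def rk.nm_def)
  thus "\<exists>xs\<in>UNIV. hnorm space (x \<ominus>\<^bsub>space\<^esub> lin xs) < e" using xs by (intro bexI[of _ xs]) simp_all
qed

lemma form_map_basic:
  assumes "\<And>i. k (\<phi> i) j = k i j'"
  shows "form (map (apsnd \<phi>) xs) (basic j) = form xs (basic j')"
  using assms by (induction xs) (auto simp: form_def basic_def)

text \<open>Applying \<open>\<phi>\<close> to the indices turns a sequence that represents \<open>F\<close> into one that represents
  \<open>F \<circ> \<psi>\<close>: the bound keeps it a Cauchy sequence and adjointness identifies the pointwise limits.\<close>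

theorem index_map_op:
  assumes adj: "\<And>i j. k (\<phi> i) j = k i (\<psi> j)"
    and B: "0 \<le> B" "\<And>xs. Re (form (map (apsnd \<phi>) xs) (map (apsnd \<phi>) xs)) \<le> B\<^sup>2 * Re (form xs xs)"
  shows "(\<lambda>x\<in>carrier space. enc (\<lambda>j. dec x (\<psi> j))) \<in> bounded_ops space space"
proof -
  interpret sp: complex_hilbert_space space by (rule hilbert_space)
  interpret p: hilbert_pair space space ..
  have nm: "sp.si.nm x = rk.nm (dec x)" for x by (simp add: sp.si.nm_def rk.nm_def)
  have bd: "pre.nm (map (apsnd \<phi>) xs) \<le> B * pre.nm xs" for xs
  proof -
    have "(pre.nm (map (apsnd \<phi>) xs))\<^sup>2 \<le> (B * pre.nm xs)\<^sup>2"
      using B(2)[of xs] by (simp add: pre.nm_sq power_mult_distrib)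
    thus ?thesis using B(1) by (simp add: power2_le_iff_abs_le)
  qed
  have sub: "pre.sub (map (apsnd \<phi>) xs) (map (apsnd \<phi>) ys) = map (apsnd \<phi>) (pre.sub xs ys)" for xs ys
    by (simp add: pre.sub_def scale_list_def case_prod_unfold apsnd_def map_prod_def)
  have main: "(\<lambda>j. F (\<psi> j)) \<in> rk_fun \<and> rk.nm (\<lambda>j. F (\<psi> j)) \<le> B * rk.nm F" if F: "F \<in> rk_fun" for F
  proof -
    note r = represents_rep[OF F]
    let ?s = "\<lambda>n. map (apsnd \<phi>) (rep F n)"
    have r': "represents ?s (\<lambda>j. F (\<psi> j))"
      unfolding represents_def
    proof (intro conjI allI)
      show "pre.cauchy ?s"
        unfolding pre.cauchy_def
      proof (intro conjI allI impI)
        fix e :: real assume "0 < e"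
        hence e: "0 < e / (B + 1)" using B(1) by simp
        obtain N where N: "\<And>m n. m \<ge> N \<Longrightarrow> n \<ge> N \<Longrightarrow> pre.nm (pre.sub (rep F m) (rep F n)) < e / (B + 1)"
          using r e unfolding represents_def pre.cauchy_def by meson
        have "pre.nm (pre.sub (?s m) (?s n)) < e" if "m \<ge> N" "n \<ge> N" for m n
        proof -
          have "pre.nm (pre.sub (?s m) (?s n)) \<le> B * pre.nm (pre.sub (rep F m) (rep F n))"
            unfolding sub by (rule bd)
          also have "\<dots> \<le> B * (e / (B + 1))" using N[OF that] B(1) by (intro mult_left_mono) auto
          also have "\<dots> < (B + 1) * (e / (B + 1))" using e by (intro mult_strict_right_mono) auto
          also have "\<dots> = e" using B(1) by simp
          finally show ?thesis .
        qed
        thus "\<exists>N. \<forall>m\<ge>N. \<forall>n\<ge>N. pre.nm (pre.sub (?s m) (?s n)) < e" by blast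
      qed simp
      show "(\<lambda>n. form (?s n) (basic j)) \<longlonglongrightarrow> F (\<psi> j)" for j
        using r unfolding represents_def form_map_basic[OF adj] by blast
    qed
    have l1: "(\<lambda>n. pre.nm (?s n)) \<longlonglongrightarrow> rk.nm (\<lambda>j. F (\<psi> j))"
      unfolding pre.nm_def rk.nm_def by (intro tendsto_real_sqrt tendsto_Re rk_ip_lim r')
    have l2: "(\<lambda>n. B * pre.nm (rep F n)) \<longlonglongrightarrow> B * rk.nm F"
      unfolding pre.nm_def rk.nm_def by (intro tendsto_mult_left tendsto_real_sqrt tendsto_Re rk_ip_lim r)
    show ?thesis using r' LIMSEQ_le[OF l1 l2] bd by (auto simp: rk_fun_def)
  qed
  show ?thesis
    by (rule p.bounded_opsI[where B = B]) (use main in \<open>auto simp: nm\<close>)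
qed

lemma index_map_op_vec:
  assumes adj: "\<And>i j. k (\<phi> i) j = k i (\<psi> j)"
  shows "(\<lambda>x\<in>carrier space. enc (\<lambda>j. dec x (\<psi> j))) (vec i) = vec (\<phi> i)"
  by (simp add: vec_def combination_rk_fun) (simp add: combination_def form_basic adj)

text \<open>From here on vectors are compared through their inner products only.\<close>

declare space_simps [simp del]

end


section \<open>Representations and completely positive maps\<close>

text \<open>The operations of \<open>C(K)\<close> get names, so that rewriting does not look inside the restricted
  abstractions that represent its elements.\<close>

definition cunit :: "'a set \<Rightarrow> 'a \<Rightarrow> complex" where "cunit K = (\<lambda>x\<in>K. 1)"
definition cadd :: "'a set \<Rightarrow> ('a \<Rightarrow> complex) \<Rightarrow> ('a \<Rightarrow> complex) \<Rightarrow> 'a \<Rightarrow> complex" where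
  "cadd K f g = (\<lambda>x\<in>K. f x + g x)"
definition cscale :: "'a set \<Rightarrow> complex \<Rightarrow> ('a \<Rightarrow> complex) \<Rightarrow> 'a \<Rightarrow> complex" where
  "cscale K c f = (\<lambda>x\<in>K. c * f x)"
definition cmul :: "'a set \<Rightarrow> ('a \<Rightarrow> complex) \<Rightarrow> ('a \<Rightarrow> complex) \<Rightarrow> 'a \<Rightarrow> complex" where
  "cmul K f g = (\<lambda>x\<in>K. f x * g x)"
definition ccnj :: "'a set \<Rightarrow> ('a \<Rightarrow> complex) \<Rightarrow> 'a \<Rightarrow> complex" where
  "ccnj K f = (\<lambda>x\<in>K. cnj (f x))"

lemmas cfun_defs = cunit_def cadd_def cscale_def cmul_def ccnj_def

lemma cfun_apply [simp]:
  assumes "x \<in> K"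
  shows "cunit K x = 1" "cadd K f g x = f x + g x" "cscale K c f x = c * f x"
    "cmul K f g x = f x * g x" "ccnj K f x = cnj (f x)"
  using assms by (simp_all add: cfun_defs)

lemma cont_fun_ops [simp]:
  "cunit K \<in> cont_fun K"
  "f \<in> cont_fun K \<Longrightarrow> g \<in> cont_fun K \<Longrightarrow> cadd K f g \<in> cont_fun K"
  "f \<in> cont_fun K \<Longrightarrow> cscale K c f \<in> cont_fun K"
  "f \<in> cont_fun K \<Longrightarrow> g \<in> cont_fun K \<Longrightarrow> cmul K f g \<in> cont_fun K"
  "f \<in> cont_fun K \<Longrightarrow> ccnj K f \<in> cont_fun K"
  unfolding cfun_defs by (auto dest!: cont_funD intro!: cont_fun_restrict continuous_intros)

lemma cunit_mult [simp]:
  assumes "f \<in> cont_fun K"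
  shows "cmul K (cunit K) f = f" "cmul K f (cunit K) = f" "cmul K (ccnj K (cunit K)) f = f"
  using assms by (intro cont_fun_eqI[of _ K]; simp)+

lemma ccnj_cunit [simp]: "ccnj K (cunit K) = cunit K"
  by (rule ext) (simp add: cfun_defs)

lemma cont_fun_gram_sum:
  assumes "\<And>k. k < (n::nat) \<Longrightarrow> f k \<in> cont_fun K" "\<And>k. k < n \<Longrightarrow> g k \<in> cont_fun K"
  shows "(\<lambda>x\<in>K. \<Sum>k<n. cnj (f k x) * g k x) \<in> cont_fun K"
  using assms by (intro cont_fun_restrict continuous_on_sum continuous_on_mult continuous_on_cnj)
    (auto dest: cont_funD)

lemma (in hilbert_pair) eq_if_cinner_dense:
  assumes d: "dense_family H I x" and u: "u \<in> carrier H" "v \<in> carrier H"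
    and eq: "\<And>i. i \<in> I \<Longrightarrow> cinner H u (x i) = cinner H v (x i)"
  shows "u = v"
proof (rule H.eq_if_cinner_eq[OF u])
  fix z assume z: "z \<in> carrier H"
  obtain i where i: "\<And>n. i n \<in> I" "(\<lambda>n. H.si.nm (H.si.sub (x (i n)) z)) \<longlonglongrightarrow> 0"
    by (rule dense_sequence[OF d z]) blast
  have x: "x (i n) \<in> carrier H" for n using d i(1) by (auto simp: dense_family_def)
  have c: "(\<lambda>n. H.si.nm (H.si.sub w w)) \<longlonglongrightarrow> 0" if "w \<in> carrier H" for w
    using that by (simp add: H.si.nm_def)
  have "(\<lambda>n. cinner H u (x (i n))) \<longlonglongrightarrow> cinner H u z"
    by (rule H.si.tendsto_ip) (use u x z i c in auto)
  moreover have "(\<lambda>n. cinner H v (x (i n))) \<longlonglongrightarrow> cinner H v z"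
    by (rule H.si.tendsto_ip) (use u x z i c in auto)
  ultimately show "cinner H u z = cinner H v z" using eq[OF i(1)] by (simp add: LIMSEQ_unique)
qed

context complex_hilbert_space
begin

lemma self_pair: "hilbert_pair H H"
  by (simp add: hilbert_pair_def complex_hilbert_space_axioms)

lemma bounded_ops_eq_if_cinner:
  assumes T: "T \<in> bounded_ops H H" "T' \<in> bounded_ops H H"
    and eq: "\<And>x y. x \<in> carrier H \<Longrightarrow> y \<in> carrier H \<Longrightarrow> cinner H (T x) y = cinner H (T' x) y"
  shows "T = T'"
  by (rule bounded_ops_eqI[OF T], rule eq_if_cinner_eq)
    (use eq bounded_opsD(1)[OF T(1)] bounded_opsD(1)[OF T(2)] in auto)

lemma bounded_ops_eq_if_cinner_dense:
  assumes T: "T \<in> bounded_ops H H" "T' \<in> bounded_ops H H" and d: "dense_family H I x"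
    and eq: "\<And>i j. i \<in> I \<Longrightarrow> j \<in> I \<Longrightarrow> cinner H (T (x i)) (x j) = cinner H (T' (x i)) (x j)"
  shows "T = T'"
proof -
  have x: "x i \<in> carrier H" if "i \<in> I" for i using d that by (auto simp: dense_family_def)
  have "T (x i) = T' (x i)" if "i \<in> I" for i
    by (rule hilbert_pair.eq_if_cinner_dense[OF self_pair d])
      (use eq that x bounded_opsD(1)[OF T(1)] bounded_opsD(1)[OF T(2)] in auto)
  thus ?thesis by (rule hilbert_pair.bounded_ops_eq_if_dense[OF self_pair T d])
qed

text \<open>The double sum is the squared norm of the sum of the vectors.\<close>

lemma gram_sum_nonneg:
  assumes a: "\<And>j. j < n \<Longrightarrow> a j \<in> carrier H"
  shows "(\<Sum>i<n::nat. \<Sum>j<n. cinner H (a j) (a i)) \<in> \<real>\<^sub>\<ge>\<^sub>0"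
proof -
  have "\<exists>s\<in>carrier H. \<forall>z\<in>carrier H. cinner H s z = (\<Sum>j<m. cinner H (a j) z)" if "m \<le> n" for m
    using that
  proof (induction m)
    case 0 show ?case by (intro bexI[of _ "0 \<odot>\<^bsub>H\<^esub> \<zero>"]) (auto simp: cinner_smult_left simp del: smult_r_null)
  next
    case (Suc m)
    then obtain s where "s \<in> carrier H" "\<forall>z\<in>carrier H. cinner H s z = (\<Sum>j<m. cinner H (a j) z)" by auto
    thus ?case using a[of m] Suc by (intro bexI[of _ "s \<oplus> a m"]) auto
  qed
  then obtain s where s: "s \<in> carrier H" "\<And>z. z \<in> carrier H \<Longrightarrow> cinner H s z = (\<Sum>j<n. cinner H (a j) z)"
    by blast
  have "(\<Sum>i<n. \<Sum>j<n. cinner H (a j) (a i)) = (\<Sum>i<n. cnj (cinner H (a i) s))"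
    using s a by (intro sum.cong) (auto simp flip: s(2) intro: si.ip_commute)
  also have "\<dots> = cnj (\<Sum>i<n. cinner H (a i) s)" by simp
  also have "\<dots> = complex_of_real ((si.nm s)\<^sup>2)" unfolding s(2)[OF s(1), symmetric] using si.ip_self[OF s(1)] by simp
  finally show ?thesis by (simp add: complex_nonneg_Reals_iff)
qed

end

locale representation = complex_hilbert_space H
  for H :: "('h, 'm) inner_module_scheme" (structure) +
  fixes K :: "'a::topological_space set" and \<pi> :: "('a \<Rightarrow> complex) \<Rightarrow> 'h \<Rightarrow> 'h"
  assumes star_rep: "star_rep K H \<pi>"
begin

lemma rep_linear: "linear_op_map K H \<pi>" using star_rep by (simp add: star_rep_def)

lemma rep_op: "f \<in> cont_fun K \<Longrightarrow> \<pi> f \<in> bounded_ops H H"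
  using rep_linear by (auto simp: linear_op_map_def)

lemma rep_closed [simp]: "f \<in> cont_fun K \<Longrightarrow> x \<in> carrier H \<Longrightarrow> \<pi> f x \<in> carrier H"
  using bounded_opsD(1)[OF rep_op] .

lemma rep_add:
  "f \<in> cont_fun K \<Longrightarrow> g \<in> cont_fun K \<Longrightarrow> x \<in> carrier H \<Longrightarrow> \<pi> (cadd K f g) x = \<pi> f x \<oplus> \<pi> g x"
  using rep_linear by (simp add: linear_op_map_def cadd_def)

lemma rep_scale: "f \<in> cont_fun K \<Longrightarrow> x \<in> carrier H \<Longrightarrow> \<pi> (cscale K c f) x = c \<odot>\<^bsub>H\<^esub> \<pi> f x"
  using rep_linear by (simp add: linear_op_map_def cscale_def)

lemma rep_mult:
  "f \<in> cont_fun K \<Longrightarrow> g \<in> cont_fun K \<Longrightarrow> x \<in> carrier H \<Longrightarrow> \<pi> (cmul K f g) x = \<pi> f (\<pi> g x)"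
  using star_rep by (simp add: star_rep_def compose_eq cmul_def)

lemma rep_adjoint:
  assumes "f \<in> cont_fun K" "x \<in> carrier H" "y \<in> carrier H"
  shows "cinner H (\<pi> f x) y = cinner H x (\<pi> (ccnj K f) y)"
    and "cinner H x (\<pi> f y) = cinner H (\<pi> (ccnj K f) x) y"
  using hilbert_pair.hadjoint(2,3)[OF self_pair rep_op[OF assms(1)]] star_rep assms
  by (auto simp: star_rep_def ccnj_def)

lemma rep_mult_cinner:
  assumes "f \<in> cont_fun K" "g \<in> cont_fun K" "x \<in> carrier H" "y \<in> carrier H"
  shows "cinner H (\<pi> f x) (\<pi> g y) = cinner H (\<pi> (cmul K (ccnj K g) f) x) y"
  using assms by (simp add: rep_adjoint(2) rep_mult)

lemma rep_gram_sum:
  assumes G: "\<And>k. k < (n::nat) \<Longrightarrow> G k \<in> cont_fun K" "\<And>k. k < n \<Longrightarrow> G' k \<in> cont_fun K"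
    and x: "x \<in> carrier H" "y \<in> carrier H"
  shows "cinner H (\<pi> (\<lambda>t\<in>K. \<Sum>k<n. cnj (G' k t) * G k t) x) y = (\<Sum>k<n. cinner H (\<pi> (G k) x) (\<pi> (G' k) y))"
  using G
proof (induction n)
  case 0
  have "(\<lambda>t\<in>K. \<Sum>k<0::nat. cnj (G' k t) * G k t) = cscale K 0 (cunit K)"
    by (rule ext) (simp add: cscale_def)
  moreover have "cinner H (\<pi> (cscale K 0 (cunit K)) x) y = 0"
    using x rep_closed[of "cunit K" x] cinner_smult_left[of "\<pi> (cunit K) x" y 0]
    by (simp only: rep_scale cont_fun_ops mult_zero_left)
  ultimately show ?case by simp
next
  case (Suc n)
  have s: "(\<lambda>t\<in>K. \<Sum>k<n. cnj (G' k t) * G k t) \<in> cont_fun K"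
    using Suc.prems by (intro cont_fun_gram_sum) auto
  have m: "cmul K (ccnj K (G' n)) (G n) \<in> cont_fun K" using Suc.prems by simp
  have "(\<lambda>t\<in>K. \<Sum>k<Suc n. cnj (G' k t) * G k t)
      = cadd K (\<lambda>t\<in>K. \<Sum>k<n. cnj (G' k t) * G k t) (cmul K (ccnj K (G' n)) (G n))"
    by (rule ext) (simp add: cfun_defs)
  hence step: "cinner H (\<pi> (\<lambda>t\<in>K. \<Sum>k<Suc n. cnj (G' k t) * G k t) x) y
      = cinner H (\<pi> (\<lambda>t\<in>K. \<Sum>k<n. cnj (G' k t) * G k t) x) y + cinner H (\<pi> (cmul K (ccnj K (G' n)) (G n)) x) y"
    using rep_add[OF s m x(1)] rep_closed[OF s x(1)] rep_closed[OF m x(1)] x(2) by (simp only: cinner_add_left)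
  have IH: "cinner H (\<pi> (\<lambda>t\<in>K. \<Sum>k<n. cnj (G' k t) * G k t) x) y = (\<Sum>k<n. cinner H (\<pi> (G k) x) (\<pi> (G' k) y))"
    by (rule Suc.IH) (simp_all add: Suc.prems)
  have last: "cinner H (\<pi> (cmul K (ccnj K (G' n)) (G n)) x) y = cinner H (\<pi> (G n) x) (\<pi> (G' n) y)"
    using Suc.prems x by (simp add: rep_mult_cinner)
  show ?case unfolding step IH last by simp
qed

end

definition compression ::
  "'a::topological_space set \<Rightarrow> ('h, 'm) inner_module_scheme \<Rightarrow> ('l, 'n) inner_module_scheme \<Rightarrow>
    (('a \<Rightarrow> complex) \<Rightarrow> 'l \<Rightarrow> 'l) \<Rightarrow> ('h \<Rightarrow> 'l) \<Rightarrow> ('a \<Rightarrow> complex) \<Rightarrow> 'h \<Rightarrow> 'h" where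
  "compression K H L \<sigma> T =
    (\<lambda>f\<in>cont_fun K. compose (carrier H) (hadjoint H L T) (compose (carrier H) (\<sigma> f) T))"

locale compressed_representation = H: complex_hilbert_space H + L: representation L K \<sigma>
  for H :: "('h, 'm) inner_module_scheme" and L :: "('l, 'n) inner_module_scheme"
    and K :: "'a::topological_space set" and \<sigma> +
  fixes T assumes T: "T \<in> bounded_ops H L"
begin

sublocale pair: hilbert_pair H L ..

lemma compression_op: "f \<in> cont_fun K \<Longrightarrow> compression K H L \<sigma> T f \<in> bounded_ops H H"
  by (simp add: compression_def)
    (intro bounded_ops_compose[of H L H] bounded_ops_compose[of H L L] H.complex_hilbert_space_axioms
      L.complex_hilbert_space_axioms T L.rep_op pair.hadjoint(1))

lemma cinner_compression:
  assumes "f \<in> cont_fun K" "x \<in> carrier H" "y \<in> carrier H"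
  shows "cinner H (compression K H L \<sigma> T f x) y = cinner L (\<sigma> f (T x)) (T y)"
  using assms pair.hadjoint(3)[OF T assms(3), of "\<sigma> f (T x)"] bounded_opsD(1)[OF T]
  by (simp add: compression_def compose_eq)

lemma compression_closed:
  "f \<in> cont_fun K \<Longrightarrow> x \<in> carrier H \<Longrightarrow> compression K H L \<sigma> T f x \<in> carrier H"
  by (rule bounded_opsD(1)[OF compression_op])

lemma compression_linear: "linear_op_map K H (compression K H L \<sigma> T)"
  unfolding linear_op_map_def cadd_def[symmetric] cscale_def[symmetric]
proof (intro conjI ballI allI)
  show "compression K H L \<sigma> T \<in> cont_fun K \<rightarrow> bounded_ops H H" using compression_op by blast
  fix f assume f: "f \<in> cont_fun K"
  {
    fix g assume g: "g \<in> cont_fun K"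
    show "compression K H L \<sigma> T (cadd K f g) =
      (\<lambda>h\<in>carrier H. compression K H L \<sigma> T f h \<oplus>\<^bsub>H\<^esub> compression K H L \<sigma> T g h)"
    proof (rule extensionalityI[of _ "carrier H"])
      fix x assume x: "x \<in> carrier H"
      have "compression K H L \<sigma> T (cadd K f g) x = compression K H L \<sigma> T f x \<oplus>\<^bsub>H\<^esub> compression K H L \<sigma> T g x"
        using f g x bounded_opsD(1)[OF T]
        by (intro H.eq_if_cinner_eq) (simp_all add: compression_closed cinner_compression L.rep_add)
      thus "compression K H L \<sigma> T (cadd K f g) x
        = (\<lambda>h\<in>carrier H. compression K H L \<sigma> T f h \<oplus>\<^bsub>H\<^esub> compression K H L \<sigma> T g h) x" using x by simp
    qed (use bounded_opsD(4)[OF compression_op] f g in auto)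
  }
  fix c
  show "compression K H L \<sigma> T (cscale K c f) = (\<lambda>h\<in>carrier H. c \<odot>\<^bsub>H\<^esub> compression K H L \<sigma> T f h)"
  proof (rule extensionalityI[of _ "carrier H"])
    fix x assume x: "x \<in> carrier H"
    have "compression K H L \<sigma> T (cscale K c f) x = c \<odot>\<^bsub>H\<^esub> compression K H L \<sigma> T f x"
      using f x bounded_opsD(1)[OF T]
      by (intro H.eq_if_cinner_eq) (simp_all add: compression_closed cinner_compression L.rep_scale)
    thus "compression K H L \<sigma> T (cscale K c f) x
      = (\<lambda>h\<in>carrier H. c \<odot>\<^bsub>H\<^esub> compression K H L \<sigma> T f h) x" using x by simp
  qed (use bounded_opsD(4)[OF compression_op] f in auto)
qed

text \<open>For the matrix \<open>G\<^sup>*G\<close> the double sum to be estimated is a sum of squared norms, one for each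
  row of \<open>G\<close>.\<close>

theorem compression_completely_positive: "completely_positive K H (compression K H L \<sigma> T)"
  unfolding completely_positive_def pos_op_matrix_def
proof (intro conjI allI impI compression_linear)
  fix n F h assume "pos_cont_matrix K n F" and h: "\<forall>i<n. h i \<in> carrier H"
  then obtain G where G: "\<And>i j. i < n \<Longrightarrow> j < n \<Longrightarrow> G i j \<in> cont_fun K"
    and F: "\<And>i j. i < n \<Longrightarrow> j < n \<Longrightarrow> F i j = (\<lambda>x\<in>K. \<Sum>k<n. cnj (G k i x) * G k j x)"
    unfolding pos_cont_matrix_def by blast
  have FK: "F i j \<in> cont_fun K" if "i < n" "j < n" for i j
    unfolding F[OF that] using that G by (intro cont_fun_gram_sum) auto
  let ?a = "\<lambda>k j. \<sigma> (G k j) (T (h j))"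
  have "(\<Sum>i<n. \<Sum>j<n. cinner H (compression K H L \<sigma> T (F i j) (h j)) (h i))
      = (\<Sum>i<n. \<Sum>j<n. \<Sum>k<n. cinner L (?a k j) (?a k i))"
  proof (intro sum.cong refl)
    fix i j assume ij: "i \<in> {..<n}" "j \<in> {..<n}"
    have "cinner H (compression K H L \<sigma> T (F i j) (h j)) (h i) = cinner L (\<sigma> (F i j) (T (h j))) (T (h i))"
      using ij h FK by (intro cinner_compression) auto
    also have "\<dots> = (\<Sum>k<n. cinner L (?a k j) (?a k i))"
      using ij h G bounded_opsD(1)[OF T] by (simp add: F L.rep_gram_sum)
    finally show "cinner H (compression K H L \<sigma> T (F i j) (h j)) (h i) = (\<Sum>k<n. cinner L (?a k j) (?a k i))" .
  qed
  also have "\<dots> = (\<Sum>i<n. \<Sum>k<n. \<Sum>j<n. cinner L (?a k j) (?a k i))"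
    by (intro sum.cong refl sum.swap)
  also have "\<dots> = (\<Sum>k<n. \<Sum>i<n. \<Sum>j<n. cinner L (?a k j) (?a k i))" by (rule sum.swap)
  also have "\<dots> \<in> \<real>\<^sub>\<ge>\<^sub>0"
  proof -
    have "(\<Sum>i<n. \<Sum>j<n. cinner L (?a k j) (?a k i)) \<in> \<real>\<^sub>\<ge>\<^sub>0" if "k < n" for k
      using that G h bounded_opsD(1)[OF T] by (intro L.gram_sum_nonneg) auto
    hence "(\<Sum>k<m. \<Sum>i<n. \<Sum>j<n. cinner L (?a k j) (?a k i)) \<in> \<real>\<^sub>\<ge>\<^sub>0" if "m \<le> n" for m
      using that by (induction m) (auto intro: nonneg_Reals_add_I)
    thus ?thesis by simp
  qed
  finally show "(\<Sum>i<n. \<Sum>j<n. cinner H (compression K H L \<sigma> T (F i j) (h j)) (h i)) \<in> \<real>\<^sub>\<ge>\<^sub>0" .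
qed

end

lemma (in representation) rep_completely_positive:
  assumes "\<pi> \<in> extensional (cont_fun K)" shows "completely_positive K H \<pi>"
proof -
  have I: "(\<lambda>x\<in>carrier H. x) \<in> bounded_ops H H"
    by (rule hilbert_pair.bounded_opsI[OF self_pair, where B = 1]) auto
  interpret c: compressed_representation H H K \<pi> "\<lambda>x\<in>carrier H. x" by unfold_locales (rule I)
  have "compression K H H \<pi> (\<lambda>x\<in>carrier H. x) = \<pi>"
  proof (rule extensionalityI[of _ "cont_fun K"])
    fix f assume f: "f \<in> cont_fun K"
    show "compression K H H \<pi> (\<lambda>x\<in>carrier H. x) f = \<pi> f"
      by (rule bounded_ops_eq_if_cinner[OF c.compression_op[OF f] rep_op[OF f]])
        (simp add: c.cinner_compression f)
  qed (use assms in \<open>auto simp: compression_def\<close>)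
  thus ?thesis using c.compression_completely_positive by simp
qed

section \<open>The GNS representation\<close>

context regular_measure
begin

lemma continuous_mult_sq_integrable:
  assumes "f \<in> cont_fun K" "h \<in> sq_integrable \<mu>" shows "(\<lambda>x. f x * h x) \<in> sq_integrable \<mu>"
proof -
  obtain B where "\<And>x. x \<in> K \<Longrightarrow> cmod (f x) \<le> B" by (rule bounded_on_compact[OF K cont_funD[OF assms(1)]]) blast
  thus ?thesis
    using borel_measurable_continuous[OF \<mu> cont_funD[OF assms(1)]] assms(2)
    by (intro sq_integrable_bounded_mult) (auto simp: space_\<mu>)
qed

lemma gns_class:
  assumes f: "f \<in> cont_fun K" and h: "h \<in> sq_integrable \<mu>"
  shows "gns_rep K \<mu> f (L2_class \<mu> h) = L2_class \<mu> (\<lambda>x. f x * h x)"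
proof -
  have "AE x in \<mu>. f x * L2_repr (L2_class \<mu> h) x = f x * h x"
    using L2_repr_class(2)[OF h] by eventually_elim simp
  thus ?thesis using f h by (simp add: gns_rep_def L2_class_cong)
qed

lemma L2_class_restrict: "L2_class \<mu> (\<lambda>x\<in>K. f x) = L2_class \<mu> f"
  by (rule L2_class_cong_space) (simp add: space_\<mu>)

lemma gns_op: assumes f: "f \<in> cont_fun K" shows "gns_rep K \<mu> f \<in> bounded_ops (L2 \<mu>) (L2 \<mu>)"
proof -
  obtain B where B: "0 < B" "\<And>x. x \<in> K \<Longrightarrow> cmod (f x) \<le> B"
    by (rule bounded_on_compact[OF K cont_funD[OF f]]) blast
  note m = continuous_mult_sq_integrable[OF f]
  show ?thesis
  proof (rule hilbert_pair.bounded_opsI[OF L2.self_pair, where B = B])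
    fix X Y assume "X \<in> carrier (L2 \<mu>)" "Y \<in> carrier (L2 \<mu>)"
    then obtain g h where "g \<in> sq_integrable \<mu>" "X = L2_class \<mu> g" "h \<in> sq_integrable \<mu>" "Y = L2_class \<mu> h"
      by (meson L2_carrierE)
    thus "gns_rep K \<mu> f (X \<oplus>\<^bsub>L2 \<mu>\<^esub> Y) = gns_rep K \<mu> f X \<oplus>\<^bsub>L2 \<mu>\<^esub> gns_rep K \<mu> f Y"
      using f m by (simp add: gns_class distrib_left)
  next
    fix X c assume "X \<in> carrier (L2 \<mu>)"
    then obtain h where h: "h \<in> sq_integrable \<mu>" "X = L2_class \<mu> h" by (rule L2_carrierE)
    show "gns_rep K \<mu> f X \<in> carrier (L2 \<mu>)" using f h m by (simp add: gns_class)
    show "gns_rep K \<mu> f (c \<odot>\<^bsub>L2 \<mu>\<^esub> X) = c \<odot>\<^bsub>L2 \<mu>\<^esub> gns_rep K \<mu> f X"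
      using f h m by (simp add: gns_class mult.left_commute)
    have "(LINT x|\<mu>. (cmod (f x * h x))\<^sup>2) \<le> (LINT x|\<mu>. B\<^sup>2 * (cmod (h x))\<^sup>2)"
    proof (rule integral_mono)
      fix x assume "x \<in> space \<mu>"
      hence "(cmod (f x))\<^sup>2 \<le> B\<^sup>2" using B(2) by (intro power_mono) (auto simp: space_\<mu>)
      thus "(cmod (f x * h x))\<^sup>2 \<le> B\<^sup>2 * (cmod (h x))\<^sup>2" by (simp add: norm_mult power_mult_distrib mult_right_mono)
    qed (use m[OF h(1)] h(1) in simp_all)
    hence "sqrt (LINT x|\<mu>. (cmod (f x * h x))\<^sup>2) \<le> sqrt (B\<^sup>2 * (LINT x|\<mu>. (cmod (h x))\<^sup>2))" by simp
    also have "\<dots> = B * sqrt (LINT x|\<mu>. (cmod (h x))\<^sup>2)" using B(1) by (simp add: real_sqrt_mult)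
    finally show "L2.si.nm (gns_rep K \<mu> f X) \<le> B * L2.si.nm X"
      using f h m[OF h(1)] by (simp add: gns_class L2_nm_class)
  qed (use f in \<open>simp add: gns_rep_def\<close>)
qed

text \<open>All operations on classes are operations on representatives, hence the algebraic laws of
  pointwise multiplication carry over.\<close>

theorem gns_star_rep: "star_rep K (L2 \<mu>) (gns_rep K \<mu>)"
proof -
  interpret p: hilbert_pair "L2 \<mu>" "L2 \<mu>" by (rule L2.self_pair)
  note m = continuous_mult_sq_integrable
  have ext: "F \<in> extensional (carrier (L2 \<mu>)) \<Longrightarrow> G \<in> extensional (carrier (L2 \<mu>)) \<Longrightarrow>
    (\<And>h. h \<in> sq_integrable \<mu> \<Longrightarrow> F (L2_class \<mu> h) = G (L2_class \<mu> h)) \<Longrightarrow> F = G" for F G :: "_ \<Rightarrow> ('a \<Rightarrow> complex) set"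
    by (rule extensionalityI[of F "carrier (L2 \<mu>)" G]) (auto elim: L2_carrierE)
  have gext: "gns_rep K \<mu> f \<in> extensional (carrier (L2 \<mu>))" if "f \<in> cont_fun K" for f
    using that by (simp add: gns_rep_def)
  have res: "L2_class \<mu> (\<lambda>x. cscale K c f x * h x) = L2_class \<mu> (\<lambda>x. c * (f x * h x))"
    "L2_class \<mu> (\<lambda>x. cadd K f g x * h x) = L2_class \<mu> (\<lambda>x. f x * h x + g x * h x)"
    "L2_class \<mu> (\<lambda>x. cmul K f g x * h x) = L2_class \<mu> (\<lambda>x. f x * (g x * h x))" for f g h c
    by (rule L2_class_cong_space; simp add: space_\<mu> algebra_simps)+
  show ?thesis
    unfolding star_rep_def linear_op_map_def cadd_def[symmetric] cscale_def[symmetric]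
      cmul_def[symmetric] ccnj_def[symmetric]
  proof (intro conjI ballI allI)
    show "gns_rep K \<mu> \<in> cont_fun K \<rightarrow> bounded_ops (L2 \<mu>) (L2 \<mu>)" using gns_op by blast
    fix f assume f: "f \<in> cont_fun K"
    show "gns_rep K \<mu> (cscale K c f) = (\<lambda>h\<in>carrier (L2 \<mu>). c \<odot>\<^bsub>L2 \<mu>\<^esub> gns_rep K \<mu> f h)" for c
      by (rule ext) (use f m[OF f] in \<open>simp_all add: gext gns_class res compose_eq\<close>)
    show "gns_rep K \<mu> (ccnj K f) = hadjoint (L2 \<mu>) (L2 \<mu>) (gns_rep K \<mu> f)"
    proof (rule p.hadjoint_eqI[symmetric])
      show "gns_rep K \<mu> (ccnj K f) \<in> bounded_ops (L2 \<mu>) (L2 \<mu>)" using f by (intro gns_op) simp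
      fix X Y assume "X \<in> carrier (L2 \<mu>)" "Y \<in> carrier (L2 \<mu>)"
      then obtain g h where g: "g \<in> sq_integrable \<mu>" "X = L2_class \<mu> g" and h: "h \<in> sq_integrable \<mu>" "Y = L2_class \<mu> h"
        by (meson L2_carrierE)
      have cf: "ccnj K f \<in> cont_fun K" using f by simp
      have "(LINT x|\<mu>. f x * g x * cnj (h x)) = (LINT x|\<mu>. g x * cnj (ccnj K f x * h x))"
        by (rule Bochner_Integration.integral_cong) (simp_all add: space_\<mu>)
      thus "cinner (L2 \<mu>) (gns_rep K \<mu> f X) Y = cinner (L2 \<mu>) X (gns_rep K \<mu> (ccnj K f) Y)"
        using f g h m[OF f g(1)] m[OF cf h(1)] by (simp only: gns_class[OF f] gns_class[OF cf] L2_cinner_class)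
    qed
    fix g assume g: "g \<in> cont_fun K"
    show "gns_rep K \<mu> (cadd K f g) = (\<lambda>h\<in>carrier (L2 \<mu>). gns_rep K \<mu> f h \<oplus>\<^bsub>L2 \<mu>\<^esub> gns_rep K \<mu> g h)"
      by (rule ext) (use f g m[OF f] m[OF g] in \<open>simp_all add: gext gns_class res compose_eq\<close>)
    show "gns_rep K \<mu> (cmul K f g) = compose (carrier (L2 \<mu>)) (gns_rep K \<mu> f) (gns_rep K \<mu> g)"
      by (rule ext) (use f g m[OF f] m[OF g] in \<open>simp_all add: gext gns_class res compose_eq\<close>)
  qed
qed

sublocale gns: representation "L2 \<mu>" K "gns_rep K \<mu>"
  by unfold_locales (rule gns_star_rep)

lemma gns_completely_positive: "completely_positive K (L2 \<mu>) (gns_rep K \<mu>)"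
  by (rule gns.rep_completely_positive) (simp add: gns_rep_def)

lemma gns_mult:
  assumes "f \<in> cont_fun K" "g \<in> cont_fun K"
  shows "gns_rep K \<mu> f (L2_class \<mu> g) = L2_class \<mu> (cmul K f g)"
  using assms by (simp add: gns_class cmul_def L2_class_restrict)

lemma measure_rep_gns: "measure_rep K \<mu> (L2 \<mu>) (gns_rep K \<mu>) (L2_class \<mu> (cunit K))"
  unfolding measure_rep_def
proof (intro conjI ballI)
  fix f assume f: "f \<in> cont_fun K"
  have c: "cmul K f (cunit K) \<in> cont_fun K" using f by simp
  have "(LINT x|\<mu>. f x) = (LINT x|\<mu>. cmul K f (cunit K) x * cnj (cunit K x))"
    by (rule Bochner_Integration.integral_cong) (simp_all add: space_\<mu>)
  thus "(LINT x|\<mu>. f x) = cinner (L2 \<mu>) (gns_rep K \<mu> f (L2_class \<mu> (cunit K))) (L2_class \<mu> (cunit K))"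
    using f c by (simp only: gns_mult cont_fun_ops L2_cinner_class cont_fun_sq_integrable)
qed (use gns_star_rep L2.complex_hilbert_space_axioms in auto)

end


section \<open>Unique extension implies maximality\<close>

lemma measure_repD:
  assumes "measure_rep K \<mu> H \<pi> \<xi>"
  shows "complex_hilbert_space H" "star_rep K H \<pi>" "\<xi> \<in> carrier H"
    and "f \<in> cont_fun K \<Longrightarrow> (LINT x|\<mu>. f x) = cinner H (\<pi> f \<xi>) \<xi>"
  using assms by (auto simp: measure_rep_def)

lemma cont_affine_cont_fun: "a \<in> cont_affine K \<Longrightarrow> a \<in> cont_fun K"
  by (simp add: cont_affine_def)

lemma cunit_affine: "convex K \<Longrightarrow> cunit K \<in> cont_affine K"
proof -
  assume K: "convex K"
  have "(1 - t) *\<^sub>R x + t *\<^sub>R y \<in> K" if "x \<in> K" "y \<in> K" "t \<in> {0..1}" for x y t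
    using that K by (intro convexD) auto
  thus ?thesis by (auto simp: cont_affine_def scaleR_left_diff_distrib algebra_simps)
qed

lemma pos_measure_eq_if_complex:
  fixes K :: "'a::t2_space set"
  assumes K: "compact K" and \<mu>: "\<mu> \<in> pos_measures K" and \<nu>: "\<nu> \<in> pos_measures K"
    and eq: "\<And>f. f \<in> cont_fun K \<Longrightarrow> (LINT x|\<mu>. f x) = (LINT x|\<nu>. f x)"
  shows "\<mu> = \<nu>"
proof (rule pos_measure_eqI[OF K \<mu> \<nu>])
  fix f :: "'a \<Rightarrow> real" assume f: "continuous_on K f"
  let ?g = "\<lambda>x\<in>K. complex_of_real (f x)"
  have g: "?g \<in> cont_fun K" using f by (intro cont_fun_restrict continuous_on_of_real)
  have "(LINT x|M. ?g x) = complex_of_real (LINT x|M. f x)" if "M \<in> pos_measures K" for M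
  proof -
    have "(LINT x|M. ?g x) = (LINT x|M. complex_of_real (f x))"
      by (rule Bochner_Integration.integral_cong) (simp_all add: pos_measuresD(3)[OF that])
    thus ?thesis by simp
  qed
  hence "complex_of_real (LINT x|\<mu>. f x) = complex_of_real (LINT x|\<nu>. f x)"
    using eq[OF g] \<mu> \<nu> by metis
  thus "(LINT x|\<mu>. f x) = (LINT x|\<nu>. f x)" by simp
qed

text \<open>The isometry \<open>W\<close> embeds \<open>L\<^sup>2(\<mu>)\<close> as the cyclic subspace generated by \<open>\<xi>\<close>, so compressing
  \<open>\<sigma>\<close> along \<open>V W\<close> extends the restriction of the GNS representation to affine functions.
  Representations need not be unital; the identity \<open>\<sigma>(1) V \<xi> = V \<pi>(1) \<xi>\<close> makes up for it.\<close>

theorem maximal_if_unique_extension: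
  fixes K :: "'a::locally_convex_space set"
    and H :: "('h, 'm) inner_module_scheme" and L :: "('l, 'n) inner_module_scheme"
  assumes cK: "compact K" "convex K" and \<mu>: "\<mu> \<in> pos_measures K" and \<nu>: "\<nu> \<in> pos_measures K"
    and uep: "unique_extension_property K (L2 \<mu>) (gns_rep K \<mu>)"
    and H: "measure_rep K \<mu> H \<pi> \<xi>" and L: "measure_rep K \<nu> L \<sigma> \<eta>" and dil: "dilated_by K H \<pi> \<xi> L \<sigma> \<eta>"
  shows "\<nu> = \<mu>"
proof -
  interpret regular_measure K \<mu> by unfold_locales (fact cK(1), fact \<mu>)
  interpret H: representation H K \<pi>
    by (rule representation.intro[OF measure_repD(1)[OF H] representation_axioms.intro[OF measure_repD(2)[OF H]]])
  interpret L: representation L K \<sigma>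
    by (rule representation.intro[OF measure_repD(1)[OF L] representation_axioms.intro[OF measure_repD(2)[OF L]]])
  interpret HL: hilbert_pair H L ..
  interpret MH: hilbert_pair "L2 \<mu>" H ..
  interpret GL: hilbert_pair "L2 \<mu>" L ..
  note xi = measure_repD(3)[OF H]
  obtain V where V: "V \<in> isometries H L" "\<eta> = V \<xi>"
    and Va: "\<And>a. a \<in> cont_affine K \<Longrightarrow>
      \<pi> a = compose (carrier H) (hadjoint H L V) (compose (carrier H) (\<sigma> a) V)"
    using dil unfolding dilated_by_def by blast
  have VB: "V \<in> bounded_ops H L" using V(1) by (simp add: isometries_def)
  note Vc = bounded_opsD(1)[OF VB]
  have Vaff: "cinner L (\<sigma> a (V x)) (V y) = cinner H (\<pi> a x) y"
    if "a \<in> cont_affine K" "x \<in> carrier H" "y \<in> carrier H" for a x y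
    using that HL.hadjoint(3)[OF VB, of y "\<sigma> a (V x)"] Vc cont_affine_cont_fun[OF that(1)]
    by (simp add: Va compose_eq)
  have gram: "cinner H (\<pi> f \<xi>) (\<pi> g \<xi>) = cinner (L2 \<mu>) (L2_class \<mu> f) (L2_class \<mu> g)"
    if f: "f \<in> cont_fun K" and g: "g \<in> cont_fun K" for f g
  proof -
    have "cinner H (\<pi> f \<xi>) (\<pi> g \<xi>) = (LINT x|\<mu>. cmul K (ccnj K g) f x)"
      using f g xi by (simp add: H.rep_mult_cinner measure_repD(4)[OF H])
    also have "\<dots> = (LINT x|\<mu>. f x * cnj (g x))"
      by (rule Bochner_Integration.integral_cong) (simp_all add: space_\<mu>)
    finally show ?thesis using f g by simp
  qed
  obtain W where W: "W \<in> isometries (L2 \<mu>) H" "\<And>f. f \<in> cont_fun K \<Longrightarrow> W (L2_class \<mu> f) = \<pi> f \<xi>"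
    by (rule MH.isometry_extending_Gram[OF continuous_dense_in_L2, of "\<lambda>f. \<pi> f \<xi>"])
      (use gram xi in auto)
  have WB: "W \<in> bounded_ops (L2 \<mu>) H" using W(1) by (simp add: isometries_def)
  define T where "T = compose (carrier (L2 \<mu>)) V W"
  have TB: "T \<in> bounded_ops (L2 \<mu>) L"
    unfolding T_def by (intro bounded_ops_compose[of _ H] L2.complex_hilbert_space_axioms
        H.complex_hilbert_space_axioms L.complex_hilbert_space_axioms WB VB)
  have T: "T (L2_class \<mu> f) = V (\<pi> f \<xi>)" if "f \<in> cont_fun K" for f
    using that by (simp add: T_def compose_eq W(2))
  interpret c: compressed_representation "L2 \<mu>" L K \<sigma> T
    by unfold_locales (rule TB)
  let ?\<Phi> = "compression K (L2 \<mu>) L \<sigma> T"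
  have aff: "?\<Phi> a = gns_rep K \<mu> a" if a: "a \<in> cont_affine K" for a
  proof (rule L2.bounded_ops_eq_if_cinner_dense[OF _ _ continuous_dense_in_L2])
    have ac: "a \<in> cont_fun K" by (rule cont_affine_cont_fun[OF a])
    show "?\<Phi> a \<in> bounded_ops (L2 \<mu>) (L2 \<mu>)" by (rule c.compression_op[OF ac])
    show "gns_rep K \<mu> a \<in> bounded_ops (L2 \<mu>) (L2 \<mu>)" by (rule gns_op[OF ac])
    fix f g assume f: "f \<in> cont_fun K" and g: "g \<in> cont_fun K"
    have af: "cmul K a f \<in> cont_fun K" using ac f by simp
    have "cinner (L2 \<mu>) (?\<Phi> a (L2_class \<mu> f)) (L2_class \<mu> g) = cinner L (\<sigma> a (V (\<pi> f \<xi>))) (V (\<pi> g \<xi>))"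
      using f g ac by (simp add: c.cinner_compression T)
    also have "\<dots> = cinner H (\<pi> (cmul K a f) \<xi>) (\<pi> g \<xi>)"
      using a ac f g xi by (simp add: Vaff H.rep_mult)
    also have "\<dots> = cinner (L2 \<mu>) (gns_rep K \<mu> a (L2_class \<mu> f)) (L2_class \<mu> g)"
      using gram[OF af g] gns_mult[OF ac f] by simp
    finally show "cinner (L2 \<mu>) (?\<Phi> a (L2_class \<mu> f)) (L2_class \<mu> g)
      = cinner (L2 \<mu>) (gns_rep K \<mu> a (L2_class \<mu> f)) (L2_class \<mu> g)" .
  qed
  have ext: "?\<Phi> \<in> extensional (cont_fun K)" "gns_rep K \<mu> \<in> extensional (cont_fun K)"
    by (simp_all add: compression_def gns_rep_def)
  have eq: "?\<Phi> = gns_rep K \<mu>"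
    using uep aff ext c.compression_completely_positive gns_completely_positive
    unfolding unique_extension_property_def by blast
  define u where "u = \<pi> (cunit K) \<xi>"
  have u: "u \<in> carrier H" using xi by (simp add: u_def)
  have Vu: "\<sigma> (cunit K) (V \<xi>) = V u"
  proof (rule L.eq_if_cinner_self)
    have uu: "cinner H u u = cinner H u \<xi>"
      using xi by (simp add: u_def H.rep_mult_cinner)
    have "cinner L (\<sigma> (cunit K) (V \<xi>)) (\<sigma> (cunit K) (V \<xi>)) = cinner L (\<sigma> (cunit K) (V \<xi>)) (V \<xi>)"
      using xi Vc by (simp add: L.rep_mult_cinner)
    also have "\<dots> = cinner H u \<xi>" using xi by (simp add: Vaff cunit_affine[OF cK(2)] u_def)
    finally have 1: "cinner L (\<sigma> (cunit K) (V \<xi>)) (\<sigma> (cunit K) (V \<xi>)) = cinner H u u" using uu by simp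
    have 2: "cinner L (\<sigma> (cunit K) (V \<xi>)) (V u) = cinner H u u"
      using xi u by (simp add: Vaff cunit_affine[OF cK(2)] flip: u_def)
    have 3: "cinner L (V u) (V u) = cinner H u u" by (rule HL.isometry_cinner[OF V(1) u u])
    show "Re (cinner L (\<sigma> (cunit K) (V \<xi>)) (\<sigma> (cunit K) (V \<xi>)))
      - 2 * Re (cinner L (\<sigma> (cunit K) (V \<xi>)) (V u)) + Re (cinner L (V u) (V u)) = 0"
      unfolding 1 2 3 by simp
  qed (use xi u Vc in auto)
  have "(LINT x|\<nu>. f x) = (LINT x|\<mu>. f x)" if f: "f \<in> cont_fun K" for f
  proof -
    have "(LINT x|\<nu>. f x) = cinner L (\<sigma> f (V \<xi>)) (V \<xi>)"
      using f V(2) by (simp add: measure_repD(4)[OF L])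
    also have "\<sigma> f (V \<xi>) = \<sigma> (cunit K) (\<sigma> f (\<sigma> (cunit K) (V \<xi>)))"
      using f xi Vc by (simp flip: L.rep_mult)
    also have "cinner L \<dots> (V \<xi>) = cinner L (\<sigma> f (V u)) (V u)"
      using f xi Vc by (subst L.rep_adjoint(1)) (simp_all add: Vu u)
    also have "\<dots> = cinner (L2 \<mu>) (?\<Phi> f (L2_class \<mu> (cunit K))) (L2_class \<mu> (cunit K))"
      using f by (simp add: c.cinner_compression T u_def)
    also have "\<dots> = (LINT x|\<mu>. f x)" unfolding eq using measure_repD(4)[OF measure_rep_gns f] by simp
    finally show ?thesis .
  qed
  thus "\<nu> = \<mu>" by (intro pos_measure_eq_if_complex[OF cK(1) \<nu> \<mu>])
qed


section \<open>Continuous affine functions generate the continuous functions\<close>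

subsection \<open>The Hahn--Banach theorem\<close>

definition sublinear :: "('a::real_vector \<Rightarrow> real) \<Rightarrow> bool" where
  "sublinear q \<longleftrightarrow> (\<forall>x y. q (x + y) \<le> q x + q y) \<and> (\<forall>t>0. \<forall>x. q (t *\<^sub>R x) = t * q x)"

lemma sublinearD:
  assumes "sublinear q"
  shows "q (x + y) \<le> q x + q y" "0 < t \<Longrightarrow> q (t *\<^sub>R x) = t * q x" "q 0 = 0" "- q (- x) \<le> q x"
proof -
  show a: "q (x + y) \<le> q x + q y" for x y using assms by (simp add: sublinear_def)
  show h: "0 < t \<Longrightarrow> q (t *\<^sub>R x) = t * q x" for t x using assms by (simp add: sublinear_def)
  show z: "q 0 = 0" using h[of 2 0] by simp
  show "- q (- x) \<le> q x" using a[of x "- x"] z by simp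
qed

lemma sublinearI:
  assumes "\<And>x y. q (x + y) \<le> q x + q y" "\<And>t x. 0 < t \<Longrightarrow> q (t *\<^sub>R x) \<le> t * q x"
  shows "sublinear q"
  unfolding sublinear_def
proof (intro conjI allI impI assms(1))
  fix t :: real and x assume t: "0 < t"
  have "t * q x = t * q (inverse t *\<^sub>R (t *\<^sub>R x))" using t by simp
  also have "\<dots> \<le> t * (inverse t * q (t *\<^sub>R x))" using t by (intro mult_left_mono assms(2)) auto
  also have "\<dots> = q (t *\<^sub>R x)" using t by simp
  finally show "q (t *\<^sub>R x) = t * q x" using assms(2)[OF t, of x] by simp
qed

text \<open>The largest sublinear functional \<open>r\<close> below \<open>q\<close> with \<open>r (- y) \<le> - q y\<close>; it is linear on the line
  through \<open>y\<close>.\<close>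

definition straighten :: "'a::real_vector \<Rightarrow> ('a \<Rightarrow> real) \<Rightarrow> 'a \<Rightarrow> real" where
  "straighten y q x = (INF t\<in>{0..}. q (x + t *\<^sub>R y) - t * q y)"

text \<open>The lower bound \<open>- q (- x)\<close> makes the infimum finite, and \<open>t = 0\<close> and \<open>t = 1\<close> give the two
  estimates.\<close>

lemma straighten:
  fixes q :: "'a::real_vector \<Rightarrow> real"
  assumes q: "sublinear q"
  shows "sublinear (straighten y q)" "straighten y q x \<le> q x" "straighten y q (- y) \<le> - q y"
proof -
  note Q = sublinearD[OF q]
  have hom: "q (t *\<^sub>R x) = t * q x" if "0 \<le> t" for t x
    using that Q(2)[of t x] Q(3) by (cases "t = 0") auto
  have lower: "- q (- x) \<le> q (x + t *\<^sub>R y) - t * q y" if "0 \<le> t" for t x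
    using Q(1)[of "x + t *\<^sub>R y" "- x"] hom[OF that, of y] by simp
  have le: "straighten y q x \<le> q (x + t *\<^sub>R y) - t * q y" if "0 \<le> t" for t x
    unfolding straighten_def using lower[of _ x] that by (intro cINF_lower) (auto simp: bdd_below_def)
  have ge: "c \<le> straighten y q x" if "\<And>t. 0 \<le> t \<Longrightarrow> c \<le> q (x + t *\<^sub>R y) - t * q y" for c x
    unfolding straighten_def using that by (intro cINF_greatest) auto
  show "straighten y q x \<le> q x" using le[of 0 x] by simp
  show "straighten y q (- y) \<le> - q y" using le[of 1 "- y"] Q(3) by simp
  show "sublinear (straighten y q)"
  proof (rule sublinearI)
    fix x1 x2
    have two: "straighten y q (x1 + x2) \<le> (q (x1 + s *\<^sub>R y) - s * q y) + (q (x2 + t *\<^sub>R y) - t * q y)"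
      if "0 \<le> s" "0 \<le> t" for s t
    proof -
      have "q (x1 + x2 + (s + t) *\<^sub>R y) \<le> q (x1 + s *\<^sub>R y) + q (x2 + t *\<^sub>R y)"
        using Q(1)[of "x1 + s *\<^sub>R y" "x2 + t *\<^sub>R y"] by (simp add: scaleR_add_left algebra_simps)
      thus ?thesis using le[of "s + t" "x1 + x2"] that by (simp add: algebra_simps)
    qed
    have "straighten y q (x1 + x2) - (q (x1 + s *\<^sub>R y) - s * q y) \<le> straighten y q x2" if "0 \<le> s" for s
      using two[OF that] by (intro ge) (simp add: algebra_simps)
    hence "straighten y q (x1 + x2) - straighten y q x2 \<le> straighten y q x1"
      by (intro ge) (simp add: algebra_simps)
    thus "straighten y q (x1 + x2) \<le> straighten y q x1 + straighten y q x2" by simp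
  next
    fix t :: real and x assume t: "0 < t"
    have "straighten y q (t *\<^sub>R x) / t \<le> straighten y q x"
    proof (rule ge)
      fix s :: real assume s: "0 \<le> s"
      have "straighten y q (t *\<^sub>R x) \<le> q (t *\<^sub>R x + (t * s) *\<^sub>R y) - t * s * q y" using s t by (intro le) auto
      also have "t *\<^sub>R x + (t * s) *\<^sub>R y = t *\<^sub>R (x + s *\<^sub>R y)" by (simp add: scaleR_add_right)
      also have "q \<dots> = t * q (x + s *\<^sub>R y)" by (rule Q(2)[OF t])
      finally have "straighten y q (t *\<^sub>R x) \<le> (q (x + s *\<^sub>R y) - s * q y) * t"
        by (simp add: algebra_simps)
      thus "straighten y q (t *\<^sub>R x) / t \<le> q (x + s *\<^sub>R y) - s * q y"
        by (simp only: pos_divide_le_eq[OF t])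
    qed
    thus "straighten y q (t *\<^sub>R x) \<le> t * straighten y q x" using t by (simp add: pos_divide_le_eq mult.commute)
  qed
qed

text \<open>A minimal sublinear functional coincides with all its straightenings and is therefore
  linear.\<close>

theorem Hahn_Banach:
  fixes p :: "'a::real_vector \<Rightarrow> real"
  assumes p: "sublinear p"
  obtains f where "linear f" "\<And>x. f x \<le> p x" "p z \<le> f z"
proof -
  define A where "A = {q. sublinear q \<and> (\<forall>x. q x \<le> straighten z p x)}"
  have sA: "straighten z p \<in> A" using straighten(1)[OF p] by (simp add: A_def)
  have bound: "- straighten z p (- x) \<le> q x" if "q \<in> A" for q x
  proof -
    have "- q (- x) \<le> q x" "q (- x) \<le> straighten z p (- x)"
      using that sublinearD(4)[of q x] by (auto simp: A_def)
    thus ?thesis by linarith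
  qed
  have "\<exists>m\<in>A. \<forall>a\<in>A. a \<le> m \<longrightarrow> a = m"
  proof (rule predicate_Zorn[of A "\<lambda>q r. r \<le> q"])
    show "partial_order_on A (relation_of (\<lambda>q r. r \<le> q) A)"
      by (rule partial_order_on_relation_ofI) auto
    fix C assume C: "C \<in> Chains (relation_of (\<lambda>q r. r \<le> q) A)"
    have CA: "C \<subseteq> A" and ch: "\<And>q r. q \<in> C \<Longrightarrow> r \<in> C \<Longrightarrow> q \<le> r \<or> r \<le> q"
      using C by (auto simp: Chains_def relation_of_def)
    show "\<exists>u\<in>A. \<forall>a\<in>C. u \<le> a"
    proof (cases "C = {}")
      case True thus ?thesis using sA by blast
    next
      case ne: False
      define u where "u x = (INF q\<in>C. q x)" for x
      have le: "u x \<le> q x" if "q \<in> C" for q x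
        unfolding u_def using that bound CA by (intro cINF_lower) (auto simp: bdd_below_def)
      have ge: "c \<le> u x" if "\<And>q. q \<in> C \<Longrightarrow> c \<le> q x" for c x
        unfolding u_def using ne that by (rule cINF_greatest)
      have "sublinear u"
      proof (rule sublinearI)
        fix x y
        have two: "u (x + y) \<le> q x + r y" if qr: "q \<in> C" "r \<in> C" for q r
        proof -
          obtain s where s: "s \<in> C" "s x \<le> q x" "s y \<le> r y"
            using ch[OF qr] qr by (auto simp: le_fun_def)
          have "sublinear s" using s(1) CA by (auto simp: A_def)
          thus ?thesis using le[OF s(1), of "x + y"] sublinearD(1)[of s x y] s by linarith
        qed
        have "u (x + y) - q x \<le> u y" if "q \<in> C" for q using two[OF that] by (intro ge) (simp add: algebra_simps)
        hence "u (x + y) - u y \<le> u x" by (intro ge) (simp add: algebra_simps)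
        thus "u (x + y) \<le> u x + u y" by simp
      next
        fix t :: real and x assume t: "0 < t"
        have "u (t *\<^sub>R x) / t \<le> u x"
        proof (rule ge)
          fix q assume q: "q \<in> C"
          hence "q (t *\<^sub>R x) = t * q x" using CA t sublinearD(2)[of q t x] by (auto simp: A_def)
          thus "u (t *\<^sub>R x) / t \<le> q x" using le[OF q, of "t *\<^sub>R x"] t by (simp add: pos_divide_le_eq mult.commute)
        qed
        thus "u (t *\<^sub>R x) \<le> t * u x" using t by (simp add: pos_divide_le_eq mult.commute)
      qed
      moreover have "u x \<le> straighten z p x" for x
      proof -
        obtain q where "q \<in> C" using ne by blast
        hence "u x \<le> q x" "q x \<le> straighten z p x" using le CA by (auto simp: A_def)
        thus ?thesis by linarith
      qed
      ultimately have "u \<in> A" by (simp add: A_def)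
      thus ?thesis using le by (auto simp: le_fun_def)
    qed
  qed
  then obtain f where f: "f \<in> A" and min: "\<And>a. a \<in> A \<Longrightarrow> a \<le> f \<Longrightarrow> a = f" by blast
  have sf: "sublinear f" using f by (simp add: A_def)
  note F = sublinearD[OF sf]
  have neg: "f (- y) = - f y" for y
  proof -
    have "straighten y f x \<le> straighten z p x" for x
      using straighten(2)[OF sf, of y x] f by (auto simp: A_def intro: order_trans)
    hence "straighten y f \<in> A" using straighten(1)[OF sf] by (simp add: A_def)
    hence "straighten y f = f" using straighten(2)[OF sf] by (intro min) (auto simp: le_fun_def)
    hence "f (- y) \<le> - f y" using straighten(3)[OF sf, of y] by simp
    thus ?thesis using F(4)[of y] by linarith
  qed
  have "linear f"
  proof (rule linearI)
    fix x y
    show "f (x + y) = f x + f y"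
      using F(1)[of x y] F(1)[of "- x" "- y"] neg[of x] neg[of y] neg[of "x + y"] by simp
  next
    fix r x
    show "f (r *\<^sub>R x) = r *\<^sub>R f x"
    proof (cases "r \<ge> 0")
      case True thus ?thesis using F(2)[of r x] F(3) by (cases "r = 0") auto
    next
      case False
      hence "f ((- r) *\<^sub>R x) = (- r) * f x" by (intro F(2)) simp
      thus ?thesis using neg[of "r *\<^sub>R x"] by simp
    qed
  qed
  moreover have "f x \<le> p x" for x using f straighten(2)[OF p, of z x] by (auto simp: A_def intro: order_trans)
  moreover have "p z \<le> f z"
  proof -
    have "f (- z) \<le> straighten z p (- z)" using f by (simp add: A_def)
    thus ?thesis using neg[of z] straighten(3)[OF p, of z] by simp
  qed
  ultimately show ?thesis by (rule that)
qed

lemma tendsto_scaleR_lcs: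
  fixes g :: "'b \<Rightarrow> 'a::locally_convex_space"
  assumes "(f \<longlongrightarrow> c) F" "(g \<longlongrightarrow> a) F" shows "((\<lambda>x. f x *\<^sub>R g x) \<longlongrightarrow> c *\<^sub>R a) F"
proof -
  have "filterlim (\<lambda>x. (f x, g x)) (nhds c \<times>\<^sub>F nhds a) F" using assms by (rule filterlim_Pair)
  from filterlim_compose[OF tendsto_scaleR_Pair this] show ?thesis by simp
qed

text \<open>The functional is dominated by the Minkowski functional of a convex neighbourhood of \<open>0\<close>
  that does not contain the vector to be separated from \<open>0\<close>.\<close>

theorem continuous_linear_separates:
  fixes z :: "'a::locally_convex_space"
  assumes "z \<noteq> 0"
  obtains f :: "'a \<Rightarrow> real" where "linear f" "continuous_on UNIV f" "f z \<noteq> 0"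
proof -
  obtain U where U: "open U" "0 \<in> U" "z \<notin> U" using hausdorff[of 0 z] assms by fast
  obtain W where W: "open W" "convex W" "0 \<in> W" "W \<subseteq> U" using locally_convex_zero[OF U(1,2)] by blast
  define S where "S x = {t. 0 < t \<and> inverse t *\<^sub>R x \<in> W}" for x
  define p where "p x = Inf (S x)" for x
  have ne: "S x \<noteq> {}" for x
  proof -
    have "((\<lambda>t. inverse t *\<^sub>R x) \<longlongrightarrow> 0 *\<^sub>R x) at_top"
      by (intro tendsto_scaleR_lcs tendsto_inverse_0_at_top filterlim_ident tendsto_const)
    hence "\<forall>\<^sub>F t in at_top. inverse t *\<^sub>R x \<in> W" using W by (intro topological_tendstoD) auto
    hence "\<forall>\<^sub>F t in at_top. t \<in> S x"
      using eventually_gt_at_top[of "0::real"] by eventually_elim (simp add: S_def)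
    thus ?thesis using eventually_happens'[of at_top] by fastforce
  qed
  have bdd: "bdd_below (S x)" for x by (auto simp: S_def bdd_below_def intro: less_imp_le)
  have ple: "p x \<le> t" if "t \<in> S x" for x t unfolding p_def using that bdd by (rule cInf_lower)
  have pge: "c \<le> p x" if "\<And>t. t \<in> S x \<Longrightarrow> c \<le> t" for x c unfolding p_def using ne that by (rule cInf_greatest)
  have "sublinear p"
  proof (rule sublinearI)
    fix x y
    have two: "p (x + y) \<le> s + t" if "s \<in> S x" "t \<in> S y" for s t
    proof (rule ple)
      have st: "0 < s" "0 < t" "inverse s *\<^sub>R x \<in> W" "inverse t *\<^sub>R y \<in> W" using that by (auto simp: S_def)
      have "(s / (s + t)) *\<^sub>R (inverse s *\<^sub>R x) + (t / (s + t)) *\<^sub>R (inverse t *\<^sub>R y) \<in> W"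
        using st by (intro convexD[OF W(2)]) (auto simp flip: add_divide_distrib)
      also have "(s / (s + t)) *\<^sub>R (inverse s *\<^sub>R x) + (t / (s + t)) *\<^sub>R (inverse t *\<^sub>R y) = inverse (s + t) *\<^sub>R (x + y)"
      proof -
        have "s / (s + t) * inverse s = inverse (s + t)" "t / (s + t) * inverse t = inverse (s + t)"
          using st by (simp_all add: divide_inverse)
        thus ?thesis by (simp only: scaleR_scaleR scaleR_add_right)
      qed
      finally show "s + t \<in> S (x + y)" using st by (simp add: S_def)
    qed
    have "p (x + y) - s \<le> p y" if "s \<in> S x" for s using two[OF that] by (intro pge) (simp add: algebra_simps)
    hence "p (x + y) - p y \<le> p x" by (intro pge) (simp add: algebra_simps)
    thus "p (x + y) \<le> p x + p y" by simp
  next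
    fix t :: real and x assume t: "0 < t"
    have "p (t *\<^sub>R x) / t \<le> p x"
    proof (rule pge)
      fix s assume s: "s \<in> S x"
      have "inverse (t * s) * t = inverse s" using t by (simp add: inverse_mult_distrib)
      hence "inverse (t * s) *\<^sub>R (t *\<^sub>R x) = inverse s *\<^sub>R x" by (simp only: scaleR_scaleR)
      hence "t * s \<in> S (t *\<^sub>R x)" using s t by (simp only: S_def mem_Collect_eq) simp
      from ple[OF this] show "p (t *\<^sub>R x) / t \<le> s" using t by (simp add: pos_divide_le_eq mult.commute)
    qed
    thus "p (t *\<^sub>R x) \<le> t * p x" using t by (simp add: pos_divide_le_eq mult.commute)
  qed
  then obtain f where f: "linear f" "\<And>x. f x \<le> p x" "p z \<le> f z" by (rule Hahn_Banach[of p z]) blast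
  have "1 \<le> p z"
  proof (rule pge)
    fix t assume t: "t \<in> S z"
    show "1 \<le> t"
    proof (rule ccontr)
      assume "\<not> 1 \<le> t"
      hence "t *\<^sub>R (inverse t *\<^sub>R z) + (1 - t) *\<^sub>R 0 \<in> W" using t W by (intro convexD[OF W(2)]) (auto simp: S_def)
      hence "z \<in> W" using t by (simp add: S_def)
      thus False using U W by blast
    qed
  qed
  hence nz: "f z \<noteq> 0" using f(3) by linarith
  have small: "f x \<le> e" if "inverse e *\<^sub>R x \<in> W" "0 < e" for x e
    using f(2)[of x] ple[of e x] that by (simp add: S_def)
  have "continuous_on UNIV f"
    unfolding continuous_on_def
  proof
    fix x0
    show "(f \<longlongrightarrow> f x0) (at x0 within UNIV)"
    proof (rule tendstoI)
      fix e :: real assume e: "0 < e"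
      have "((\<lambda>x. inverse (e/2) *\<^sub>R (x - x0)) \<longlongrightarrow> inverse (e/2) *\<^sub>R (x0 - x0)) (at x0)"
        by (intro tendsto_scaleR_lcs tendsto_intros)
      hence 1: "\<forall>\<^sub>F x in at x0. inverse (e/2) *\<^sub>R (x - x0) \<in> W" using W(1,3) by (intro topological_tendstoD) auto
      have "((\<lambda>x. inverse (e/2) *\<^sub>R (x0 - x)) \<longlongrightarrow> inverse (e/2) *\<^sub>R (x0 - x0)) (at x0)"
        by (intro tendsto_scaleR_lcs tendsto_intros)
      hence 2: "\<forall>\<^sub>F x in at x0. inverse (e/2) *\<^sub>R (x0 - x) \<in> W" using W(1,3) by (intro topological_tendstoD) auto
      show "\<forall>\<^sub>F x in at x0. dist (f x) (f x0) < e"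
        using 1 2
      proof eventually_elim
        case (elim x)
        have "f x - f x0 \<le> e/2" "f x0 - f x \<le> e/2"
          using small[OF elim(1)] small[OF elim(2)] e by (simp_all add: linear_diff[OF f(1)])
        thus ?case using e by (simp add: dist_real_def abs_if)
      qed
    qed
  qed
  thus ?thesis using f(1) nz that by blast
qed

subsection \<open>The Stone--Weierstrass theorem for modules over the affine functions\<close>

lemma real_affine_in_cont_affine:
  fixes K :: "'a::locally_convex_space set"
  assumes K: "convex K" and f: "linear f" "continuous_on UNIV f"
  shows "(\<lambda>x\<in>K. complex_of_real (f x)) \<in> cont_affine K"
proof -
  have "continuous_on K f" using f(2) continuous_on_subset by blast
  hence "(\<lambda>x\<in>K. complex_of_real (f x)) \<in> cont_fun K" by (intro cont_fun_restrict continuous_on_of_real)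
  moreover have "(1 - t) *\<^sub>R x + t *\<^sub>R y \<in> K" if "x \<in> K" "y \<in> K" "t \<in> {0..1}" for x y t
    using that K by (intro convexD) auto
  ultimately show ?thesis
    by (auto simp: cont_affine_def linear_add[OF f(1)] linear_cmul[OF f(1)] scaleR_conv_of_real)
qed

text \<open>The Stone--Weierstrass theorem applies to the algebra of real functions that act on \<open>M\<close> by
  multiplication.  It contains the real affine functions, and its elements lie in \<open>M\<close> because they
  are their own products with \<open>1\<close>.\<close>

theorem cont_fun_if_affine_module:
  fixes K :: "'a::locally_convex_space set"
  assumes K: "compact K" "convex K" and M: "M \<subseteq> cont_fun K" "cunit K \<in> M"
    and Madd: "\<And>f g. f \<in> M \<Longrightarrow> g \<in> M \<Longrightarrow> cadd K f g \<in> M"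
    and Mscale: "\<And>c f. f \<in> M \<Longrightarrow> cscale K c f \<in> M"
    and Mmult: "\<And>a f. a \<in> cont_affine K \<Longrightarrow> f \<in> M \<Longrightarrow> cmul K a f \<in> M"
    and Mclosed: "\<And>f. f \<in> cont_fun K \<Longrightarrow> (\<And>e. 0 < e \<Longrightarrow> \<exists>g\<in>M. \<forall>x\<in>K. cmod (f x - g x) < e) \<Longrightarrow> f \<in> M"
    and f: "f \<in> cont_fun K"
  shows "f \<in> M"
proof -
  let ?c = "\<lambda>r. \<lambda>x\<in>K. complex_of_real (r x)"
  define R where "R = {r. continuous_on K r \<and> (\<forall>q\<in>M. cmul K (?c r) q \<in> M)}"
  interpret function_ring_on R K
  proof
    show "compact K" by (rule K(1))
    show "continuous_on K r" if "r \<in> R" for r using that by (simp add: R_def)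
    fix r s assume r: "r \<in> R" and s: "s \<in> R"
    have "cmul K (?c (\<lambda>x. r x + s x)) q = cadd K (cmul K (?c r) q) (cmul K (?c s) q)" for q
      by (rule ext) (simp add: cfun_defs distrib_right)
    thus "(\<lambda>x. r x + s x) \<in> R" using r s Madd by (auto simp: R_def intro: continuous_intros)
    have "cmul K (?c (\<lambda>x. r x * s x)) q = cmul K (?c r) (cmul K (?c s) q)" for q
      by (rule ext) (simp add: cfun_defs)
    thus "(\<lambda>x. r x * s x) \<in> R" using r s by (auto simp: R_def intro: continuous_intros)
  next
    fix c
    have "cmul K (?c (\<lambda>_. c)) q = cscale K (complex_of_real c) q" for q
      by (rule ext) (simp add: cfun_defs)
    thus "(\<lambda>_. c) \<in> R" using Mscale by (simp add: R_def)
  next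
    fix x y :: 'a assume "x \<in> K" "y \<in> K" "x \<noteq> y"
    hence ne: "x - y \<noteq> 0" by simp
    obtain f :: "'a \<Rightarrow> real" where f: "linear f" "continuous_on UNIV f" "f (x - y) \<noteq> 0"
      by (rule continuous_linear_separates[OF ne]) blast
    have "f \<in> R"
      using Mmult[OF real_affine_in_cont_affine[OF K(2) f(1,2)]] continuous_on_subset[OF f(2)]
      by (simp add: R_def)
    thus "\<exists>f\<in>R. f x \<noteq> f y" using f(3) by (auto simp: linear_diff[OF f(1)])
  qed
  have real: "?c r \<in> M" if r: "continuous_on K r" for r
  proof (rule Mclosed)
    show "?c r \<in> cont_fun K" using r by (intro cont_fun_restrict continuous_on_of_real)
    fix e :: real assume "0 < e"
    then obtain s where s: "s \<in> R" "\<And>x. x \<in> K \<Longrightarrow> \<bar>r x - s x\<bar> < e" using Stone_Weierstrass_basic[OF r] by blast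
    have "cmul K (?c s) (cunit K) = ?c s" by (rule ext) (simp add: cfun_defs)
    hence "?c s \<in> M" using s(1) M(2) by (force simp: R_def)
    moreover have "cmod (?c r x - ?c s x) < e" if "x \<in> K" for x
      using s(2)[OF that] that by (simp flip: of_real_diff)
    ultimately show "\<exists>g\<in>M. \<forall>x\<in>K. cmod (?c r x - g x) < e" by blast
  qed
  have "cadd K (?c (\<lambda>x. Re (f x))) (cscale K \<i> (?c (\<lambda>x. Im (f x)))) \<in> M"
    using cont_funD[OF f] by (intro Madd Mscale real continuous_intros)
  also have "cadd K (?c (\<lambda>x. Re (f x))) (cscale K \<i> (?c (\<lambda>x. Im (f x)))) = f"
    using f by (intro cont_fun_eqI[of _ K] cont_fun_ops cont_fun_restrict continuous_intros)
      (auto dest: cont_funD simp: complex_eq_iff)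
  finally show ?thesis .
qed


section \<open>The Stinespring dilation\<close>

lemma (in positive_kernel) eq_if_cinner_vec:
  assumes "x \<in> carrier space" "y \<in> carrier space" "\<And>i. cinner space x (vec i) = cinner space y (vec i)"
  shows "x = y"
proof -
  have "dec x = dec y" using assms by (intro ext) (simp add: cinner_vec)
  thus ?thesis using assms(1,2) by (auto simp: space_simps)
qed

lemma (in positive_kernel) ops_eq_if_vec:
  assumes "complex_hilbert_space L" and T: "T \<in> bounded_ops space L" "T' \<in> bounded_ops space L"
    and eq: "\<And>i. T (vec i) = T' (vec i)"
  shows "T = T'"
proof -
  interpret sp: complex_hilbert_space space by (rule hilbert_space)
  interpret L: complex_hilbert_space L by fact
  interpret p: hilbert_pair space L ..
  have lin: "lin xs \<in> carrier space" for xs by (simp add: lin_def combination_rk_fun space_simps)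
  have "T (lin xs) = T' (lin xs)" for xs
  proof (induction xs)
    case Nil
    have "lin [] = 0 \<odot>\<^bsub>space\<^esub> vec undefined"
      by (simp add: lin_def vec_def combination_def space_simps)
    thus ?case using bounded_opsD(3)[OF T(1) vec_carrier] bounded_opsD(3)[OF T(2) vec_carrier] eq by metis
  next
    case (Cons y xs)
    obtain c i where y: "y = (c, i)" by force
    have "lin (y # xs) = c \<odot>\<^bsub>space\<^esub> vec i \<oplus>\<^bsub>space\<^esub> lin xs"
      by (simp add: lin_def vec_def combination_def y space_simps) (subst form_Cons_left, simp add: basic_def)
    thus ?case using Cons eq lin
      by (simp add: bounded_opsD(2)[OF T(1)] bounded_opsD(2)[OF T(2)] bounded_opsD(3)[OF T(1)]
          bounded_opsD(3)[OF T(2)])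
  qed
  thus ?thesis by (intro p.bounded_ops_eq_if_dense[OF T lin_dense])
qed

lemma (in complex_hilbert_space) cinner_smult_right:
  "x \<in> carrier H \<Longrightarrow> y \<in> carrier H \<Longrightarrow> cinner H x (c \<odot>\<^bsub>H\<^esub> y) = cnj c * cinner H x y"
  by (rule si.ip_scal_right)

lemma sum_list_double_sum:
  "(\<Sum>x\<leftarrow>xs. \<Sum>y\<leftarrow>ys. F x y) = (\<Sum>i<length xs. \<Sum>j<length ys. F (xs ! i) (ys ! j) :: 'b::comm_monoid_add)"
  by (simp add: sum_list_sum_nth atLeast0LessThan)

text \<open>The index \<open>(f, j)\<close> stands for the elementary tensor of \<open>f\<close> and the vector \<open>x j\<close>.  Indices
  range over all functions, so those outside \<open>C(K)\<close> are replaced by a default in \<open>C(K)\<close>.\<close>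

locale stinespring = complex_hilbert_space H
  for H :: "('h, 'm) inner_module_scheme" (structure) +
  fixes K :: "'a::topological_space set" and \<Phi> :: "('a \<Rightarrow> complex) \<Rightarrow> 'h \<Rightarrow> 'h"
    and x :: "'j \<Rightarrow> 'h" and enc :: "(('a \<Rightarrow> complex) \<times> 'j \<Rightarrow> complex) \<Rightarrow> 'l"
  assumes K: "compact K" and cp: "completely_positive K H \<Phi>"
    and x: "x j \<in> carrier H" and enc: "inj enc"
begin

lemma cp_linear: "linear_op_map K H \<Phi>" using cp by (simp add: completely_positive_def)

lemma cp_op: "f \<in> cont_fun K \<Longrightarrow> \<Phi> f \<in> bounded_ops H H"
  using cp_linear by (auto simp: linear_op_map_def)

lemma cp_closed [simp]: "f \<in> cont_fun K \<Longrightarrow> h \<in> carrier H \<Longrightarrow> \<Phi> f h \<in> carrier H"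
  using bounded_opsD(1)[OF cp_op] .

lemma cp_add:
  "f \<in> cont_fun K \<Longrightarrow> g \<in> cont_fun K \<Longrightarrow> h \<in> carrier H \<Longrightarrow> \<Phi> (cadd K f g) h = \<Phi> f h \<oplus> \<Phi> g h"
  using cp_linear by (simp add: linear_op_map_def cadd_def)

lemma cp_scale: "f \<in> cont_fun K \<Longrightarrow> h \<in> carrier H \<Longrightarrow> \<Phi> (cscale K c f) h = c \<odot>\<^bsub>H\<^esub> \<Phi> f h"
  using cp_linear by (simp add: linear_op_map_def cscale_def)

definition clamp :: "('a \<Rightarrow> complex) \<Rightarrow> 'a \<Rightarrow> complex" where
  "clamp f = (if f \<in> cont_fun K then f else cunit K)"

lemma clamp [simp]: "clamp f \<in> cont_fun K" "f \<in> cont_fun K \<Longrightarrow> clamp f = f"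
  by (simp_all add: clamp_def)

definition kern :: "('a \<Rightarrow> complex) \<times> 'j \<Rightarrow> ('a \<Rightarrow> complex) \<times> 'j \<Rightarrow> complex" where
  "kern p q = cinner H (\<Phi> (cmul K (ccnj K (clamp (fst q))) (clamp (fst p))) (x (snd p))) (x (snd q))"

text \<open>The matrix with entries \<open>cnj (f i) * f j\<close> is \<open>G\<^sup>*G\<close> for the matrix \<open>G\<close> whose first row is \<open>f\<close>
  and whose other rows vanish; complete positivity of \<open>\<Phi>\<close> for this matrix is positivity of the
  kernel.\<close>

lemma kern_sum_nonneg:
  "(\<Sum>(c, p)\<leftarrow>xs. \<Sum>(d, q)\<leftarrow>xs. c * cnj d * kern p q) \<in> \<real>\<^sub>\<ge>\<^sub>0"
proof -
  define n where "n = length xs"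
  define c where "c i = fst (xs ! i)" for i
  define f where "f i = clamp (fst (snd (xs ! i)))" for i
  define h where "h i = c i \<odot>\<^bsub>H\<^esub> x (snd (snd (xs ! i)))" for i
  define F where "F i j = cmul K (ccnj K (f i)) (f j)" for i j
  have fK: "f i \<in> cont_fun K" for i by (simp add: f_def)
  have h: "h i \<in> carrier H" for i by (simp add: h_def x)
  have "pos_cont_matrix K n F"
    unfolding pos_cont_matrix_def
  proof (intro exI[of _ "\<lambda>k i. if k = 0 then f i else cscale K 0 (cunit K)"] conjI allI impI)
    fix i j assume "i < n" "j < n"
    hence "n = Suc (n - 1)" by simp
    hence "(\<Sum>k<n. cnj ((if k = 0 then f i else cscale K 0 (cunit K)) t) * (if k = 0 then f j else cscale K 0 (cunit K)) t)
        = cnj (f i t) * f j t" if "t \<in> K" for t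
      using that by (subst \<open>n = Suc (n - 1)\<close>, subst sum.lessThan_Suc_shift) (simp add: sum.neutral)
    thus "F i j = (\<lambda>t\<in>K. \<Sum>k<n. cnj ((if k = 0 then f i else cscale K 0 (cunit K)) t)
        * (if k = 0 then f j else cscale K 0 (cunit K)) t)"
      by (auto simp: F_def cmul_def ccnj_def fun_eq_iff)
  qed (use fK in simp_all)
  hence "pos_op_matrix H n (\<lambda>i j. \<Phi> (F i j))" using cp by (simp add: completely_positive_def)
  hence pos: "(\<Sum>i<n. \<Sum>j<n. cinner H (\<Phi> (F i j) (h j)) (h i)) \<in> \<real>\<^sub>\<ge>\<^sub>0"
    using h unfolding pos_op_matrix_def by blast
  have FK: "F i j \<in> cont_fun K" for i j using fK by (simp add: F_def)
  have tm: "cinner H (\<Phi> (F i j) (h j)) (h i) = c j * cnj (c i) * kern (snd (xs ! j)) (snd (xs ! i))" for i j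
    unfolding h_def using x FK[of i j] bounded_opsD(3)[OF cp_op[OF FK]]
    by (simp add: cinner_smult_right kern_def F_def f_def)
  have "(\<Sum>(c, p)\<leftarrow>xs. \<Sum>(d, q)\<leftarrow>xs. c * cnj d * kern p q)
      = (\<Sum>j<n. \<Sum>i<n. c j * cnj (c i) * kern (snd (xs ! j)) (snd (xs ! i)))"
    by (simp add: case_prod_unfold sum_list_double_sum n_def c_def)
  also have "\<dots> = (\<Sum>i<n. \<Sum>j<n. cinner H (\<Phi> (F i j) (h j)) (h i))"
    unfolding tm by (rule sum.swap)
  finally show ?thesis using pos by simp
qed

text \<open>A sesquilinear form with real diagonal is Hermitian.\<close>

lemma kern_commute: "kern q p = cnj (kern p q)"
proof -
  have d: "Im (kern p p) = 0" for p
    using kern_sum_nonneg[of "[(1, p)]"] by (simp add: complex_nonneg_Reals_iff)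
  have "Im (kern p q + kern q p) = 0" "Im (- \<i> * kern p q + \<i> * kern q p) = 0"
    using kern_sum_nonneg[of "[(1, p), (1, q)]"] kern_sum_nonneg[of "[(1, p), (\<i>, q)]"] d[of p] d[of q]
    by (simp_all add: complex_nonneg_Reals_iff)
  thus ?thesis by (simp add: complex_eq_iff)
qed

sublocale kernel: positive_kernel kern enc
proof
  show "kern q p = cnj (kern p q)" for p q by (rule kern_commute)
  show "0 \<le> Re (\<Sum>(c, i)\<leftarrow>xs. \<Sum>(d, j)\<leftarrow>xs. c * cnj d * kern i j)" for xs
    using kern_sum_nonneg[of xs] unfolding complex_nonneg_Reals_iff by blast
qed (rule enc)

abbreviation "L \<equiv> kernel.space"

definition v :: "('a \<Rightarrow> complex) \<Rightarrow> 'j \<Rightarrow> 'l" where "v f j = kernel.vec (f, j)"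

sublocale L: complex_hilbert_space L by (rule kernel.hilbert_space)

lemma v_carrier [simp]: "v f j \<in> carrier L"
  unfolding v_def by (rule kernel.vec_carrier)

lemma cinner_v:
  "f \<in> cont_fun K \<Longrightarrow> g \<in> cont_fun K \<Longrightarrow>
    cinner L (v f i) (v g j) = cinner H (\<Phi> (cmul K (ccnj K g) f) (x i)) (x j)"
  unfolding v_def kernel.cinner_vec_vec by (simp add: kern_def)

lemma v_clamp: "v (clamp f) j = v f j"
  unfolding v_def by (rule kernel.eq_if_cinner_vec)
    (simp_all add: kernel.cinner_vec_vec kern_def)

text \<open>By the choice of the default, the elementary tensors over \<open>C(K)\<close> exhaust the basic vectors.\<close>

lemma eq_if_cinner_v:
  assumes "y \<in> carrier L" "z \<in> carrier L"
    and "\<And>f j. f \<in> cont_fun K \<Longrightarrow> cinner L y (v f j) = cinner L z (v f j)"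
  shows "y = z"
proof (rule kernel.eq_if_cinner_vec[OF assms(1,2)])
  fix p show "cinner L y (kernel.vec p) = cinner L z (kernel.vec p)"
    using assms(3)[of "clamp (fst p)" "snd p"] by (simp add: v_clamp) (simp add: v_def)
qed

lemma v_add:
  assumes f: "f \<in> cont_fun K" and g: "g \<in> cont_fun K"
  shows "v (cadd K f g) j = v f j \<oplus>\<^bsub>L\<^esub> v g j"
proof (rule eq_if_cinner_v)
  fix h i assume h: "h \<in> cont_fun K"
  have "cmul K (ccnj K h) (cadd K f g) = cadd K (cmul K (ccnj K h) f) (cmul K (ccnj K h) g)"
    by (rule ext) (simp add: cfun_defs distrib_left)
  thus "cinner L (v (cadd K f g) j) (v h i) = cinner L (v f j \<oplus>\<^bsub>L\<^esub> v g j) (v h i)"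
    using f g h x by (simp add: cinner_v cp_add)
qed simp_all

lemma v_scale:
  assumes f: "f \<in> cont_fun K" shows "v (cscale K c f) j = c \<odot>\<^bsub>L\<^esub> v f j"
proof (rule eq_if_cinner_v)
  fix h i assume h: "h \<in> cont_fun K"
  have "cmul K (ccnj K h) (cscale K c f) = cscale K c (cmul K (ccnj K h) f)"
    by (rule ext) (simp add: cfun_defs)
  thus "cinner L (v (cscale K c f) j) (v h i) = cinner L (c \<odot>\<^bsub>L\<^esub> v f j) (v h i)"
    using f h x by (simp add: cinner_v cp_scale)
qed simp_all

text \<open>The action of \<open>f\<close> on elementary tensors is multiplication in the first factor, and its adjoint
  is the action of the conjugate.  An operator on functions of indices is therefore given by
  precomposition with the action of the conjugate.\<close>

definition act :: "('a \<Rightarrow> complex) \<Rightarrow> ('a \<Rightarrow> complex) \<times> 'j \<Rightarrow> ('a \<Rightarrow> complex) \<times> 'j" where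
  "act f p = (cmul K f (clamp (fst p)), snd p)"

definition dil :: "('a \<Rightarrow> complex) \<Rightarrow> 'l \<Rightarrow> 'l" where
  "dil f = (\<lambda>y\<in>carrier L. enc (\<lambda>p. kernel.dec y (act (ccnj K f) p)))"

lemma act_adjoint: "f \<in> cont_fun K \<Longrightarrow> kern (act f p) q = kern p (act (ccnj K f) q)"
proof -
  assume f: "f \<in> cont_fun K"
  have "cmul K (ccnj K (clamp (fst q))) (cmul K f (clamp (fst p)))
      = cmul K (ccnj K (cmul K (ccnj K f) (clamp (fst q)))) (clamp (fst p))"
    by (rule ext) (simp add: cfun_defs)
  thus ?thesis using f by (simp add: kern_def act_def)
qed

text \<open>Boundedness of the multiplication by \<open>f\<close> is positivity of the kernel on the vectors
  multiplied by the square root of \<open>B\<^sup>2 - \<bar>f\<bar>\<^sup>2\<close>.\<close>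

lemma act_bounded:
  assumes f: "f \<in> cont_fun K" and B: "\<And>t. t \<in> K \<Longrightarrow> cmod (f t) \<le> B"
  shows "Re (kernel.form (map (apsnd (act f)) xs) (map (apsnd (act f)) xs)) \<le> B\<^sup>2 * Re (kernel.form xs xs)"
proof -
  define s where "s = (\<lambda>t\<in>K. complex_of_real (sqrt (B\<^sup>2 - (cmod (f t))\<^sup>2)))"
  have s: "s \<in> cont_fun K"
    unfolding s_def by (intro cont_fun_restrict continuous_intros cont_funD[OF f])
  have ss: "cnj (s t) * s t = complex_of_real (B\<^sup>2) - cnj (f t) * f t" if t: "t \<in> K" for t
  proof -
    have "(cmod (f t))\<^sup>2 \<le> B\<^sup>2" using B[OF t] by (intro power_mono) auto
    hence "cnj (s t) * s t = complex_of_real (B\<^sup>2 - (cmod (f t))\<^sup>2)"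
      using t by (simp add: s_def flip: of_real_mult)
    also have "\<dots> = complex_of_real (B\<^sup>2) - f t * cnj (f t)"
      using complex_norm_square[of "f t"] by (simp only: of_real_diff of_real_power)
    finally show ?thesis by (simp add: mult.commute)
  qed
  have kern_s: "kern (act s p) (act s q) = complex_of_real (B\<^sup>2) * kern p q - kern (act f p) (act f q)" for p q
  proof -
    let ?g = "clamp (fst q)" and ?h = "clamp (fst p)"
    have "cmul K (ccnj K (cmul K s ?g)) (cmul K s ?h)
        = cadd K (cscale K (complex_of_real (B\<^sup>2)) (cmul K (ccnj K ?g) ?h))
            (cscale K (-1) (cmul K (ccnj K (cmul K f ?g)) (cmul K f ?h)))"
    proof (rule cont_fun_eqI[of _ K])
      fix t assume t: "t \<in> K"
      have "cnj (s t * ?g t) * (s t * ?h t) = (cnj (s t) * s t) * (cnj (?g t) * ?h t)" by simp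
      also have "\<dots> = complex_of_real (B\<^sup>2) * (cnj (?g t) * ?h t) - cnj (f t * ?g t) * (f t * ?h t)"
        unfolding ss[OF t] by (simp add: algebra_simps)
      finally show "cmul K (ccnj K (cmul K s ?g)) (cmul K s ?h) t
        = cadd K (cscale K (complex_of_real (B\<^sup>2)) (cmul K (ccnj K ?g) ?h))
            (cscale K (-1) (cmul K (ccnj K (cmul K f ?g)) (cmul K f ?h))) t" using t by simp
    qed (use f s in simp_all)
    thus ?thesis using f s x by (simp add: kern_def act_def cp_add cp_scale)
  qed
  have form_act: "kernel.form (map (apsnd (act g)) xs) (map (apsnd (act g)) xs)
      = (\<Sum>(c, p)\<leftarrow>xs. \<Sum>(d, q)\<leftarrow>xs. c * cnj d * kern (act g p) (act g q))" for g
    by (simp add: kernel.form_def case_prod_unfold o_def)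
  have "kernel.form (map (apsnd (act s)) xs) (map (apsnd (act s)) xs)
      = complex_of_real (B\<^sup>2) * kernel.form xs xs - kernel.form (map (apsnd (act f)) xs) (map (apsnd (act f)) xs)"
    unfolding form_act kern_s
    by (simp add: kernel.form_def case_prod_unfold sum_list_double_sum sum_distrib_left sum_subtractf algebra_simps)
  moreover have "0 \<le> Re (kernel.form (map (apsnd (act s)) xs) (map (apsnd (act s)) xs))"
    by (rule kernel.pre.ip_nonneg) simp
  ultimately show ?thesis by simp
qed

lemma dil_op: assumes f: "f \<in> cont_fun K" shows "dil f \<in> bounded_ops L L"
proof -
  obtain B where B: "0 < B" "\<And>t. t \<in> K \<Longrightarrow> cmod (f t) \<le> B"
    by (rule bounded_on_compact[OF K cont_funD[OF f]]) blast
  show ?thesis unfolding dil_def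
    by (rule kernel.index_map_op[OF act_adjoint[OF f], of B]) (use B act_bounded[OF f] in auto)
qed

lemma dil_closed: "f \<in> cont_fun K \<Longrightarrow> y \<in> carrier L \<Longrightarrow> dil f y \<in> carrier L"
  by (rule bounded_opsD(1)[OF dil_op])

lemma dil_v:
  assumes "f \<in> cont_fun K" "g \<in> cont_fun K" shows "dil f (v g j) = v (cmul K f g) j"
  using kernel.index_map_op_vec[OF act_adjoint[OF assms(1)], of "(g, j)"] assms
  by (simp add: dil_def v_def act_def)

lemma cinner_dil_v:
  assumes "f \<in> cont_fun K" "g \<in> cont_fun K" "y \<in> carrier L"
  shows "cinner L (dil f y) (v g j) = cinner L y (v (cmul K (ccnj K f) g) j)"
  using assms kernel.cinner_vec[OF dil_closed[OF assms(1,3)], of "(g, j)"]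
    kernel.cinner_vec[OF assms(3), of "act (ccnj K f) (g, j)"]
  by (simp add: v_def act_def dil_def)

theorem dil_star_rep: "star_rep K L dil"
proof -
  interpret p: hilbert_pair L L by (rule L.self_pair)
  have ext: "F = (\<lambda>y\<in>carrier L. G y)" if "F \<in> bounded_ops L L" "\<And>y. y \<in> carrier L \<Longrightarrow> F y = G y" for F G
    by (rule extensionalityI[OF bounded_opsD(4)[OF that(1)]]) (use that(2) in auto)
  show ?thesis
    unfolding star_rep_def linear_op_map_def cadd_def[symmetric] cscale_def[symmetric]
      cmul_def[symmetric] ccnj_def[symmetric]
  proof (intro conjI ballI allI)
    show "dil \<in> cont_fun K \<rightarrow> bounded_ops L L" using dil_op by blast
    fix f assume f: "f \<in> cont_fun K"
    have cf: "ccnj K f \<in> cont_fun K" using f by simp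
    show "dil (cscale K c f) = (\<lambda>y\<in>carrier L. c \<odot>\<^bsub>L\<^esub> dil f y)" for c
    proof (rule ext[OF dil_op[OF cont_fun_ops(3)[OF f]]], rule eq_if_cinner_v)
      fix y g j assume y: "y \<in> carrier L" and g: "g \<in> cont_fun K"
      have "cmul K (ccnj K (cscale K c f)) g = cscale K (cnj c) (cmul K (ccnj K f) g)"
        by (rule HOL.ext) (simp add: cfun_defs)
      thus "cinner L (dil (cscale K c f) y) (v g j) = cinner L (c \<odot>\<^bsub>L\<^esub> dil f y) (v g j)"
        using f g y by (simp add: cinner_dil_v v_scale dil_closed L.cinner_smult_right L.cinner_smult_left)
    qed (use f dil_closed in simp_all)
    show "dil (ccnj K f) = hadjoint L L (dil f)"
    proof (rule kernel.ops_eq_if_vec[OF L.complex_hilbert_space_axioms dil_op[OF cf] p.hadjoint(1)[OF dil_op[OF f]]])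
      fix q
      have q: "kernel.vec q = v (clamp (fst q)) (snd q)" unfolding v_clamp by (simp add: v_def)
      show "dil (ccnj K f) (kernel.vec q) = hadjoint L L (dil f) (kernel.vec q)"
        unfolding q
      proof (rule eq_if_cinner_v)
        fix g j assume g: "g \<in> cont_fun K"
        have c: "ccnj K (ccnj K f) = f"
          using f by (intro cont_fun_eqI[of _ K]) auto
        have "cinner L (hadjoint L L (dil f) (v (clamp (fst q)) (snd q))) (v g j)
            = cinner L (v (clamp (fst q)) (snd q)) (dil f (v g j))"
          by (rule p.hadjoint(3)[OF dil_op[OF f] v_carrier v_carrier, symmetric])
        moreover have "cinner L (dil (ccnj K f) (v (clamp (fst q)) (snd q))) (v g j)
            = cinner L (v (clamp (fst q)) (snd q)) (v (cmul K f g) j)"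
          by (simp only: cinner_dil_v[OF cf g v_carrier] c)
        ultimately show "cinner L (dil (ccnj K f) (v (clamp (fst q)) (snd q))) (v g j)
          = cinner L (hadjoint L L (dil f) (v (clamp (fst q)) (snd q))) (v g j)"
          by (simp only: dil_v[OF f g])
      qed (use dil_closed[OF cf v_carrier] bounded_opsD(1)[OF p.hadjoint(1)[OF dil_op[OF f]] v_carrier] in blast)+
    qed
    fix g assume g: "g \<in> cont_fun K"
    show "dil (cadd K f g) = (\<lambda>y\<in>carrier L. dil f y \<oplus>\<^bsub>L\<^esub> dil g y)"
    proof (rule ext[OF dil_op[OF cont_fun_ops(2)[OF f g]]], rule eq_if_cinner_v)
      fix y h j assume y: "y \<in> carrier L" and h: "h \<in> cont_fun K"
      have "cmul K (ccnj K (cadd K f g)) h = cadd K (cmul K (ccnj K f) h) (cmul K (ccnj K g) h)"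
        by (rule HOL.ext) (simp add: cfun_defs distrib_right)
      thus "cinner L (dil (cadd K f g) y) (v h j) = cinner L (dil f y \<oplus>\<^bsub>L\<^esub> dil g y) (v h j)"
        using f g h y by (simp add: cinner_dil_v v_add dil_closed)
    qed (use f g dil_closed in simp_all)
    show "dil (cmul K f g) = compose (carrier L) (dil f) (dil g)"
      unfolding compose_def
    proof (rule ext[OF dil_op[OF cont_fun_ops(4)[OF f g]]], rule eq_if_cinner_v)
      fix y h j assume y: "y \<in> carrier L" and h: "h \<in> cont_fun K"
      have "cmul K (ccnj K (cmul K f g)) h = cmul K (ccnj K g) (cmul K (ccnj K f) h)"
        by (rule HOL.ext) (simp add: cfun_defs)
      thus "cinner L (dil (cmul K f g) y) (v h j) = cinner L (dil f (dil g y)) (v h j)"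
        using f g h y by (simp add: cinner_dil_v dil_closed)
    qed (use f g dil_closed in simp_all)
  qed
qed

sublocale D: representation L K dil
  by unfold_locales (rule dil_star_rep)

end


section \<open>Maximality implies unique extension\<close>

text \<open>A completely positive extension \<open>\<Phi>\<close> of the restriction of the GNS representation to affine
  functions, with its Stinespring dilation.  The vector \<open>S.v f g\<close> is the elementary tensor of \<open>f\<close>
  with the class of \<open>g\<close>.\<close>

locale affine_extension = regular_measure K \<mu>
  for K :: "'a::locally_convex_space set" and \<mu> :: "'a measure" +
  fixes \<Phi> :: "('a \<Rightarrow> complex) \<Rightarrow> ('a \<Rightarrow> complex) set \<Rightarrow> ('a \<Rightarrow> complex) set"
    and enc :: "(('a \<Rightarrow> complex) \<times> ('a \<Rightarrow> complex) \<Rightarrow> complex) \<Rightarrow> 'h"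
  assumes convex: "convex K" and cp: "completely_positive K (L2 \<mu>) \<Phi>"
    and affine: "a \<in> cont_affine K \<Longrightarrow> \<Phi> a = gns_rep K \<mu> a" and enc: "inj enc"
begin

definition base :: "('a \<Rightarrow> complex) \<Rightarrow> ('a \<Rightarrow> complex) set" where
  "base g = L2_class \<mu> (if g \<in> cont_fun K then g else cunit K)"

lemma base [simp]: "g \<in> cont_fun K \<Longrightarrow> base g = L2_class \<mu> g"
  by (simp add: base_def)

lemma base_carrier: "base g \<in> carrier (L2 \<mu>)"
  by (simp add: base_def)

sublocale S: stinespring "L2 \<mu>" K \<Phi> base enc
  by unfold_locales (fact K, fact cp, fact base_carrier, fact enc)

abbreviation "unit_fun \<equiv> cunit K"

lemma gram:
  assumes "f \<in> cont_fun K" "f' \<in> cont_fun K" "g \<in> cont_fun K" "g' \<in> cont_fun K"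
  shows "cinner S.L (S.v f g) (S.v f' g')
    = cinner (L2 \<mu>) (\<Phi> (cmul K (ccnj K f') f) (L2_class \<mu> g)) (L2_class \<mu> g')"
  using assms by (simp add: S.cinner_v)

lemma affine_base:
  assumes a: "a \<in> cont_affine K" and g: "g \<in> cont_fun K"
  shows "\<Phi> a (L2_class \<mu> g) = L2_class \<mu> (cmul K a g)"
  by (simp add: affine[OF a] gns_mult[OF cont_affine_cont_fun[OF a] g])

lemma gram_one:
  assumes "g \<in> cont_fun K" "h \<in> cont_fun K"
  shows "cinner S.L (S.v unit_fun g) (S.v unit_fun h) = cinner (L2 \<mu>) (L2_class \<mu> g) (L2_class \<mu> h)"
  using assms affine_base[OF cunit_affine[OF convex]] by (simp add: gram L2_cinner_class)

lemma L2_class_cadd: "f \<in> cont_fun K \<Longrightarrow> g \<in> cont_fun K \<Longrightarrow>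
    L2_class \<mu> (cadd K f g) = L2_class \<mu> f \<oplus>\<^bsub>L2 \<mu>\<^esub> L2_class \<mu> g"
  by (simp add: cadd_def L2_class_restrict)

lemma L2_class_cscale: "f \<in> cont_fun K \<Longrightarrow> L2_class \<mu> (cscale K c f) = c \<odot>\<^bsub>L2 \<mu>\<^esub> L2_class \<mu> f"
  by (simp add: cscale_def L2_class_restrict)

lemma v_add_right:
  assumes f: "f \<in> cont_fun K" and g: "g \<in> cont_fun K" "g' \<in> cont_fun K"
  shows "S.v f (cadd K g g') = S.v f g \<oplus>\<^bsub>S.L\<^esub> S.v f g'"
proof (rule S.eq_if_cinner_v)
  fix h j assume h: "h \<in> cont_fun K"
  have c: "cmul K (ccnj K h) f \<in> cont_fun K" using f h by simp
  have "\<Phi> (cmul K (ccnj K h) f) (base (cadd K g g'))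
      = \<Phi> (cmul K (ccnj K h) f) (base g) \<oplus>\<^bsub>L2 \<mu>\<^esub> \<Phi> (cmul K (ccnj K h) f) (base g')"
    using g bounded_opsD(2)[OF S.cp_op[OF c] base_carrier base_carrier, of g g'] L2_class_cadd[OF g] by simp
  thus "cinner S.L (S.v f (cadd K g g')) (S.v h j) = cinner S.L (S.v f g \<oplus>\<^bsub>S.L\<^esub> S.v f g') (S.v h j)"
    using f g h c base_carrier by (simp add: S.cinner_v S.L.cinner_add_left del: base)
qed simp_all

lemma v_scale_right:
  assumes f: "f \<in> cont_fun K" and g: "g \<in> cont_fun K"
  shows "S.v f (cscale K c g) = c \<odot>\<^bsub>S.L\<^esub> S.v f g"
proof (rule S.eq_if_cinner_v)
  fix h j assume h: "h \<in> cont_fun K"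
  have k: "cmul K (ccnj K h) f \<in> cont_fun K" using f h by simp
  have "\<Phi> (cmul K (ccnj K h) f) (base (cscale K c g)) = c \<odot>\<^bsub>L2 \<mu>\<^esub> \<Phi> (cmul K (ccnj K h) f) (base g)"
    using g bounded_opsD(3)[OF S.cp_op[OF k] base_carrier, of c g] L2_class_cscale[OF g, of c] by simp
  thus "cinner S.L (S.v f (cscale K c g)) (S.v h j) = cinner S.L (c \<odot>\<^bsub>S.L\<^esub> S.v f g) (S.v h j)"
    using f g h k base_carrier by (simp add: S.cinner_v S.L.cinner_smult_left del: base)
qed simp_all

definition func :: "('a \<Rightarrow> complex) \<Rightarrow> complex" where
  "func f = cinner (L2 \<mu>) (\<Phi> f (L2_class \<mu> unit_fun)) (L2_class \<mu> unit_fun)"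

lemma func_v: "f \<in> cont_fun K \<Longrightarrow> func f = cinner S.L (S.dil f (S.v unit_fun unit_fun)) (S.v unit_fun unit_fun)"
  by (simp add: func_def S.dil_v gram)

lemma func_add: "f \<in> cont_fun K \<Longrightarrow> g \<in> cont_fun K \<Longrightarrow> func (cadd K f g) = func f + func g"
  by (simp add: func_v S.D.rep_add S.dil_closed S.L.cinner_add_left)

lemma func_scale: "f \<in> cont_fun K \<Longrightarrow> func (cscale K c f) = c * func f"
  by (simp add: func_v S.D.rep_scale S.dil_closed S.L.cinner_smult_left)

lemma func_sq:
  assumes "f \<in> cont_fun K" shows "func (cmul K (ccnj K f) f) = cinner S.L (S.v f unit_fun) (S.v f unit_fun)"
  using assms by (simp add: func_def gram)

lemma func_cnj:
  assumes f: "f \<in> cont_fun K" shows "func (ccnj K f) = cnj (func f)"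
proof -
  have "func (ccnj K f) = cinner S.L (S.v unit_fun unit_fun) (S.v f unit_fun)"
    using f by (simp add: func_def gram)
  also have "\<dots> = cnj (cinner S.L (S.v f unit_fun) (S.v unit_fun unit_fun))"
    by (rule S.L.si.ip_commute) simp_all
  also have "\<dots> = cnj (func f)" using f by (simp add: func_def gram)
  finally show ?thesis .
qed

text \<open>A nonnegative function \<open>r\<close> is the square of \<open>sqrt r\<close>, so its value is the squared norm of
  \<open>sqrt r \<otimes> 1\<close>.  This positivity is what the Riesz--Markov theorem asks for.\<close>

theorem func_measure:
  obtains \<nu> where "\<nu> \<in> pos_measures K" "\<And>f. f \<in> cont_fun K \<Longrightarrow> (LINT x|\<nu>. f x) = func f"
proof -
  let ?c = "\<lambda>r. \<lambda>x\<in>K. complex_of_real (r x)"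
  have c: "?c r \<in> cont_fun K" if "continuous_on K r" for r
    using that by (intro cont_fun_restrict continuous_on_of_real)
  interpret R: positive_functional K "\<lambda>r. Re (func (?c r))"
  proof
    show "compact K" by (rule K)
    fix r s :: "'a \<Rightarrow> real" assume r: "continuous_on K r" and s: "continuous_on K s"
    have "?c (\<lambda>x. r x + s x) = cadd K (?c r) (?c s)" by (rule ext) (simp add: cfun_defs)
    thus "Re (func (?c (\<lambda>x. r x + s x))) = Re (func (?c r)) + Re (func (?c s))"
      using func_add[OF c[OF r] c[OF s]] by simp
  next
    fix a and r :: "'a \<Rightarrow> real" assume r: "continuous_on K r"
    have "?c (\<lambda>x. a * r x) = cscale K (complex_of_real a) (?c r)" by (rule ext) (simp add: cfun_defs)
    thus "Re (func (?c (\<lambda>x. a * r x))) = a * Re (func (?c r))"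
      using func_scale[OF c[OF r], of "complex_of_real a"] by simp
  next
    fix r :: "'a \<Rightarrow> real" assume r: "continuous_on K r" and nn: "\<And>x. x \<in> K \<Longrightarrow> 0 \<le> r x"
    let ?s = "?c (\<lambda>x. sqrt (r x))"
    have s: "?s \<in> cont_fun K" using r by (intro c continuous_intros)
    have "?c r = cmul K (ccnj K ?s) ?s"
      using nn by (intro ext) (simp add: cfun_defs flip: of_real_mult)
    thus "0 \<le> Re (func (?c r))" using func_sq[OF s] S.L.cinner_nonneg[OF S.v_carrier] by simp
  qed
  have "(LINT x|R.\<nu>. f x) = func f" if f: "f \<in> cont_fun K" for f
  proof -
    let ?r = "\<lambda>x. Re (f x)" and ?i = "\<lambda>x. Im (f x)"
    have r: "continuous_on K ?r" and i: "continuous_on K ?i"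
      using cont_funD[OF f] by (intro continuous_intros; simp)+
    have real: "func (?c s) = complex_of_real (LINT x|R.\<nu>. s x)" if s: "continuous_on K s" for s
    proof -
      have "ccnj K (?c s) = ?c s" by (rule ext) (simp add: cfun_defs)
      hence "Im (func (?c s)) = 0" using func_cnj[OF c[OF s]] by (simp add: complex_eq_iff)
      thus ?thesis using R.l_eq_integral[OF s] by (simp add: complex_eq_iff)
    qed
    have "f = cadd K (?c ?r) (cscale K \<i> (?c ?i))"
      using f c[OF r] c[OF i] by (intro cont_fun_eqI[of _ K] cont_fun_ops) (auto simp: complex_eq_iff)
    hence "func f = complex_of_real (LINT x|R.\<nu>. ?r x) + \<i> * complex_of_real (LINT x|R.\<nu>. ?i x)"
      using c[OF r] c[OF i] real[OF r] real[OF i] by (metis func_add func_scale cont_fun_ops(3))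
    moreover have "integrable R.\<nu> f" by (rule integrable_continuous[OF K R.\<nu>_regular cont_funD[OF f]])
    ultimately show ?thesis by (simp add: complex_eq_iff)
  qed
  thus ?thesis using R.\<nu>_regular that by blast
qed

lemma measure_rep_dilation:
  assumes "\<And>f. f \<in> cont_fun K \<Longrightarrow> (LINT x|\<nu>. f x) = func f"
  shows "measure_rep K \<nu> S.L S.dil (S.v unit_fun unit_fun)"
  unfolding measure_rep_def
  using assms func_v S.dil_star_rep S.L.complex_hilbert_space_axioms S.v_carrier by simp

text \<open>If the state agrees with \<open>\<mu>\<close>, then \<open>f \<otimes> 1\<close> and \<open>1 \<otimes> f\<close> are vectors of the same length as
  \<open>f\<close> in \<open>L\<^sup>2(\<mu>)\<close>.  Multiplication by an affine function preserves their equality, because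
  the inner products that decide it involve \<open>\<Phi>\<close> only at affine functions and in the state.\<close>

theorem eq_gns_if_func_eq:
  assumes func: "\<And>f. f \<in> cont_fun K \<Longrightarrow> func f = (LINT x|\<mu>. f x)" and f: "f \<in> cont_fun K"
  shows "\<Phi> f = gns_rep K \<mu> f"
proof -
  define N where "N f = (LINT x|\<mu>. (cmod (f x))\<^sup>2)" for f :: "'a \<Rightarrow> complex"
  have N: "cinner (L2 \<mu>) (L2_class \<mu> f) (L2_class \<mu> f) = complex_of_real (N f)" if "f \<in> cont_fun K" for f
    using that by (simp add: N_def L2_cinner_self del: L2_cinner_class)
  have right: "cinner S.L (S.v unit_fun f) (S.v unit_fun f) = complex_of_real (N f)" if "f \<in> cont_fun K" for f
    using that by (simp only: gram_one N)
  have left: "cinner S.L (S.v f unit_fun) (S.v f unit_fun) = complex_of_real (N f)" if f: "f \<in> cont_fun K" for f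
  proof -
    have "cinner S.L (S.v f unit_fun) (S.v f unit_fun) = (LINT x|\<mu>. cmul K (ccnj K f) f x)"
      using func_sq[OF f] func[of "cmul K (ccnj K f) f"] f by simp
    also have "\<dots> = (LINT x|\<mu>. f x * cnj (f x))"
      by (rule Bochner_Integration.integral_cong) (simp_all add: space_\<mu> mult.commute)
    also have "\<dots> = complex_of_real (N f)" using N[OF f] f by simp
    finally show ?thesis .
  qed
  define M where "M = {p \<in> cont_fun K. S.v p unit_fun = S.v unit_fun p}"
  have all: "p \<in> M" if "p \<in> cont_fun K" for p
  proof (rule cont_fun_if_affine_module[OF K convex _ _ _ _ _ _ that])
    show "M \<subseteq> cont_fun K" "unit_fun \<in> M" by (auto simp: M_def)
    fix p q assume "p \<in> M" "q \<in> M"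
    thus "cadd K p q \<in> M" by (simp add: M_def S.v_add v_add_right)
  next
    fix p c assume "p \<in> M"
    thus "cscale K c p \<in> M" by (simp add: M_def S.v_scale v_scale_right)
  next
    fix a p assume a: "a \<in> cont_affine K" and p: "p \<in> M"
    have ac: "a \<in> cont_fun K" by (rule cont_affine_cont_fun[OF a])
    have pc: "p \<in> cont_fun K" and pv: "S.v p unit_fun = S.v unit_fun p" using p by (auto simp: M_def)
    have apc: "cmul K a p \<in> cont_fun K" using ac pc by simp
    have "S.v (cmul K a p) unit_fun = S.dil a (S.v p unit_fun)" using ac pc by (simp add: S.dil_v)
    also have "\<dots> = S.v a p" using ac pc by (simp add: pv S.dil_v)
    finally have step: "S.v (cmul K a p) unit_fun = S.v a p" .
    have "S.v (cmul K a p) unit_fun = S.v unit_fun (cmul K a p)"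
    proof (rule S.L.eq_if_cinner_self)
      have mixed: "cinner S.L (S.v (cmul K a p) unit_fun) (S.v unit_fun (cmul K a p)) = complex_of_real (N (cmul K a p))"
        unfolding step using ac pc apc
        by (simp only: gram cunit_mult cont_fun_ops affine_base[OF a pc] N)
      show "Re (cinner S.L (S.v (cmul K a p) unit_fun) (S.v (cmul K a p) unit_fun))
        - 2 * Re (cinner S.L (S.v (cmul K a p) unit_fun) (S.v unit_fun (cmul K a p)))
        + Re (cinner S.L (S.v unit_fun (cmul K a p)) (S.v unit_fun (cmul K a p))) = 0"
        unfolding mixed left[OF apc] right[OF apc] by simp
    qed (rule S.v_carrier)+
    thus "cmul K a p \<in> M" using apc by (simp add: M_def)
  next
    fix p assume p: "p \<in> cont_fun K" and approx: "\<And>e. 0 < e \<Longrightarrow> \<exists>q\<in>M. \<forall>x\<in>K. cmod (p x - q x) < e"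
    have bound: "S.L.si.nm (S.L.si.sub (S.v p unit_fun) (S.v unit_fun p)) \<le> 0 + e * (2 * sqrt (measure \<mu> K))"
      if e: "0 < e" for e
    proof -
      obtain q where q: "q \<in> M" "\<And>x. x \<in> K \<Longrightarrow> cmod (p x - q x) < e" using approx[OF e] by blast
      have qc: "q \<in> cont_fun K" and qv: "S.v q unit_fun = S.v unit_fun q" using q(1) by (auto simp: M_def)
      define d where "d = cadd K p (cscale K (-1) q)"
      have d: "d \<in> cont_fun K" using p qc by (simp add: d_def)
      have pd: "p = cadd K d q" using p qc d by (intro cont_fun_eqI[of _ K]) (auto simp: d_def)
      have "N d \<le> (LINT x|\<mu>. e\<^sup>2)"
        unfolding N_def
      proof (rule integral_mono)
        fix x assume "x \<in> space \<mu>"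
        thus "(cmod (d x))\<^sup>2 \<le> e\<^sup>2" using q(2)[of x] by (intro power_mono) (auto simp: d_def space_\<mu>)
      qed (use d in simp_all)
      hence "N d \<le> e\<^sup>2 * measure \<mu> K" by (simp add: space_\<mu> mult.commute)
      hence "sqrt (N d) \<le> sqrt (e\<^sup>2 * measure \<mu> K)" by simp
      hence Nd: "sqrt (N d) \<le> e * sqrt (measure \<mu> K)" using e by (simp add: real_sqrt_mult)
      have "S.L.si.nm (S.L.si.sub (S.v p unit_fun) (S.v unit_fun p))
          = S.L.si.nm (S.L.si.sub (S.v d unit_fun \<oplus>\<^bsub>S.L\<^esub> S.v q unit_fun) (S.v unit_fun d \<oplus>\<^bsub>S.L\<^esub> S.v q unit_fun))"
        using S.v_add[OF d qc, of unit_fun] v_add_right[OF _ d qc, of unit_fun] pd qv by simp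
      also have "\<dots> = S.L.si.nm (S.L.si.sub (S.v d unit_fun) (S.v unit_fun d))"
        by (simp add: S.L.si.nm_def algebra_simps)
      also have "\<dots> \<le> S.L.si.nm (S.v d unit_fun) + S.L.si.nm (S.v unit_fun d)"
        using S.L.si.nm_triangle[of "S.v d unit_fun" "(-1) \<odot>\<^bsub>S.L\<^esub> S.v unit_fun d"]
        by (simp add: S.L.si.sub_def S.L.si.nm_scal)
      also have "\<dots> = 2 * sqrt (N d)" using left[OF d] right[OF d] by (simp add: S.L.si.nm_def)
      finally show ?thesis using Nd by simp
    qed
    have "S.L.si.nm (S.L.si.sub (S.v p unit_fun) (S.v unit_fun p)) \<le> 0"
    proof (rule field_le_epsilon)
      fix e :: real assume e: "0 < e"
      define m where "m = 2 * sqrt (measure \<mu> K)"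
      have m: "0 \<le> m" by (simp add: m_def)
      have "S.L.si.nm (S.L.si.sub (S.v p unit_fun) (S.v unit_fun p)) \<le> 0 + e / (m + 1) * m"
        unfolding m_def by (rule bound) (use e in \<open>simp add: add_nonneg_pos\<close>)
      also have "\<dots> \<le> 0 + e" using e m by (simp add: field_simps)
      finally show "S.L.si.nm (S.L.si.sub (S.v p unit_fun) (S.v unit_fun p)) \<le> 0 + e" .
    qed
    moreover have "0 \<le> S.L.si.nm (S.L.si.sub (S.v p unit_fun) (S.v unit_fun p))"
      by (intro S.L.si.nm_nonneg S.L.si.sub_closed S.v_carrier)
    ultimately have "S.v p unit_fun = S.v unit_fun p" by (intro S.L.eq_if_dist_zero S.v_carrier) simp
    thus "p \<in> M" using p by (simp add: M_def)
  qed
  show ?thesis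
  proof (rule L2.bounded_ops_eq_if_cinner_dense[OF S.cp_op[OF f] gns_op[OF f] continuous_dense_in_L2])
    fix g h assume g: "g \<in> cont_fun K" and h: "h \<in> cont_fun K"
    have fg: "cmul K f g \<in> cont_fun K" using f g by simp
    have "S.v f g = S.dil f (S.v unit_fun g)" using f g by (simp add: S.dil_v)
    also have "S.v unit_fun g = S.v g unit_fun" using all[OF g] by (simp add: M_def)
    also have "S.dil f (S.v g unit_fun) = S.v (cmul K f g) unit_fun" by (rule S.dil_v[OF f g])
    also have "\<dots> = S.v unit_fun (cmul K f g)" using all[OF fg] by (simp add: M_def)
    finally have v: "S.v f g = S.v unit_fun (cmul K f g)" .
    have "cinner (L2 \<mu>) (\<Phi> f (L2_class \<mu> g)) (L2_class \<mu> h) = cinner S.L (S.v f g) (S.v unit_fun h)"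
      using f g h by (simp add: gram)
    also have "\<dots> = cinner (L2 \<mu>) (gns_rep K \<mu> f (L2_class \<mu> g)) (L2_class \<mu> h)"
      unfolding v gram_one[OF fg h] gns_mult[OF f g] ..
    finally show "cinner (L2 \<mu>) (\<Phi> f (L2_class \<mu> g)) (L2_class \<mu> h)
      = cinner (L2 \<mu>) (gns_rep K \<mu> f (L2_class \<mu> g)) (L2_class \<mu> h)" .
  qed
qed

end

text \<open>Functions of two arguments in \<open>'a \<Rightarrow> complex\<close> are coded by their graphs; triples are
  merged pointwise through an injection of the triples of complex numbers into the complex numbers.\<close>

lemma kernel_encoding:
  fixes e :: "('a \<Rightarrow> complex) set \<Rightarrow> 'h"
  assumes "inj e"
  obtains enc :: "(('a \<Rightarrow> complex) \<times> ('a \<Rightarrow> complex) \<Rightarrow> complex) \<Rightarrow> 'h" where "inj enc"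
proof -
  have inf: "infinite (UNIV :: complex set)" by (rule infinite_UNIV_char_0)
  obtain t :: "complex \<times> complex \<Rightarrow> complex" where t: "inj t"
  proof -
    have "\<exists>t. bij_betw t (UNIV \<times> UNIV :: (complex \<times> complex) set) (UNIV :: complex set)"
      using card_of_Times_same_infinite[OF inf] by (simp add: card_of_ordIso)
    thus ?thesis using that by (auto simp: bij_betw_def)
  qed
  define J :: "('a \<Rightarrow> complex) \<Rightarrow> ('a \<Rightarrow> complex) \<Rightarrow> complex \<Rightarrow> 'a \<Rightarrow> complex"
    where "J f g c = (\<lambda>a. t (f a, t (g a, c)))" for f g c
  have J: "f = f' \<and> g = g' \<and> c = c'" if "J f g c = J f' g' c'"
    for f g f' g' :: "'a \<Rightarrow> complex" and c c'
  proof -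
    have "(f a, t (g a, c)) = (f' a, t (g' a, c'))" for a
      using injD[OF t, of "(f a, t (g a, c))" "(f' a, t (g' a, c'))"] fun_cong[OF that, of a] by (simp add: J_def)
    hence f: "f a = f' a" and "t (g a, c) = t (g' a, c')" for a by auto
    hence "(g a, c) = (g' a, c')" for a using injD[OF t] by blast
    thus ?thesis using f by auto
  qed
  define graph where "graph F = range (\<lambda>(f, g). J f g (F (f, g)))" for F
  have "F = G" if FG: "graph F = graph G" for F G
  proof
    fix p :: "('a \<Rightarrow> complex) \<times> ('a \<Rightarrow> complex)"
    obtain f g where p: "p = (f, g)" by force
    have "J f g (F (f, g)) \<in> graph F" unfolding graph_def by (rule range_eqI[of _ _ "(f, g)"]) simp
    hence "J f g (F (f, g)) \<in> graph G" by (simp only: FG)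
    then obtain f' g' where "J f g (F (f, g)) = J f' g' (G (f', g'))" by (auto simp: graph_def)
    from J[OF this] show "F p = G p" unfolding p by auto
  qed
  hence "inj (\<lambda>F. e (graph F))" using assms by (auto simp: inj_def)
  thus ?thesis by (rule that)
qed

text \<open>Both \<open>\<Phi>\<close> and the GNS representation are dilated; as they agree on affine functions,
  \<open>1 \<otimes> f \<mapsto> 1 \<otimes> f\<close> embeds the dilation of the latter into that of the former.  This
  shows that \<open>\<mu>\<close> is below the state of \<open>\<Phi>\<close> in the dilation order.\<close>

theorem unique_extension_if_maximal:
  fixes K :: "'a::locally_convex_space set" and \<mu> :: "'a measure"
  assumes cK: "compact K" "convex K" and \<mu>: "\<mu> \<in> pos_measures K"
    and universe: "\<exists>e :: ('a \<Rightarrow> complex) set \<Rightarrow> 'h. inj e"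
    and max: "dilation_maximal TYPE('h) K \<mu>"
  shows "unique_extension_property K (L2 \<mu>) (gns_rep K \<mu>)"
proof -
  obtain e :: "('a \<Rightarrow> complex) set \<Rightarrow> 'h" where "inj e" using universe by blast
  then obtain enc :: "(('a \<Rightarrow> complex) \<times> ('a \<Rightarrow> complex) \<Rightarrow> complex) \<Rightarrow> 'h" where enc: "inj enc"
    by (rule kernel_encoding)
  interpret regular_measure K \<mu> by unfold_locales (fact cK(1), fact \<mu>)
  have ext: "gns_rep K \<mu> \<in> extensional (cont_fun K)" by (simp add: gns_rep_def)
  interpret A: affine_extension K \<mu> "gns_rep K \<mu>" enc
    by unfold_locales (fact cK(2), fact gns_completely_positive, rule refl, fact enc)
  let ?one = "cunit K"
  \<comment> \<open>The GNS representation is multiplicative, so its Stinespring space is a copy of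
      \<open>L\<^sup>2(\<mu>)\<close>: every combination of elementary tensors is one of the form \<open>1 \<otimes> g\<close>.\<close>
  have A_v: "A.S.v f g = A.S.v ?one (cmul K f g)" if f: "f \<in> cont_fun K" and g: "g \<in> cont_fun K" for f g
  proof (rule A.S.L.eq_if_cinner_self)
    have fg: "cmul K f g \<in> cont_fun K" using f g by simp
    have ff: "cmul K (ccnj K f) f \<in> cont_fun K" using f by simp
    have 1: "cinner A.S.L (A.S.v f g) (A.S.v f g) = cinner (L2 \<mu>) (L2_class \<mu> (cmul K f g)) (L2_class \<mu> (cmul K f g))"
    proof -
      have "cinner A.S.L (A.S.v f g) (A.S.v f g)
          = (LINT x|\<mu>. cmul K (cmul K (ccnj K f) f) g x * cnj (g x))"
        using f g ff by (simp only: A.gram gns_mult L2_cinner_class cont_fun_sq_integrable cont_fun_ops)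
      also have "\<dots> = (LINT x|\<mu>. cmul K f g x * cnj (cmul K f g x))"
        by (rule Bochner_Integration.integral_cong) (simp_all add: space_\<mu> mult_ac)
      finally show ?thesis using fg by simp
    qed
    have 2: "cinner A.S.L (A.S.v f g) (A.S.v ?one (cmul K f g))
        = cinner (L2 \<mu>) (L2_class \<mu> (cmul K f g)) (L2_class \<mu> (cmul K f g))"
      using f g fg by (simp only: A.gram cunit_mult cont_fun_ops gns_mult)
    show "Re (cinner A.S.L (A.S.v f g) (A.S.v f g)) - 2 * Re (cinner A.S.L (A.S.v f g) (A.S.v ?one (cmul K f g)))
      + Re (cinner A.S.L (A.S.v ?one (cmul K f g)) (A.S.v ?one (cmul K f g))) = 0"
      unfolding 1 2 A.gram_one[OF fg fg] by simp
  qed (rule A.S.v_carrier)+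
  have A_lin: "\<exists>g\<in>cont_fun K. A.S.kernel.lin xs = A.S.v ?one g" for xs
  proof (induction xs)
    case Nil
    have "A.S.kernel.lin [] = 0 \<odot>\<^bsub>A.S.L\<^esub> A.S.v ?one ?one"
      by (simp add: A.S.kernel.lin_def A.S.v_def A.S.kernel.vec_def A.S.kernel.combination_def A.S.kernel.space_simps)
    also have "\<dots> = A.S.v ?one (cscale K 0 ?one)" by (rule A.v_scale_right[symmetric]) simp_all
    finally have "A.S.kernel.lin [] = A.S.v ?one (cscale K 0 ?one)" .
    moreover have "cscale K 0 ?one \<in> cont_fun K" by simp
    ultimately show ?case by blast
  next
    case (Cons y xs)
    then obtain g where g: "g \<in> cont_fun K" "A.S.kernel.lin xs = A.S.v ?one g" by blast
    obtain c f j where y: "y = (c, (f, j))" by (metis prod.exhaust)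
    define k where "k = cmul K (A.S.clamp f) (if j \<in> cont_fun K then j else ?one)"
    have k: "k \<in> cont_fun K" by (simp add: k_def)
    have "A.S.v f j = A.S.v (A.S.clamp f) (if j \<in> cont_fun K then j else ?one)"
      by (rule A.S.eq_if_cinner_v) (simp_all add: A.S.v_clamp A.S.cinner_v A.base_def A.S.v_def
          A.S.kernel.cinner_vec_vec A.S.kern_def)
    also have "\<dots> = A.S.v ?one k" unfolding k_def by (rule A_v) simp_all
    finally have vk: "A.S.v f j = A.S.v ?one k" .
    have "A.S.kernel.lin (y # xs) = c \<odot>\<^bsub>A.S.L\<^esub> A.S.v f j \<oplus>\<^bsub>A.S.L\<^esub> A.S.kernel.lin xs"
      by (simp add: A.S.kernel.lin_def A.S.v_def A.S.kernel.vec_def A.S.kernel.combination_def A.S.kernel.space_simps y)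
        (subst A.S.kernel.form_Cons_left, simp add: A.S.kernel.basic_def)
    also have "\<dots> = A.S.v ?one (cadd K (cscale K c k) g)"
      using k g by (simp add: vk A.v_add_right A.v_scale_right)
    finally have "A.S.kernel.lin (y # xs) = A.S.v ?one (cadd K (cscale K c k) g)" .
    moreover have "cadd K (cscale K c k) g \<in> cont_fun K" using k g by simp
    ultimately show ?case by blast
  qed
  have A_dense: "dense_family A.S.L (cont_fun K) (A.S.v ?one)"
    unfolding dense_family_def
  proof (intro conjI ballI allI impI A.S.v_carrier)
    fix u and e :: real assume "u \<in> carrier A.S.L" "0 < e"
    then obtain xs where xs: "hnorm A.S.L (u \<ominus>\<^bsub>A.S.L\<^esub> A.S.kernel.lin xs) < e"
      using A.S.kernel.lin_dense unfolding dense_family_def by blast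
    obtain g where "g \<in> cont_fun K" "A.S.kernel.lin xs = A.S.v ?one g" using A_lin by blast
    thus "\<exists>g\<in>cont_fun K. hnorm A.S.L (u \<ominus>\<^bsub>A.S.L\<^esub> A.S.v ?one g) < e" using xs by metis
  qed
  have unique: "\<Phi> = gns_rep K \<mu>" if \<Phi>: "\<Phi> \<in> extensional (cont_fun K)" "completely_positive K (L2 \<mu>) \<Phi>"
    "\<forall>a\<in>cont_affine K. \<Phi> a = gns_rep K \<mu> a" for \<Phi>
  proof -
    interpret B: affine_extension K \<mu> \<Phi> enc
      by unfold_locales (fact cK(2), fact \<Phi>(2), use \<Phi>(3) in blast, fact enc)
    obtain \<nu> where \<nu>: "\<nu> \<in> pos_measures K" "\<And>f. f \<in> cont_fun K \<Longrightarrow> (LINT x|\<nu>. f x) = B.func f"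
      by (rule B.func_measure) blast
    interpret AB: hilbert_pair A.S.L B.S.L ..
    obtain V where V: "V \<in> isometries A.S.L B.S.L" "\<And>g. g \<in> cont_fun K \<Longrightarrow> V (A.S.v ?one g) = B.S.v ?one g"
      by (rule AB.isometry_extending_Gram[OF A_dense, of "B.S.v ?one"])
        (simp_all only: A.gram_one B.gram_one B.S.v_carrier)
    interpret c: compressed_representation A.S.L B.S.L K B.S.dil V
      by unfold_locales (use V(1) in \<open>simp add: isometries_def\<close>)
    have dil: "A.S.dil a = compression K A.S.L B.S.L B.S.dil V a" if a: "a \<in> cont_affine K" for a
    proof (rule A.S.L.bounded_ops_eq_if_cinner_dense[OF _ _ A_dense])
      have ac: "a \<in> cont_fun K" by (rule cont_affine_cont_fun[OF a])
      show "A.S.dil a \<in> bounded_ops A.S.L A.S.L" by (rule A.S.dil_op[OF ac])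
      show "compression K A.S.L B.S.L B.S.dil V a \<in> bounded_ops A.S.L A.S.L" by (rule c.compression_op[OF ac])
      fix g h assume g: "g \<in> cont_fun K" and h: "h \<in> cont_fun K"
      have "cinner A.S.L (compression K A.S.L B.S.L B.S.dil V a (A.S.v ?one g)) (A.S.v ?one h)
          = cinner B.S.L (B.S.v a g) (B.S.v ?one h)"
        using ac g h c.cinner_compression[OF ac A.S.v_carrier A.S.v_carrier, of ?one g ?one h]
        by (simp add: V(2) B.S.dil_v)
      also have "\<dots> = cinner A.S.L (A.S.v a g) (A.S.v ?one h)"
        using ac g h by (simp add: A.gram B.gram B.affine[OF a])
      also have "\<dots> = cinner A.S.L (A.S.dil a (A.S.v ?one g)) (A.S.v ?one h)"
        using ac g by (simp add: A.S.dil_v)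
      finally show "cinner A.S.L (A.S.dil a (A.S.v ?one g)) (A.S.v ?one h)
        = cinner A.S.L (compression K A.S.L B.S.L B.S.dil V a (A.S.v ?one g)) (A.S.v ?one h)" by simp
    qed
    have "dilated_by K A.S.L A.S.dil (A.S.v ?one ?one) B.S.L B.S.dil (B.S.v ?one ?one)"
      unfolding dilated_by_def
    proof (intro bexI[OF _ V(1)] conjI ballI)
      fix a assume a: "a \<in> cont_affine K"
      show "A.S.dil a = compose (carrier A.S.L) (hadjoint A.S.L B.S.L V) (compose (carrier A.S.L) (B.S.dil a) V)"
        unfolding dil[OF a] using cont_affine_cont_fun[OF a] by (simp only: compression_def restrict_apply')
    qed (simp add: V(2))
    moreover have "measure_rep K \<mu> A.S.L A.S.dil (A.S.v ?one ?one)"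
      by (rule A.measure_rep_dilation) (simp only: A.func_def measure_repD(4)[OF measure_rep_gns])
    moreover have "measure_rep K \<nu> B.S.L B.S.dil (B.S.v ?one ?one)"
      by (rule B.measure_rep_dilation[OF \<nu>(2)])
    ultimately have "dilation_le TYPE('h) K \<mu> \<nu>" unfolding dilation_le_def by blast
    hence "\<nu> = \<mu>" using max \<nu>(1) unfolding dilation_maximal_def by blast
    hence "B.func f = (LINT x|\<mu>. f x)" if "f \<in> cont_fun K" for f using \<nu>(2)[OF that] by simp
    hence "\<Phi> f = gns_rep K \<mu> f" if "f \<in> cont_fun K" for f using B.eq_gns_if_func_eq that by blast
    thus ?thesis by (rule extensionalityI[OF \<Phi>(1) ext])
  qed
  show ?thesis
    unfolding unique_extension_property_def
    by (rule ex1I[of _ "gns_rep K \<mu>"]) (use ext gns_completely_positive unique in auto)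
qed

theorem theorem7p6:
  fixes K :: "'a::locally_convex_space set" and \<mu> :: "'a measure"
  assumes "compact K" and "convex K" and "\<mu> \<in> pos_measures K"
    and universe: "\<exists>e :: ('a \<Rightarrow> complex) set \<Rightarrow> 'h. inj e"
  shows "dilation_maximal TYPE('h) K \<mu> \<longleftrightarrow> unique_extension_property K (L2 \<mu>) (gns_rep K \<mu>)"
proof
  assume "dilation_maximal TYPE('h) K \<mu>"
  thus "unique_extension_property K (L2 \<mu>) (gns_rep K \<mu>)"
    by (rule unique_extension_if_maximal[OF assms])
next
  assume "unique_extension_property K (L2 \<mu>) (gns_rep K \<mu>)"
  thus "dilation_maximal TYPE('h) K \<mu>"
    unfolding dilation_maximal_def dilation_le_def
    by (auto intro: maximal_if_unique_extension[OF assms(1-3)])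
qed

end
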